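(* Let $T_0>0$, let $S^1=\mathbb R/\mathbb Z$ and let $V\in C^2(\mathbb R\times S^1)$, $V=V(t,x)$, be periodic in $t$ with minimal period $T_0$. Suppose that the equation $\ddot x+V'_x(t,x)=0$, $x\in S^1$, is non-resonant. Then for every $\rho=\frac{k_1}{k_2T_0}$ with $k_1\in\mathbb Z$ and $k_2\in\mathbb N$, $k_2\ge 1$, coprime, there is an integer $r>0$ such that the equation has exactly $2r$ fundamental solutions of rotation frequency $\rho$, and the equation has infinitely many non-fundamental solutions of rotation frequency $\rho$.
   Context: $V'_x$ and $V''$ denote the first and second derivatives of $V$ with respect to $x$. For $k_1\in\mathbb Z$, $k_2\ge1$ put $$C^2_{k_1,k_2T_0}=\{[x] : x\in C^2(\mathbb R,\mathbb R),\ x(t+k_2T_0)=x(t)+k_1 \ \forall t\},\qquad [x]=x \bmod 1,$$ so two real-valued lifts differing by an integer constant represent the same element (a curve in $S^1$). One has $C^2_{k_1,k_2T_0}\subset C^2_{mk_1,mk_2T_0}$ for every integer $m\ge 1$. A periodic solution is a solution of the equation belonging to some $C^2_{k_1,k_2T_0}$; its rotation frequency is then $\rho(x)=\frac{k_1}{k_2T_0}$. If $k_1,k_2$ are coprime, the set of periodic functions of rotation frequency $\rho=\frac{k_1}{k_2T_0}$ is $\bigcup_{m\ge1}C^2_{mk_1,mk_2T_0}$. A periodic solution $x$ of rotation frequency $\rho=\frac{k_1}{k_2T_0}$ ($k_1,k_2$ coprime) is called fundamental if $x\in C^2_{k_1,k_2T_0}$, and non-fundamental otherwise. A periodic solution $x(t)$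 is called non-resonant if the linearized equation $\ddot y+V''(t,x(t))y=0$ has no periodic solution (of any period) other than $y\equiv0$. The equation is called non-resonant if all its periodic solutions are non-resonant. *)

theory Defs
  imports "HOL-Analysis.Analysis"
begin

text \<open>Twice continuously (Frechet) differentiable on the whole space; used for curves
  \<open>\<real> \<rightarrow> \<real>\<close> as well as for functions on \<open>\<real> \<times> \<real>\<close>.\<close>

definition C2_fun :: "('a::real_normed_vector \<Rightarrow> 'b::real_normed_vector) \<Rightarrow> bool" where
  "C2_fun f \<longleftrightarrow>
     (\<exists>(f' :: 'a \<Rightarrow> 'a \<Rightarrow>\<^sub>L 'b) (f'' :: 'a \<Rightarrow> 'a \<Rightarrow>\<^sub>L 'a \<Rightarrow>\<^sub>L 'b).
        (\<forall>z. (f has_derivative blinfun_apply (f' z)) (at z)) \<and>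
        (\<forall>z. (f' has_derivative blinfun_apply (f'' z)) (at z)) \<and>
        continuous_on UNIV f'')"

text \<open>A function on \<open>\<real> \<times> S\<^sup>1\<close>, with \<open>S\<^sup>1 = \<real>/\<int>\<close>, is given by its lift to
  \<open>\<real> \<times> \<real>\<close>, which is 1-periodic in the second variable.\<close>

definition C2_cylinder :: "(real \<Rightarrow> real \<Rightarrow> real) \<Rightarrow> bool" where
  "C2_cylinder V \<longleftrightarrow> C2_fun (\<lambda>(t, x). V t x) \<and> (\<forall>t x. V t (x + 1) = V t x)"

definition time_period :: "(real \<Rightarrow> real \<Rightarrow> real) \<Rightarrow> real \<Rightarrow> bool" where
  "time_period V T \<longleftrightarrow> T > 0 \<and> (\<forall>t x. V (t + T) x = V t x)"

definition minimal_time_period :: "(real \<Rightarrow> real \<Rightarrow> real) \<Rightarrow> real \<Rightarrow> bool" where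
  "minimal_time_period V T0 \<longleftrightarrow> time_period V T0 \<and> (\<forall>T. time_period V T \<longrightarrow> T0 \<le> T)"

definition V_x :: "(real \<Rightarrow> real \<Rightarrow> real) \<Rightarrow> real \<Rightarrow> real \<Rightarrow> real" where
  "V_x V t x = deriv (\<lambda>u. V t u) x"

definition V_xx :: "(real \<Rightarrow> real \<Rightarrow> real) \<Rightarrow> real \<Rightarrow> real \<Rightarrow> real" where
  "V_xx V t x = deriv (\<lambda>u. V_x V t u) x"

text \<open>The curve \<open>x mod 1\<close> in \<open>S\<^sup>1\<close>, represented by the set of its lifts.\<close>

definition curve_mod1 :: "(real \<Rightarrow> real) \<Rightarrow> (real \<Rightarrow> real) set" where
  "curve_mod1 x = {y. \<exists>n::int. \<forall>t. y t = x t + of_int n}"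

definition C2_curves :: "real \<Rightarrow> int \<Rightarrow> nat \<Rightarrow> (real \<Rightarrow> real) set set" where
  "C2_curves T0 k1 k2 =
     {curve_mod1 x | x. C2_fun x \<and> (\<forall>t. x (t + real k2 * T0) = x t + of_int k1)}"

definition solves :: "(real \<Rightarrow> real \<Rightarrow> real) \<Rightarrow> (real \<Rightarrow> real) \<Rightarrow> bool" where
  "solves V x \<longleftrightarrow> C2_fun x \<and> (\<forall>t. deriv (deriv x) t + V_x V t (x t) = 0)"

text \<open>If \<open>V\<close> is 1-periodic in its second variable, the next three notions
  do not depend on the choice of the lift.\<close>

definition solution_curve ::
  "(real \<Rightarrow> real \<Rightarrow> real) \<Rightarrow> (real \<Rightarrow> real) set \<Rightarrow> bool" where
  "solution_curve V c \<longleftrightarrow> (\<exists>x. c = curve_mod1 x \<and> solves V x)"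

definition periodic_solution ::
  "(real \<Rightarrow> real \<Rightarrow> real) \<Rightarrow> real \<Rightarrow> (real \<Rightarrow> real) set \<Rightarrow> bool" where
  "periodic_solution V T0 c \<longleftrightarrow>
     solution_curve V c \<and> (\<exists>k1 k2. k2 \<ge> 1 \<and> c \<in> C2_curves T0 k1 k2)"

definition non_resonant_solution ::
  "(real \<Rightarrow> real \<Rightarrow> real) \<Rightarrow> (real \<Rightarrow> real) set \<Rightarrow> bool" where
  "non_resonant_solution V c \<longleftrightarrow>
     (\<forall>x\<in>c. \<forall>y. C2_fun y \<and> (\<forall>t. deriv (deriv y) t + V_xx V t (x t) * y t = 0) \<and>
               (\<exists>T>0. \<forall>t. y (t + T) = y t)
        \<longrightarrow> (\<forall>t. y t = 0))"

definition non_resonant_equation :: "(real \<Rightarrow> real \<Rightarrow> real) \<Rightarrow> real \<Rightarrow> bool" where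
  "non_resonant_equation V T0 \<longleftrightarrow>
     (\<forall>c. periodic_solution V T0 c \<longrightarrow> non_resonant_solution V c)"

definition has_rotation_frequency ::
  "real \<Rightarrow> (real \<Rightarrow> real) set \<Rightarrow> real \<Rightarrow> bool" where
  "has_rotation_frequency T0 c \<rho> \<longleftrightarrow>
     (\<exists>k1 k2. k2 \<ge> 1 \<and> c \<in> C2_curves T0 k1 k2 \<and> \<rho> = of_int k1 / (real k2 * T0))"

definition fundamental :: "real \<Rightarrow> (real \<Rightarrow> real) set \<Rightarrow> real \<Rightarrow> bool" where
  "fundamental T0 c \<rho> \<longleftrightarrow>
     (\<exists>k1 k2. k2 \<ge> 1 \<and> coprime k1 (int k2) \<and> \<rho> = of_int k1 / (real k2 * T0) \<and>
              c \<in> C2_curves T0 k1 k2)"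

definition fundamental_solutions ::
  "(real \<Rightarrow> real \<Rightarrow> real) \<Rightarrow> real \<Rightarrow> real \<Rightarrow> (real \<Rightarrow> real) set set" where
  "fundamental_solutions V T0 \<rho> =
     {c. periodic_solution V T0 c \<and> has_rotation_frequency T0 c \<rho> \<and> fundamental T0 c \<rho>}"

definition non_fundamental_solutions ::
  "(real \<Rightarrow> real \<Rightarrow> real) \<Rightarrow> real \<Rightarrow> real \<Rightarrow> (real \<Rightarrow> real) set set" where
  "non_fundamental_solutions V T0 \<rho> =
     {c. periodic_solution V T0 c \<and> has_rotation_frequency T0 c \<rho> \<and> \<not> fundamental T0 c \<rho>}"

end

theory Submission
  imports Defs
begin

text \<open>
  Solutions with \<open>x (t + K T0) = x t + \<kappa>\<close> are the zeros of the return map \<open>\<Phi> z - z - \<kappa>\<close> on the cylinder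
  of initial data \<open>z = (x 0, x' 0)\<close>, where \<open>\<Phi>\<close> is the time \<open>K T0\<close> map. Non-resonance makes every
  zero nondegenerate, hence isolated, and velocities are bounded a priori, so there are finitely many. Read as
  a complex function, the return map has positive real part at the top of the cylinder and negative real part
  at the bottom; comparing the increments of a logarithm at both ends shows that the number of zeros is even.

  Existence is variational. Broken trajectories with short links turn the action into a coercive function
  \<open>W\<close> of finitely many nodes, so its minimum is attained in each class. In the class \<open>(m K, m \<kappa>)\<close>, either the
  minimizer is new, or the \<open>m\<close>-fold iterate of a minimizer \<open>p\<close> of the class \<open>(K, \<kappa>)\<close> and its translate
  by 1 are strict local minima, and a mountain pass between them gives a critical value \<open>c\<close> with
  \<open>m W(p) < c \<le> m W(p) + const\<close>. The \<open>m\<close>-fold iterates of the finitely many fundamental solutions \<open>y\<close> have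
  action \<open>m W(y)\<close>, which avoids this window for large \<open>m\<close>. So every large \<open>m\<close> yields a
  non-fundamental solution, and distinct primes \<open>m\<close> yield distinct ones.
\<close>

section \<open>Zeros of a periodic map of the plane\<close>

text \<open>A nondegenerate zero counts +1 or -1 according to the orientation of its derivative.
  Either sign changes the difference of the two end increments by 2 modulo 4, which is why the count
  is kept modulo 4 and yields a parity. Increments are measured in units of \<open>\<i> * pi\<close>
  and not \<open>2 * \<i> * pi\<close>: the model function with simple zeros at the integer
  translates of one point is a sine, which changes sign under \<open>z + 1\<close>, so the
  successive quotients alternate between periodic and antiperiodic. On the variational side, short
  links replace function spaces by finitely many reals, with compact sublevel sets modulo integer
  translations. A first order expansion with quadratic error is all the smoothness needed: it makes
  one explicit gradient step lower the action. The obstacle is uniformity in \<open>m\<close>: the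
  height of the pass must not depend on the number of links, so the path moves one node at a time
  and the bounds use the velocity bound of the base class. Non-resonance enters twice: for the base
  class it gives finiteness, and for the iterated class, whose period is \<open>m\<close> times
  longer, it isolates the iterated minimizer.\<close>

definition log_increment :: "(complex \<Rightarrow> complex) \<Rightarrow> complex set \<Rightarrow> int \<Rightarrow> bool" where
  "log_increment F U p \<longleftrightarrow>
     (\<exists>g. continuous_on U g \<and> (\<forall>z\<in>U. F z = exp (g z) \<and> g (z + 1) = g z + \<i> * (of_real pi * of_int p)))"

text \<open>Two logarithms of one number differ by a multiple of \<open>2 * pi * \<i>\<close>, so
  the values of \<open>d\<close> are at least \<open>2 * pi\<close> apart, and a continuous function
  with such a range is constant on a connected set.\<close>

lemma continuous_exp_constant:
  fixes d :: "complex \<Rightarrow> complex"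
  assumes "connected U" "continuous_on U d" "\<And>z. z \<in> U \<Longrightarrow> exp (d z) = c" "x \<in> U" "y \<in> U"
  shows "d x = d y"
proof -
  have "d constant_on U"
  proof (rule continuous_discrete_range_constant[OF assms(1,2)])
    fix x assume x: "x \<in> U"
    show "\<exists>e>0. \<forall>y. y \<in> U \<and> d y \<noteq> d x \<longrightarrow> e \<le> norm (d y - d x)"
    proof (intro exI[of _ "2*pi"] conjI allI impI)
      fix y assume y: "y \<in> U \<and> d y \<noteq> d x"
      then have "exp (d y) = exp (d x)" using assms(3) x by auto
      then obtain n::int where n: "d y = d x + of_int (2 * n) * pi * \<i>" unfolding exp_eq by blast
      then have "n \<noteq> 0" using y by auto
      then have "\<bar>of_int n::real\<bar> \<ge> 1" by linarith
      have "norm (d y - d x) = 2 * pi * \<bar>of_int n\<bar>" using n by (simp add: norm_mult)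
      then show "2*pi \<le> norm (d y - d x)" using \<open>\<bar>of_int n::real\<bar> \<ge> 1\<close> by simp
    qed simp
  qed
  then show ?thesis using assms(4,5) unfolding constant_on_def by auto
qed

text \<open>The difference of two logarithms of \<open>F\<close> is a logarithm of 1, hence
  constant, and so takes equal values at \<open>z\<close> and \<open>z + 1\<close>.\<close>

lemma log_increment_unique:
  assumes "connected U" "z \<in> U" "\<And>z. z \<in> U \<Longrightarrow> z + 1 \<in> U"
    and "log_increment F U p" "log_increment F U q"
  shows "p = q"
proof -
  obtain g where g: "continuous_on U g" "\<And>z. z \<in> U \<Longrightarrow> F z = exp (g z)"
    "\<And>z. z \<in> U \<Longrightarrow> g (z + 1) = g z + \<i> * (of_real pi * of_int p)"
    using assms(4) unfolding log_increment_def by blast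
  obtain k where k: "continuous_on U k" "\<And>z. z \<in> U \<Longrightarrow> F z = exp (k z)"
    "\<And>z. z \<in> U \<Longrightarrow> k (z + 1) = k z + \<i> * (of_real pi * of_int q)"
    using assms(5) unfolding log_increment_def by blast
  have "g z - k z = g (z+1) - k (z+1)"
  proof (rule continuous_exp_constant[OF assms(1), of "\<lambda>z. g z - k z" 1])
    show "exp (g z - k z) = 1" if "z \<in> U" for z
      using g(2)[OF that] k(2)[OF that] by (simp add: exp_diff)
  qed (auto intro!: continuous_intros g k assms)
  then have "\<i> * (of_real pi * of_int p) = \<i> * (of_real pi * of_int q)"
    using g(3)[OF assms(2)] k(3)[OF assms(2)] by (simp add: algebra_simps)
  then show ?thesis by simp
qed

lemma log_increment_subset: "log_increment F U p \<Longrightarrow> V \<subseteq> U \<Longrightarrow> log_increment F V p"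
  unfolding log_increment_def by (meson continuous_on_subset subsetD)

lemma log_increment_divide:
  assumes "log_increment F U p" "log_increment G U q" "\<And>z. z \<in> U \<Longrightarrow> H z = F z / G z"
  shows "log_increment H U (p - q)"
proof -
  obtain g where g: "continuous_on U g" "\<And>z. z \<in> U \<Longrightarrow> F z = exp (g z)"
    "\<And>z. z \<in> U \<Longrightarrow> g (z + 1) = g z + \<i> * (of_real pi * of_int p)"
    using assms(1) unfolding log_increment_def by blast
  obtain k where k: "continuous_on U k" "\<And>z. z \<in> U \<Longrightarrow> G z = exp (k z)"
    "\<And>z. z \<in> U \<Longrightarrow> k (z + 1) = k z + \<i> * (of_real pi * of_int q)"
    using assms(2) unfolding log_increment_def by blast
  show ?thesis unfolding log_increment_def
    by (rule exI[of _ "\<lambda>z. g z - k z"])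
       (auto intro!: continuous_intros g k simp: assms(3) g(2,3) k(2,3) exp_diff algebra_simps)
qed

lemma log_increment_right_half_plane:
  assumes "continuous_on U F" "\<And>z. z \<in> U \<Longrightarrow> Re (F z) > 0" "\<And>z. z \<in> U \<Longrightarrow> F (z + 1) = F z"
  shows "log_increment F U 0"
  unfolding log_increment_def
proof (intro exI[of _ "\<lambda>z. Ln (F z)"] conjI ballI)
  show "continuous_on U (\<lambda>z. Ln (F z))"
    using assms by (intro continuous_intros) (auto simp: complex_nonpos_Reals_iff dest!: assms(2))
  fix z assume "z \<in> U"
  then show "F z = exp (Ln (F z))" using assms(2)[of z] by (subst exp_Ln) auto
  show "Ln (F (z + 1)) = Ln (F z) + \<i> * (complex_of_real pi * of_int 0)"
    using assms(3)[OF \<open>z \<in> U\<close>] by simp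
qed

text \<open>The principal logarithm of \<open>H\<close> is continuous and periodic, and a constant
  factor only adds a constant to the logarithm: neither contributes to the increment. All later
  increments are found by splitting off such factors.\<close>

lemma log_increment_mult_right_half_plane:
  assumes "log_increment F U p" "continuous_on U H" "\<And>z. z \<in> U \<Longrightarrow> Re (H z) > 0"
    "\<And>z. z \<in> U \<Longrightarrow> H (z + 1) = H z" "c \<noteq> 0" "\<And>z. z \<in> U \<Longrightarrow> G z = c * F z * H z"
  shows "log_increment G U p"
proof -
  obtain g where g: "continuous_on U g" "\<And>z. z \<in> U \<Longrightarrow> F z = exp (g z)"
    "\<And>z. z \<in> U \<Longrightarrow> g (z + 1) = g z + \<i> * (of_real pi * of_int p)"
    using assms(1) unfolding log_increment_def by blast
  obtain k where k: "continuous_on U k" "\<And>z. z \<in> U \<Longrightarrow> H z = exp (k z)"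
    "\<And>z. z \<in> U \<Longrightarrow> k (z + 1) = k z + \<i> * (of_real pi * of_int 0)"
    using log_increment_right_half_plane[OF assms(2-4)] unfolding log_increment_def by blast
  show ?thesis unfolding log_increment_def
    by (rule exI[of _ "\<lambda>z. Ln c + g z + k z"])
       (use assms(5) in \<open>auto intro!: continuous_intros g k simp: assms(6) g(2,3) k(2,3) exp_add algebra_simps\<close>)
qed

lemma log_increment_cnj:
  assumes "log_increment F U p"
  shows "log_increment (\<lambda>z. cnj (F z)) U (- p)"
proof -
  obtain g where g: "continuous_on U g" "\<And>z. z \<in> U \<Longrightarrow> F z = exp (g z)"
    "\<And>z. z \<in> U \<Longrightarrow> g (z + 1) = g z + \<i> * (of_real pi * of_int p)"
    using assms(1) unfolding log_increment_def by blast
  show ?thesis unfolding log_increment_def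
    by (rule exI[of _ "\<lambda>z. cnj (g z)"])
       (auto intro!: continuous_intros g simp: g(2,3) exp_cnj)
qed

section \<open>The sine and its real-linear images on half planes\<close>

lemma sin_pi_as_exp:
  fixes z w :: complex
  shows "sin (pi * (z - w)) = (\<i>/2) * exp (- \<i> * (of_real pi * (z - w))) * (1 - exp (2 * \<i> * (of_real pi * (z - w))))"
    and "sin (pi * (z - w)) = (- \<i>/2) * exp (\<i> * (of_real pi * (z - w))) * (1 - exp (- 2 * \<i> * (of_real pi * (z - w))))"
  unfolding sin_exp_eq by (simp_all add: algebra_simps exp_add[symmetric] exp_diff[symmetric] divide_simps)

lemma exp_2pi_shift: "exp (2 * \<i> * (of_real pi * (z + 1 - w))) = exp (2 * \<i> * (of_real pi * (z - w)))"
  "exp (- 2 * \<i> * (of_real pi * (z + 1 - w))) = exp (- 2 * \<i> * (of_real pi * (z - w)))"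
proof -
  have "2 * \<i> * (of_real pi * (z + 1 - w)) = 2 * \<i> * (of_real pi * (z - w)) + 2 * of_real pi * \<i>"
    by (simp add: algebra_simps)
  then show "exp (2 * \<i> * (of_real pi * (z + 1 - w))) = exp (2 * \<i> * (of_real pi * (z - w)))"
    by (simp only: exp_add exp_two_pi_i mult_1_right)
  have "- 2 * \<i> * (of_real pi * (z + 1 - w)) = - 2 * \<i> * (of_real pi * (z - w)) - 2 * of_real pi * \<i>"
    by (simp add: algebra_simps)
  then show "exp (- 2 * \<i> * (of_real pi * (z + 1 - w))) = exp (- 2 * \<i> * (of_real pi * (z - w)))"
    by (simp only: exp_diff exp_two_pi_i div_by_1)
qed

text \<open>Above \<open>w\<close> the term \<open>exp (- \<i> * pi * (z - w))\<close> dominates the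
  sine. Once it is factored out, 1 minus a number of modulus below 1 remains, which lies in the
  right half plane. Below \<open>w\<close> the other exponential dominates and the sign
  flips.\<close>

lemma log_increment_sin_upper:
  "log_increment (\<lambda>z. sin (of_real pi * (z - w))) {z. Im z > Im w} (-1)"
proof (rule log_increment_mult_right_half_plane[OF _ _ _ _ _ sin_pi_as_exp(1)])
  show "log_increment (\<lambda>z. exp (- \<i> * (complex_of_real pi * (z - w)))) {z. Im z > Im w} (-1)"
    unfolding log_increment_def
    by (rule exI[of _ "\<lambda>z. - \<i> * (complex_of_real pi * (z - w))"])
       (auto intro!: continuous_intros simp: algebra_simps)
  fix z assume z: "z \<in> {z. Im z > Im w}"
  have "norm (exp (2 * \<i> * (complex_of_real pi * (z - w)))) < 1" using z by simp
  then show "0 < Re (1 - exp (2 * \<i> * (complex_of_real pi * (z - w))))"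
    using complex_Re_le_cmod[of "exp (2 * \<i> * (complex_of_real pi * (z - w)))"] by (simp del: norm_exp_eq_Re)
  show "1 - exp (2 * \<i> * (of_real pi * (z + 1 - w))) = 1 - exp (2 * \<i> * (of_real pi * (z - w)))"
    by (simp only: exp_2pi_shift)
qed (auto intro!: continuous_intros)

lemma log_increment_sin_lower:
  "log_increment (\<lambda>z. sin (of_real pi * (z - w))) {z. Im z < Im w} 1"
proof (rule log_increment_mult_right_half_plane[OF _ _ _ _ _ sin_pi_as_exp(2)])
  show "log_increment (\<lambda>z. exp (\<i> * (complex_of_real pi * (z - w)))) {z. Im z < Im w} 1"
    unfolding log_increment_def
    by (rule exI[of _ "\<lambda>z. \<i> * (complex_of_real pi * (z - w))"])
       (auto intro!: continuous_intros simp: algebra_simps)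
  fix z assume z: "z \<in> {z. Im z < Im w}"
  have "norm (exp (- 2 * \<i> * (complex_of_real pi * (z - w)))) < 1" using z by (simp add: mult_pos_neg)
  then show "0 < Re (1 - exp (- 2 * \<i> * (complex_of_real pi * (z - w))))"
    using complex_Re_le_cmod[of "exp (- 2 * \<i> * (complex_of_real pi * (z - w)))"] by (simp del: norm_exp_eq_Re)
  show "1 - exp (- 2 * \<i> * (of_real pi * (z + 1 - w))) = 1 - exp (- 2 * \<i> * (of_real pi * (z - w)))"
    by (simp only: exp_2pi_shift)
qed (auto intro!: continuous_intros)

text \<open>The coefficients are the Wirtinger derivatives \<open>(D 1 - \<i> * D \<i>) / 2\<close>
  and \<open>(D 1 + \<i> * D \<i>) / 2\<close>.\<close>

lemma real_linear_complex_form: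
  fixes D :: "complex \<Rightarrow> complex"
  assumes "linear D"
  obtains a b where "\<And>z. D z = a * z + b * cnj z"
proof
  fix z
  have "z = Re z *\<^sub>R 1 + Im z *\<^sub>R \<i>" by (simp add: complex_eq_iff)
  then have "D z = D (Re z *\<^sub>R 1 + Im z *\<^sub>R \<i>)" by simp
  also have "\<dots> = Re z *\<^sub>R D 1 + Im z *\<^sub>R D \<i>"
    by (simp only: linear_add[OF assms] linear_cmul[OF assms])
  also have "\<dots> = ((D 1 - \<i> * D \<i>)/2) * z + ((D 1 + \<i> * D \<i>)/2) * cnj z"
    by (simp add: complex_eq_iff field_simps)
  finally show "D z = ((D 1 - \<i> * D \<i>)/2) * z + ((D 1 + \<i> * D \<i>)/2) * cnj z" .
qed

text \<open>The difference of the squared norms is the determinant of the map. Concretely, if the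
  norms agree and \<open>a\<close> is nonzero, a square root \<open>z\<close> of
  \<open>- b / a\<close> has modulus 1 and lies in the kernel.\<close>

lemma cnj_linear_form_inj_norm_neq:
  assumes "\<And>z. a * z + b * cnj z = 0 \<Longrightarrow> z = 0"
  shows "norm a \<noteq> norm b"
proof
  assume eq: "norm a = norm b"
  show False
  proof (cases "a = 0")
    case True then show False using assms[of 1] eq by auto
  next
    case False
    define z where "z = csqrt (- b / a)"
    have z2: "z^2 = - b / a" unfolding z_def by simp
    have "norm (z^2) = 1" unfolding z2 using eq False by (simp add: norm_divide) (metis norm_eq_zero)
    then have n1: "norm z = 1" by (simp add: norm_power power2_eq_1_iff) (smt (verit) norm_ge_zero)
    then have zn: "z \<noteq> 0" by auto
    have "z * (a * z + b * cnj z) = a * z^2 + b * (z * cnj z)" by (simp add: algebra_simps power2_eq_square)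
    also have "z * cnj z = 1" using n1 by (simp add: complex_norm_square[symmetric])
    also have "a * z^2 + b * 1 = 0" using z2 False by simp
    finally show False using assms[of z] zn by auto
  qed
qed

text \<open>By injectivity one of the terms \<open>a * s\<close> and \<open>b * cnj s\<close>
  strictly dominates. Factoring it out leaves 1 plus a number of modulus below 1, so the image of
  the sine has the increments of \<open>s\<close> or of \<open>cnj s\<close>. Thus \<open>e\<close>
  is 1 if \<open>D\<close> preserves orientation and -1 otherwise.\<close>

lemma log_increment_linear_sin:
  fixes D :: "complex \<Rightarrow> complex"
  assumes "linear D" "\<And>z. D z = 0 \<Longrightarrow> z = 0"
  obtains e :: int where "\<bar>e\<bar> = 1"
    "log_increment (\<lambda>z. D (sin (of_real pi * (z - w)) / of_real pi)) {z. Im z > Im w} (- e)"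
    "log_increment (\<lambda>z. D (sin (of_real pi * (z - w)) / of_real pi)) {z. Im z < Im w} e"
proof -
  obtain a b where D: "\<And>z. D z = a * z + b * cnj z" using real_linear_complex_form[OF assms(1)] by blast
  have ab: "norm a \<noteq> norm b" using assms(2) unfolding D by (rule cnj_linear_form_inj_norm_neq)
  define s where "s = (\<lambda>z::complex. sin (of_real pi * (z - w)))"
  have s1: "s (z + 1) = - s z" for z
    unfolding s_def using sin_plus_pi[of "of_real pi * (z - w)"] by (simp add: algebra_simps)
  have s_cont: "continuous_on U s" for U unfolding s_def by (intro continuous_intros)
  have s_nz: "s z \<noteq> 0" if "log_increment s U p" "z \<in> U" for U p z
    using that unfolding log_increment_def by auto
  have half: "Re (1 + c * u / v) > 0" if "norm c < 1" "norm u = norm v" for c u v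
  proof -
    have "norm (c * u / v) < 1" using that by (cases "v = 0") (auto simp: norm_mult norm_divide)
    then show ?thesis using abs_Re_le_cmod[of "c * u / v"] by (simp add: abs_le_iff)
  qed
  have key: "\<exists>e::int. \<bar>e\<bar> = 1 \<and> (\<forall>U p. log_increment s U p \<longrightarrow> log_increment (\<lambda>z. D (s z / of_real pi)) U (e * p))"
  proof (cases "norm b < norm a")
    case True
    have "log_increment (\<lambda>z. D (s z / of_real pi)) U p" if s: "log_increment s U p" for U p
    proof (rule log_increment_mult_right_half_plane[OF s])
      show "continuous_on U (\<lambda>z. 1 + (b/a) * cnj (s z) / s z)"
        using s_nz[OF s] by (intro continuous_intros s_cont) auto
      show "a / pi \<noteq> 0" using True by auto
      show "0 < Re (1 + (b/a) * cnj (s z) / s z)" for z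
        using True by (intro half) (auto simp: norm_divide divide_simps)
      show "D (s z / of_real pi) = a / of_real pi * s z * (1 + (b/a) * cnj (s z) / s z)" if "z \<in> U" for z
        using s_nz[OF s that] True by (auto simp: D field_simps)
    qed (simp add: s1)
    then show ?thesis by (intro exI[of _ 1]) auto
  next
    case False
    then have lt: "norm a < norm b" using ab by auto
    have "log_increment (\<lambda>z. D (s z / of_real pi)) U (- p)" if s: "log_increment s U p" for U p
    proof (rule log_increment_mult_right_half_plane[OF log_increment_cnj[OF s]])
      show "continuous_on U (\<lambda>z. 1 + (a/b) * s z / cnj (s z))"
        using s_nz[OF s] by (intro continuous_intros s_cont) auto
      show "b / pi \<noteq> 0" using lt by auto
      show "0 < Re (1 + (a/b) * s z / cnj (s z))" for z
        using lt by (intro half) (auto simp: norm_divide divide_simps)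
      show "D (s z / of_real pi) = b / of_real pi * cnj (s z) * (1 + (a/b) * s z / cnj (s z))" if "z \<in> U" for z
        using s_nz[OF s that] lt by (auto simp: D field_simps)
    qed (simp add: s1)
    then show ?thesis by (intro exI[of _ "-1"]) auto
  qed
  then obtain e where e: "\<bar>e\<bar> = (1::int)" "\<And>U p. log_increment s U p \<Longrightarrow> log_increment (\<lambda>z. D (s z / of_real pi)) U (e * p)"
    by blast
  show ?thesis
    using that[of e] e(1) e(2)[OF log_increment_sin_upper[of w, folded s_def]]
       e(2)[OF log_increment_sin_lower[of w, folded s_def]] by (simp add: s_def)
qed

section \<open>Dividing out a nondegenerate zero\<close>

lemma translation_int:
  fixes F :: "complex \<Rightarrow> complex" and s :: complex
  assumes "\<And>z. F (z + 1) = s * F z" "s * s = 1"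
  shows "\<exists>c. c \<noteq> 0 \<and> (\<forall>z. F (z + of_int n) = c * F z)"
proof (induction n rule: int_induct[of _ 0])
  case base then show ?case by (intro exI[of _ 1]) auto
next
  case (step1 i)
  then obtain c where c: "c \<noteq> 0" "\<And>z. F (z + of_int i) = c * F z" by blast
  have "F (z + of_int (i + 1)) = (s * c) * F z" for z
    using assms(1)[of "z + of_int i"] c(2)[of z] by (simp add: add.assoc)
  then show ?case using c(1) assms(2) by (intro exI[of _ "s * c"]) auto
next
  case (step2 i)
  then obtain c where c: "c \<noteq> 0" "\<And>z. F (z + of_int i) = c * F z" by blast
  have "F (z + of_int (i - 1)) = (s * c) * F z" for z
  proof -
    have "c * F z = s * F (z + of_int (i - 1))"
      using assms(1)[of "z + of_int (i - 1)"] c(2)[of z] by (simp add: algebra_simps)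
    then have "s * (c * F z) = (s * s) * F (z + of_int (i - 1))" by simp
    then show ?thesis using assms(2) by (simp add: mult.assoc)
  qed
  then show ?case using c(1) assms(2) by (intro exI[of _ "s * c"]) auto
qed

lemma sin_pi_eq_0_iff:
  fixes z w :: complex
  shows "sin (of_real pi * (z - w)) = 0 \<longleftrightarrow> (\<exists>n::int. z = w + of_int n)"
proof -
  have "sin (of_real pi * (z - w)) = 0 \<longleftrightarrow> (\<exists>n::int. complex_of_real pi * (z - w) = of_real pi * of_int n)"
    by (simp add: sin_eq_0 mult.commute)
  also have "\<dots> \<longleftrightarrow> (\<exists>n::int. z = w + of_int n)"
    by (simp only: mult_cancel_left) (simp add: diff_eq_eq add.commute)
  finally show ?thesis .
qed

text \<open>Both functions equal \<open>D (z - w)\<close> up to an error of smaller order than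
  \<open>z - w\<close>. Injectivity gives \<open>norm (D (z - w)) \<ge> B * norm (z - w)\<close>, so
  both relative errors vanish in the limit.\<close>

lemma has_derivative_quotient_tendsto_1:
  fixes F L :: "complex \<Rightarrow> complex"
  assumes F: "(F has_derivative D) (at w)" "F w = 0"
    and L: "(L has_derivative D) (at w)" "L w = 0"
    and inj: "\<And>z. D z = 0 \<Longrightarrow> z = 0"
  shows "((\<lambda>z. F z / L z) \<longlongrightarrow> 1) (at w)"
proof -
  interpret D: bounded_linear D using F(1) by (rule has_derivative_bounded_linear)
  have "inj D" using inj D.linear_axioms by (metis linear_injective_0)
  then obtain B where B: "B > 0" "\<And>z. B * norm z \<le> norm (D z)"
    using linear_inj_bounded_below_pos[of D] D.linear_axioms by blast
  have f: "((\<lambda>z. (F z - D (z - w)) /\<^sub>R norm (z - w)) \<longlongrightarrow> 0) (at w)"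
    and l: "((\<lambda>z. (L z - D (z - w)) /\<^sub>R norm (z - w)) \<longlongrightarrow> 0) (at w)"
    using F L unfolding has_derivative_at_within by simp_all
  have *: "((\<lambda>z. (G z - D (z - w)) / D (z - w)) \<longlongrightarrow> 0) (at w)"
    if g: "((\<lambda>z. (G z - D (z - w)) /\<^sub>R norm (z - w)) \<longlongrightarrow> 0) (at w)" for G
  proof (rule Lim_null_comparison[OF _ tendsto_mult_left_zero[OF tendsto_norm_zero[OF g], of "1/B"]])
    show "\<forall>\<^sub>F z in at w. norm ((G z - D (z - w)) / D (z - w))
        \<le> norm ((G z - D (z - w)) /\<^sub>R norm (z - w)) * (1/B)"
      unfolding eventually_at_filter
    proof (rule always_eventually, intro allI impI)
      fix z assume "z \<noteq> w"
      then have "norm (z - w) > 0" "B * norm (z - w) \<le> norm (D (z - w))" using B by auto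
      then have "norm (G z - D (z - w)) / norm (D (z - w)) \<le> norm (G z - D (z - w)) / (B * norm (z - w))"
        using B(1) by (intro divide_left_mono mult_pos_pos) (auto intro: inj dest: inj)
      then show "norm ((G z - D (z - w)) / D (z - w)) \<le> norm ((G z - D (z - w)) /\<^sub>R norm (z - w)) * (1/B)"
        by (simp add: norm_divide norm_inverse norm_mult divide_inverse mult_ac)
    qed
  qed
  have lim: "((\<lambda>z. (1 + (F z - D (z - w)) / D (z - w)) / (1 + (L z - D (z - w)) / D (z - w))) \<longlongrightarrow> (1 + 0) / (1 + 0)) (at w)"
    by (intro tendsto_intros *[OF f] *[OF l]) auto
  have ev: "\<forall>\<^sub>F z in at w. (1 + (F z - D (z - w)) / D (z - w)) / (1 + (L z - D (z - w)) / D (z - w)) = F z / L z"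
    unfolding eventually_at_filter
  proof (rule always_eventually, intro allI impI)
    fix z assume "z \<noteq> w"
    then have "D (z - w) \<noteq> 0" using inj[of "z - w"] by auto
    then show "(1 + (F z - D (z - w)) / D (z - w)) / (1 + (L z - D (z - w)) / D (z - w)) = F z / L z"
      by (auto simp: field_simps)
  qed
  show ?thesis using Lim_transform_eventually[OF lim ev] by simp
qed

text \<open>The divisor \<open>L\<close> vanishes exactly on the integer translates of
  \<open>w\<close> and has at \<open>w\<close> the derivative of \<open>F\<close>, so the quotient
  extends continuously by nonzero values. No holomorphy is involved. The quotient need not be
  differentiable at the translates of \<open>w\<close>, but it has no zero there, so nondegeneracy
  of the other zeros is all that has to be carried along.\<close>

lemma divide_out_zero:
  fixes F :: "complex \<Rightarrow> complex" and s :: complex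
  assumes cont: "continuous_on UNIV F" and per: "\<And>z. F (z + 1) = s * F z" and s: "s = 1 \<or> s = -1"
    and nd: "\<And>z. F z = 0 \<Longrightarrow> \<exists>D. (F has_derivative D) (at z) \<and> (\<forall>h. D h = 0 \<longrightarrow> h = 0)"
    and w: "F w = 0"
  obtains D Q where "linear D" "\<And>h. D h = 0 \<Longrightarrow> h = 0" "continuous_on UNIV Q"
    "\<And>z. Q (z + 1) = - s * Q z" "\<And>z. Q z = 0 \<longleftrightarrow> F z = 0 \<and> (\<forall>n::int. z \<noteq> w + of_int n)"
    "\<And>z. Q z = 0 \<Longrightarrow> \<exists>D. (Q has_derivative D) (at z) \<and> (\<forall>h. D h = 0 \<longrightarrow> h = 0)"
    "\<And>z. (\<forall>n::int. z \<noteq> w + of_int n) \<Longrightarrow> Q z = F z / D (sin (of_real pi * (z - w)) / of_real pi)"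
proof -
  have ss: "s * s = 1" "s \<noteq> 0" using s by auto
  obtain D where FD: "(F has_derivative D) (at w)" and inj: "\<And>h. D h = 0 \<Longrightarrow> h = 0"
    using nd[OF w] by blast
  interpret D: bounded_linear D using FD by (rule has_derivative_bounded_linear)
  have D0: "D h = 0 \<longleftrightarrow> h = 0" for h using inj[of h] D.zero by auto
  define L where "L = (\<lambda>z. D (sin (of_real pi * (z - w)) / of_real pi))"
  have L_diff: "(L has_derivative (\<lambda>h. D (cos (of_real pi * (z - w)) * h))) (at z)" for z
  proof -
    have "((\<lambda>z. sin (of_real pi * (z - w)) / of_real pi) has_field_derivative cos (of_real pi * (z - w))) (at z)"
      by (auto intro!: derivative_eq_intros)
    then have "((\<lambda>z. sin (of_real pi * (z - w)) / of_real pi) has_derivative (\<lambda>h. cos (of_real pi * (z - w)) * h)) (at z)"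
      unfolding has_field_derivative_def by simp
    from D.has_derivative[OF this] show ?thesis unfolding L_def .
  qed
  have L0: "L z = 0 \<longleftrightarrow> (\<exists>n::int. z = w + of_int n)" for z
    unfolding L_def D0 by (simp add: sin_pi_eq_0_iff)
  have L1: "L (z + 1) = - L z" for z
  proof -
    have "of_real pi * (z + 1 - w) = of_real pi * (z - w) + of_real pi" by (simp add: algebra_simps)
    then have "sin (of_real pi * (z + 1 - w)) / of_real pi = - (sin (of_real pi * (z - w)) / complex_of_real pi)"
      by (simp only: sin_plus_pi) simp
    then show ?thesis unfolding L_def by (simp only: linear_neg[OF D.linear_axioms])
  qed
  \<comment> \<open>The filled-in values must be 1 at \<open>w\<close> and obey the translation law
    with factor \<open>- s\<close>. The cosine does so in the antiperiodic case, the constant 1 in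
    the periodic one.\<close>
  define c where "c = (\<lambda>z. if s = 1 then cos (of_real pi * (z - w)) else 1)"
  have c1: "c (z + 1) = - s * c z" for z
  proof -
    have "of_real pi * (z + 1 - w) = of_real pi * (z - w) + of_real pi" by (simp add: algebra_simps)
    then show ?thesis using s unfolding c_def by (auto simp: cos_plus_pi)
  qed
  define Q where "Q = (\<lambda>z. if L z = 0 then c z else F z / L z)"
  have Q1: "Q (z + 1) = - s * Q z" for z
    unfolding Q_def L1 c1 per by auto
  \<comment> \<open>Only \<open>w\<close> itself needs the limit of the quotient; continuity at its
    translates follows from the translation law.\<close>
  have "isCont Q w"
  proof -
    have Lw: "L w = 0" using L0[of w] by (auto intro: exI[of _ 0])
    have "((\<lambda>z. F z / L z) \<longlongrightarrow> 1) (at w)"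
      using has_derivative_quotient_tendsto_1[of F D w L] FD w L_diff[of w] Lw inj by simp
    moreover have "\<forall>\<^sub>F z in at w. F z / L z = Q z"
    proof -
      have "\<forall>\<^sub>F z in at w. z \<in> ball w 1 - {w}" by (intro eventually_at_in_open) auto
      then show ?thesis
      proof eventually_elim
        case (elim z)
        have "L z \<noteq> 0"
        proof
          assume "L z = 0"
          then obtain n::int where n: "z = w + of_int n" using L0 by auto
          then have "\<bar>real_of_int n\<bar> < 1" using elim by (auto simp: dist_norm)
          then have "n = 0" by linarith
          then show False using n elim by auto
        qed
        then show ?case by (simp add: Q_def)
      qed
    qed
    moreover have "Q w = 1" using Lw by (auto simp: Q_def c_def)
    ultimately show ?thesis unfolding isCont_def by (simp only: Lim_transform_eventually)
  qed
  have near: "\<forall>\<^sub>F y in nhds z. Q y = F y / L y" if "L z \<noteq> 0" for z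
  proof -
    have "isCont L z" using L_diff by (rule has_derivative_continuous)
    then have "\<forall>\<^sub>F y in nhds z. L y \<noteq> 0" using that
      by (simp add: continuous_at_imp_continuous_at_within isCont_def tendsto_imp_eventually_ne eventually_nhds_conv_at)
    then show ?thesis by eventually_elim (simp add: Q_def)
  qed
  have Q_cont: "isCont Q z" for z
  proof (cases "L z = 0")
    case True
    then obtain n::int where n: "z = w + of_int n" using L0 by auto
    obtain d where d: "d \<noteq> 0" "\<And>z. Q (z + of_int (-n)) = d * Q z"
      using translation_int[of Q "- s" "- n"] Q1 ss by auto
    have Qeq: "Q = (\<lambda>z. Q (z - of_int n) / d)" using d by (auto simp: fun_eq_iff)
    have "isCont (\<lambda>z. Q (z - of_int n)) z"
      by (rule isCont_o2[where g=Q]) (use \<open>isCont Q w\<close> n in \<open>auto intro!: continuous_intros\<close>)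
    then have "isCont (\<lambda>z. Q (z - of_int n) / d) z" using d(1) by (intro continuous_intros) auto
    then show ?thesis using Qeq by simp
  next
    case False
    have "isCont F z" using cont by (simp add: continuous_on_eq_continuous_at)
    moreover have "isCont L z" using L_diff by (rule has_derivative_continuous)
    ultimately have "isCont (\<lambda>z. F z / L z) z" using False by (intro continuous_intros)
    then show ?thesis using isCont_cong[OF near[OF False]] by simp
  qed
  have Q0: "Q z = 0 \<longleftrightarrow> F z = 0 \<and> (\<forall>n::int. z \<noteq> w + of_int n)" for z
  proof (cases "L z = 0")
    case True
    then obtain n::int where n: "z = w + of_int n" using L0 by auto
    have "Q w = 1" using L0[of w] by (auto simp: Q_def c_def intro: exI[of _ 0])
    moreover obtain d where "d \<noteq> 0" "Q (w + of_int n) = d * Q w"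
      using translation_int[of Q "- s" n] Q1 ss by auto
    ultimately show ?thesis using n by auto
  next
    case False then show ?thesis using L0 by (auto simp: Q_def)
  qed
  show ?thesis
  proof (rule that[of D Q])
    show "linear D" by (rule D.linear_axioms)
    show "continuous_on UNIV Q" using Q_cont by (simp add: continuous_on_eq_continuous_at)
    fix z assume z: "Q z = 0"
    then have Fz: "F z = 0" and Lz: "L z \<noteq> 0" using Q0 L0 by auto
    obtain D' where D': "(F has_derivative D') (at z)" "\<And>h. D' h = 0 \<Longrightarrow> h = 0" using nd[OF Fz] by blast
    \<comment> \<open>In the product rule the derivative of \<open>1 / L\<close> is multiplied by
      \<open>F z = 0\<close>, so the derivative of the quotient is \<open>D'\<close> divided by a
      nonzero number and stays injective.\<close>
    note has_derivative_mult[OF D'(1) Deriv.has_derivative_inverse[OF Lz L_diff]]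
    then have "((\<lambda>z. F z / L z) has_derivative (\<lambda>h. D' h / L z)) (at z)"
      using Fz by (simp add: divide_inverse)
    then have "(Q has_derivative (\<lambda>h. D' h / L z)) (at z)"
      by (rule has_derivative_transform_eventually)
         (use near[OF Lz] in \<open>auto simp: eventually_nhds_conv_at elim!: eventually_mono\<close>)
    then show "\<exists>D. (Q has_derivative D) (at z) \<and> (\<forall>h. D h = 0 \<longrightarrow> h = 0)"
      using D'(2) Lz by (intro exI[of _ "\<lambda>h. D' h / L z"]) auto
  next
    fix z assume "\<forall>n::int. z \<noteq> w + of_int n"
    then show "Q z = F z / D (sin (of_real pi * (z - w)) / of_real pi)"
      using L0[of z] by (auto simp: Q_def L_def)
  qed (use inj Q1 Q0 in auto)
qed

text \<open>The plane is contractible, so a global logarithm \<open>g\<close> exists. The difference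
  \<open>g (z + 1) - g z\<close> is a logarithm of \<open>s\<close>, hence constant; as
  \<open>s\<close> squares to 1, it is a multiple of \<open>\<i> * pi\<close>.\<close>

lemma nonvanishing_log_increment:
  fixes F :: "complex \<Rightarrow> complex" and s :: complex
  assumes "continuous_on UNIV F" "\<And>z. F (z + 1) = s * F z" "s = 1 \<or> s = -1" "\<And>z. F z \<noteq> 0"
  obtains p where "log_increment F UNIV p"
proof -
  obtain g where g: "continuous_on UNIV g" "\<And>z. F z = exp (g z)"
    using continuous_logarithm_on_contractible[OF assms(1) contractible_UNIV] assms(4) by auto
  have e: "exp (g (z + 1) - g z) = s" for z
    using assms(2)[of z] g(2) assms(4)[of z] by (simp add: exp_diff)
  have const: "g (z + 1) - g z = g 1 - g 0" for z
  proof -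
    have "continuous_on UNIV (\<lambda>z. g (z + 1) - g z)"
      by (intro continuous_intros continuous_on_compose2[OF g(1)] g(1)) auto
    from continuous_exp_constant[OF connected_UNIV this e, of z 0] show ?thesis by simp
  qed
  have "\<exists>p::int. g 1 - g 0 = \<i> * (of_real pi * of_int p)"
  proof -
    have "exp (2 * (g 1 - g 0)) = (exp (g 1 - g 0))\<^sup>2" by (rule exp_double)
    also have "\<dots> = exp 0" using e[of 0] assms(3) by auto
    finally have "exp (2 * (g 1 - g 0)) = exp 0" .
    then obtain n::int where "2 * (g 1 - g 0) = 0 + of_int (2 * n) * pi * \<i>" unfolding exp_eq by blast
    then have "2 * (g 1 - g 0) = 2 * (\<i> * (of_real pi * of_int n))" by simp
    then have "g 1 - g 0 = \<i> * (of_real pi * of_int n)" by (subst (asm) mult_cancel_left) simp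
    then show ?thesis ..
  qed
  then obtain p::int where p: "g 1 - g 0 = \<i> * (of_real pi * of_int p)" by blast
  show ?thesis
    by (rule that[of p]) (unfold log_increment_def, rule exI[of _ g],
        use g const p in \<open>auto simp: algebra_simps\<close>)
qed

text \<open>Dividing by a real-linear image of \<open>sin (\<pi> (z - w))\<close> removes the zeros \<open>w + \<int>\<close> and moves
  the increments at the two ends of the cylinder by one in opposite directions; a function without
  zeros has equal increments.\<close>

lemma card_zeros_log_increment:
  fixes F :: "complex \<Rightarrow> complex" and s :: complex
  assumes "continuous_on UNIV F" "\<And>z. F (z + 1) = s * F z" "s = 1 \<or> s = -1"
    and "\<And>z. F z = 0 \<Longrightarrow> \<exists>D. (F has_derivative D) (at z) \<and> (\<forall>h. D h = 0 \<longrightarrow> h = 0)"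
    and "log_increment F {z. Im z > R} p" "log_increment F {z. Im z < - R} q"
    and "finite {z. F z = 0 \<and> 0 \<le> Re z \<and> Re z < 1}"
    and "card {z. F z = 0 \<and> 0 \<le> Re z \<and> Re z < 1} = n"
  shows "(p - q - 2 * int n) mod 4 = 0"
  using assms
proof (induction n arbitrary: F s p q)
  case 0
  have "F z \<noteq> 0" for z
  proof
    assume z: "F z = 0"
    have "s * s = 1" using "0.prems"(3) by auto
    then obtain c where "F (z + of_int (- \<lfloor>Re z\<rfloor>)) = c * F z"
      using translation_int[of F s "- \<lfloor>Re z\<rfloor>"] "0.prems"(2) by blast
    then have "z - of_int \<lfloor>Re z\<rfloor> \<in> {z. F z = 0 \<and> 0 \<le> Re z \<and> Re z < 1}"
      using z real_of_int_floor_add_one_gt[of "Re z"] of_int_floor_le[of "Re z"]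
      by (simp add: diff_less_eq add.commute)
    then show False using "0.prems"(7,8) by (metis card_0_eq empty_iff)
  qed
  then obtain r where r: "log_increment F UNIV r"
    using nonvanishing_log_increment[OF "0.prems"(1-3)] by blast
  \<comment> \<open>Both half planes inherit the increment of the global logarithm. The two explicit
    points merely witness that the half planes are nonempty.\<close>
  have "p = r"
    by (rule log_increment_unique[OF _ _ _ "0.prems"(5) log_increment_subset[OF r], of "Complex 0 (R + 1)"])
       (auto intro: convex_connected convex_halfspace_Im_gt)
  moreover have "q = r"
    by (rule log_increment_unique[OF _ _ _ "0.prems"(6) log_increment_subset[OF r], of "Complex 0 (- R - 1)"])
       (auto intro: convex_connected convex_halfspace_Im_lt)
  ultimately show ?case by simp
next
  case (Suc n)
  let ?Z = "\<lambda>F. {z::complex. F z = (0::complex) \<and> 0 \<le> Re z \<and> Re z < 1}"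
  have "?Z F \<noteq> {}" using Suc.prems(8) by (metis card.empty nat.distinct(1))
  then obtain w where w: "F w = 0" "0 \<le> Re w" "Re w < 1" by auto
  obtain D Q where D: "linear D" "\<And>h. D h = 0 \<Longrightarrow> h = 0" and Q: "continuous_on UNIV Q"
    "\<And>z. Q (z + 1) = - s * Q z" "\<And>z. Q z = 0 \<longleftrightarrow> F z = 0 \<and> (\<forall>n::int. z \<noteq> w + of_int n)"
    "\<And>z. Q z = 0 \<Longrightarrow> \<exists>D. (Q has_derivative D) (at z) \<and> (\<forall>h. D h = 0 \<longrightarrow> h = 0)"
    "\<And>z. (\<forall>n::int. z \<noteq> w + of_int n) \<Longrightarrow> Q z = F z / D (sin (of_real pi * (z - w)) / of_real pi)"
    by (rule divide_out_zero[OF Suc.prems(1-4) w(1)]) (assumption, rule that)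
  have nz: "F z \<noteq> 0" if "log_increment F U r" "z \<in> U" for U r z
    using that unfolding log_increment_def by auto
  \<comment> \<open>A function with a logarithm has no zero, so \<open>w\<close> lies between the
    two ends and each end lies on one side of \<open>w\<close>.\<close>
  have "Im w \<le> R" "Im w \<ge> - R"
    using nz[OF Suc.prems(5), of w] nz[OF Suc.prems(6), of w] w(1) by fastforce+
  obtain e :: int where e: "\<bar>e\<bar> = 1"
    "log_increment (\<lambda>z. D (sin (of_real pi * (z - w)) / of_real pi)) {z. Im z > Im w} (- e)"
    "log_increment (\<lambda>z. D (sin (of_real pi * (z - w)) / of_real pi)) {z. Im z < Im w} e"
    using log_increment_linear_sin[OF D] by blast
  have up: "log_increment Q {z. Im z > R} (p - (- e))"
    by (rule log_increment_divide[OF Suc.prems(5) log_increment_subset[OF e(2)] Q(5)])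
       (use \<open>Im w \<le> R\<close> in auto)
  have lo: "log_increment Q {z. Im z < - R} (q - e)"
    by (rule log_increment_divide[OF Suc.prems(6) log_increment_subset[OF e(3)] Q(5)])
       (use \<open>Im w \<ge> - R\<close> in auto)
  \<comment> \<open>Exactly one integer translate of \<open>w\<close> has real part in
    \<open>[0, 1)\<close>, so one division lowers the count by exactly one.\<close>
  have Z: "?Z Q = ?Z F - {w}"
  proof -
    have "k = 0" if "0 \<le> Re w + of_int k" "Re w + of_int k < 1" for k::int
      using that w by linarith
    then show ?thesis unfolding Q(3) by (fastforce dest: spec[of _ 0])
  qed
  have "(p - (- e) - (q - e) - 2 * int n) mod 4 = 0"
  proof (rule Suc.IH[OF Q(1,2) _ Q(4) up lo])
    show "- s = 1 \<or> - s = - 1" using Suc.prems(3) by auto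
    show "finite (?Z Q)" "card (?Z Q) = n"
      unfolding Z using Suc.prems(7,8) w by auto
  qed
  \<comment> \<open>The difference of the increments has changed by \<open>2 * e\<close>, and 2 and
    -2 agree modulo 4.\<close>
  moreover have "e = 1 \<or> e = -1" using e(1) by auto
  ultimately show ?case by (elim disjE; simp; presburger)
qed

theorem even_card_nondegenerate_zeros:
  fixes F :: "complex \<Rightarrow> complex"
  assumes "continuous_on UNIV F" "\<And>z. F (z + 1) = F z"
    and "\<And>z. F z = 0 \<Longrightarrow> \<exists>D. (F has_derivative D) (at z) \<and> (\<forall>h. D h = 0 \<longrightarrow> h = 0)"
    and "\<And>z. Im z > R \<Longrightarrow> Re (F z) > 0" "\<And>z. Im z < - R \<Longrightarrow> Re (F z) < 0"
    and "finite {z. F z = 0 \<and> 0 \<le> Re z \<and> Re z < 1}"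
  shows "even (card {z. F z = 0 \<and> 0 \<le> Re z \<and> Re z < 1})"
proof -
  have up: "log_increment F {z. Im z > R} 0"
    using assms by (intro log_increment_right_half_plane) (auto intro: continuous_on_subset)
  \<comment> \<open>At the lower end \<open>F\<close> takes values in the left half plane. Its
    negative has a principal logarithm, and the factor -1 does not affect the increment, so both
    ends have increment 0.\<close>
  have "log_increment (\<lambda>z. - F z) {z. Im z < - R} 0"
    using assms by (intro log_increment_right_half_plane) (auto intro: continuous_on_subset continuous_on_minus)
  then have lo: "log_increment F {z. Im z < - R} 0"
    by (rule log_increment_mult_right_half_plane[where c = "-1" and H = "\<lambda>_. 1"]) auto
  have "(0 - 0 - 2 * int (card {z. F z = 0 \<and> 0 \<le> Re z \<and> Re z < 1})) mod 4 = 0"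
    by (rule card_zeros_log_increment[OF assms(1) _ _ assms(3) up lo assms(6) refl, of 1]) (use assms(2) in auto)
  then show ?thesis by presburger
qed

section \<open>Second order equations on the line\<close>

definition ode2_solution :: "(real \<Rightarrow> real \<Rightarrow> real) \<Rightarrow> (real \<Rightarrow> real) \<Rightarrow> (real \<Rightarrow> real) \<Rightarrow> bool" where
  "ode2_solution f x x' \<longleftrightarrow>
     (\<forall>t. (x has_real_derivative x' t) (at t) \<and> (x' has_real_derivative f t (x t)) (at t))"

lemma ode2_solutionD:
  assumes "ode2_solution f x x'"
  shows "(x has_real_derivative x' t) (at t)" "(x' has_real_derivative f t (x t)) (at t)"
  using assms unfolding ode2_solution_def by auto

lemma continuous_on_if_DERIV:
  fixes g :: "real \<Rightarrow> real"
  assumes "\<And>t. (g has_real_derivative g' t) (at t)"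
  shows "continuous_on U g"
  by (rule DERIV_continuous_on[OF has_field_derivative_at_within[OF assms]])

lemma ode2_solution_continuous:
  assumes "ode2_solution f x x'"
  shows "continuous_on U x" "continuous_on U x'"
  using continuous_on_if_DERIV[OF ode2_solutionD(1)[OF assms]] continuous_on_if_DERIV[OF ode2_solutionD(2)[OF assms]]
  by auto

text \<open>An integral over \<open>{a..b}\<close> with \<open>b < a\<close> is 0, so of the two
  integrals in the witness one vanishes, and the difference is the oriented integral from 0 to
  \<open>t\<close>.\<close>

lemma antiderivative_real:
  fixes g :: "real \<Rightarrow> real"
  assumes "continuous_on UNIV g"
  obtains G where "G 0 = 0" "\<And>t. (G has_real_derivative g t) (at t)"
proof (rule that[of "\<lambda>t. integral {0..t} g - integral {t..0} g"])
  show "(\<lambda>t. integral {0..t} g - integral {t..0} g) 0 = 0" by simp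
  fix t :: real
  define R where "R = \<bar>t\<bar> + 1"
  have int: "g integrable_on {a..b}" for a b
    using assms by (intro integrable_continuous_real continuous_on_subset[OF assms]) auto
  have "((\<lambda>u. integral {-R..u} g) has_real_derivative g t) (at t within {-R..R})"
    by (rule integral_has_real_derivative[OF continuous_on_subset[OF assms]]) (auto simp: R_def)
  then have "((\<lambda>u. integral {-R..u} g) has_real_derivative g t) (at t)"
    by (subst (asm) at_within_interior) (auto simp: R_def)
  then have d: "((\<lambda>u. integral {-R..u} g - integral {-R..0} g) has_real_derivative g t) (at t)"
    by (auto intro!: derivative_eq_intros)
  have e: "integral {0..u} g - integral {u..0} g = integral {-R..u} g - integral {-R..0} g" if "u \<in> {-R<..<R}" for u
  proof (cases "u \<ge> 0")
    case True
    have "integral {-R..0} g + integral {0..u} g = integral {-R..u} g"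
      using True int by (intro Henstock_Kurzweil_Integration.integral_combine) (auto simp: R_def)
    moreover have "integral {u..0} g = 0" using True by (cases "u = 0") auto
    ultimately show ?thesis by simp
  next
    case False
    have "integral {-R..u} g + integral {u..0} g = integral {-R..0} g"
      using False that int by (intro Henstock_Kurzweil_Integration.integral_combine) auto
    then show ?thesis using False by simp
  qed
  show "((\<lambda>t. integral {0..t} g - integral {t..0} g) has_real_derivative g t) (at t)"
    by (rule has_field_derivative_transform_within_open[OF d, of "{-R<..<R}"]) (auto simp: e[symmetric], auto simp: R_def)
qed

lemma second_antiderivative_real:
  fixes g :: "real \<Rightarrow> real"
  assumes "continuous_on UNIV g"
  obtains G G' where "G 0 = 0" "G' 0 = 0" "\<And>t. (G has_real_derivative G' t) (at t)"
    "\<And>t. (G' has_real_derivative g t) (at t)"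
proof -
  obtain G' where G': "G' 0 = 0" "\<And>t. (G' has_real_derivative g t) (at t)"
    using antiderivative_real[OF assms] by blast
  have "continuous_on UNIV G'" by (rule continuous_on_if_DERIV[OF G'(2)])
  then obtain G where "G 0 = 0" "\<And>t. (G has_real_derivative G' t) (at t)"
    by (rule antiderivative_real) (rule that)
  then show ?thesis by (rule that[OF _ G'(1) _ G'(2)])
qed

section \<open>Comparison and Gronwall estimates\<close>

lemma nonneg_if_second_derivative_nonneg:
  fixes r :: "real \<Rightarrow> real"
  assumes "\<And>t. (r has_real_derivative r' t) (at t)" "\<And>t. (r' has_real_derivative r'' t) (at t)"
    "\<And>t. r'' t \<ge> 0" "r 0 = 0" "r' 0 = 0"
  shows "r t \<ge> 0"
proof (cases "t \<ge> 0")
  case True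
  have "r' u \<ge> 0" if "u \<ge> 0" for u
    using DERIV_nonneg_imp_nondecreasing[OF that, of r'] assms by metis
  then show ?thesis using DERIV_nonneg_imp_nondecreasing[OF True, of r] assms by metis
next
  case False
  have "r' u \<le> 0" if "u \<le> 0" for u
    using DERIV_nonneg_imp_nondecreasing[OF that, of r'] assms by metis
  then show ?thesis using DERIV_nonpos_imp_nonincreasing[of t 0 r] False assms by (metis linear)
qed

text \<open>Both \<open>p - r\<close> and \<open>p + r\<close> are convex and vanish to first order
  at 0. The estimate bounds a double integral on the whole line, in both time directions at
  once.\<close>

lemma abs_le_if_second_derivative_le:
  fixes r :: "real \<Rightarrow> real"
  assumes "\<And>t. (r has_real_derivative r' t) (at t)" "\<And>t. (r' has_real_derivative r'' t) (at t)"
    "\<And>t. (p has_real_derivative p' t) (at t)" "\<And>t. (p' has_real_derivative p'' t) (at t)"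
    "\<And>t. \<bar>r'' t\<bar> \<le> p'' t" "r 0 = 0" "r' 0 = 0" "p 0 = 0" "p' 0 = 0"
  shows "\<bar>r t\<bar> \<le> p t"
proof -
  have "p t - r t \<ge> 0"
    by (rule nonneg_if_second_derivative_nonneg[of "\<lambda>t. p t - r t" "\<lambda>t. p' t - r' t" "\<lambda>t. p'' t - r'' t"])
       (use assms(5) in \<open>auto intro!: derivative_eq_intros assms(1-4) simp: assms(6-9) abs_le_iff\<close>)
  moreover have "p'' t + r'' t \<ge> 0" for t using assms(5)[of t] by linarith
  then have "p t + r t \<ge> 0"
    by (intro nonneg_if_second_derivative_nonneg[of "\<lambda>t. p t + r t" "\<lambda>t. p' t + r' t" "\<lambda>t. p'' t + r'' t"])
       (auto intro!: derivative_eq_intros assms(1-4) simp: assms(6-9))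
  ultimately show ?thesis by linarith
qed

text \<open>The energy \<open>u^2 + u'^2 + \<eta>^2\<close> grows at most at rate
  \<open>2 + 2 * M^2\<close>. Including the constant \<open>\<eta>^2\<close> absorbs the
  inhomogeneous term and keeps the estimate multiplicative. The case \<open>\<eta> = 0\<close> gives
  Lipschitz dependence on the data, small \<open>\<eta>\<close> gives differentiability.\<close>

lemma gronwall2:
  fixes u :: "real \<Rightarrow> real"
  assumes "\<And>t. s \<le> t \<Longrightarrow> t \<le> e \<Longrightarrow> (u has_real_derivative u' t) (at t)"
    "\<And>t. s \<le> t \<Longrightarrow> t \<le> e \<Longrightarrow> (u' has_real_derivative u'' t) (at t)"
    "\<And>t. s \<le> t \<Longrightarrow> t \<le> e \<Longrightarrow> \<bar>u'' t\<bar> \<le> M * \<bar>u t\<bar> + \<eta>"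
    "M \<ge> 0" "\<eta> \<ge> 0" "s \<le> e"
  shows "(u e)\<^sup>2 + (u' e)\<^sup>2 + \<eta>\<^sup>2 \<le> exp ((2 + 2 * M\<^sup>2) * (e - s)) * ((u s)\<^sup>2 + (u' s)\<^sup>2 + \<eta>\<^sup>2)"
proof -
  let ?K = "2 + 2 * M\<^sup>2"
  let ?D = "\<lambda>t. ((u t)\<^sup>2 + (u' t)\<^sup>2 + \<eta>\<^sup>2) * exp (- ?K * (t - s))"
  have "?D s \<ge> ?D e"
  proof (rule DERIV_nonpos_imp_nonincreasing[OF assms(6)])
    fix t assume t: "s \<le> t" "t \<le> e"
    let ?E = "2 * u t * u' t + 2 * u' t * u'' t - ?K * ((u t)\<^sup>2 + (u' t)\<^sup>2 + \<eta>\<^sup>2)"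
    have "(?D has_real_derivative ?E * exp (- ?K * (t - s))) (at t)"
      by (rule derivative_eq_intros assms(1,2) t refl | simp add: power2_eq_square algebra_simps)+
    moreover have "?E \<le> 0"
    proof -
      have "2 * u t * u' t \<le> (u t)\<^sup>2 + (u' t)\<^sup>2" using sum_squares_bound[of "u t" "u' t"] by simp
      moreover have "2 * u' t * u'' t \<le> (u' t)\<^sup>2 + (u'' t)\<^sup>2" using sum_squares_bound[of "u' t" "u'' t"] by simp
      moreover have "(u'' t)\<^sup>2 \<le> (M * \<bar>u t\<bar> + \<eta>)\<^sup>2"
        using assms(3)[OF t] by (intro power2_le_iff_abs_le[THEN iffD2]) (use assms(4,5) in auto)
      moreover have "(M * \<bar>u t\<bar> + \<eta>)\<^sup>2 \<le> 2 * M\<^sup>2 * (u t)\<^sup>2 + 2 * \<eta>\<^sup>2"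
        using sum_squares_bound[of "M * \<bar>u t\<bar>" \<eta>] by (simp add: power2_sum power_mult_distrib)
      moreover have "0 \<le> M\<^sup>2 * (u' t)\<^sup>2" "0 \<le> M\<^sup>2 * \<eta>\<^sup>2" "0 \<le> (u t)\<^sup>2" by auto
      moreover have "?K * ((u t)\<^sup>2 + (u' t)\<^sup>2 + \<eta>\<^sup>2) = 2 * (u t)\<^sup>2 + 2 * (u' t)\<^sup>2 + 2 * \<eta>\<^sup>2
          + 2 * (M\<^sup>2 * (u t)\<^sup>2) + 2 * (M\<^sup>2 * (u' t)\<^sup>2) + 2 * (M\<^sup>2 * \<eta>\<^sup>2)"
        by (simp add: algebra_simps)
      ultimately show ?thesis by linarith
    qed
    ultimately show "\<exists>y. (?D has_real_derivative y) (at t) \<and> y \<le> 0"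
      using mult_nonpos_nonneg[OF _ exp_ge_zero] by blast
  qed
  then have "((u e)\<^sup>2 + (u' e)\<^sup>2 + \<eta>\<^sup>2) * exp (- ?K * (e - s)) \<le> (u s)\<^sup>2 + (u' s)\<^sup>2 + \<eta>\<^sup>2" by simp
  then have le: "((u e)\<^sup>2 + (u' e)\<^sup>2 + \<eta>\<^sup>2) * exp (- ?K * (e - s)) * exp (?K * (e - s))
      \<le> ((u s)\<^sup>2 + (u' s)\<^sup>2 + \<eta>\<^sup>2) * exp (?K * (e - s))" by (rule mult_right_mono) simp
  have one: "exp (- ?K * (e - s)) * exp (?K * (e - s)) = 1" by (simp add: exp_add[symmetric] algebra_simps)
  show ?thesis using le unfolding mult.assoc one by (simp only: mult_1_left mult_1_right mult.commute)
qed

section \<open>Global solutions for a force that is Lipschitz in the position\<close>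

locale lipschitz_ode2 =
  fixes f :: "real \<Rightarrow> real \<Rightarrow> real" and M B :: real
  assumes f_cont: "continuous_on UNIV (\<lambda>(t, x). f t x)"
    and f_lipschitz: "\<bar>f t x - f t y\<bar> \<le> M * \<bar>x - y\<bar>"
    and f_bound: "\<bar>f t 0\<bar> \<le> B"
begin

lemma M_nonneg: "M \<ge> 0"
  using f_lipschitz[of 0 1 0] by auto

lemma continuous_on_f_compose:
  assumes "continuous_on U g"
  shows "continuous_on U (\<lambda>t. f t (g t))"
proof -
  have "continuous_on U (\<lambda>t. (\<lambda>(t, x). f t x) (t, g t))"
    by (rule continuous_on_compose2[OF f_cont]) (auto intro!: continuous_intros assms)
  then show ?thesis by simp
qed

text \<open>Picard iteration in a weighted supremum norm: the unknown is \<open>u = x / w\<close>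
  with \<open>w t = cosh (\<omega> * t)\<close>. Integrating the weight twice gives
  \<open>P\<close>, at most \<open>w / \<omega>^2\<close>, so the iteration contracts by
  \<open>M / \<omega>^2\<close>, and \<open>\<omega>^2 = 2 * (M + 1)\<close> makes this at most 1/2.
  One fixed point lives on the whole line, without any continuation argument.\<close>

lemma ivp_existence_at_0: "\<exists>x x'. ode2_solution f x x' \<and> x 0 = a \<and> x' 0 = v"
proof -
  define \<omega> where "\<omega> = sqrt (2 * (M + 1))"
  have \<omega>: "\<omega> > 0" "\<omega>\<^sup>2 = 2 * (M + 1)" using M_nonneg by (auto simp: \<omega>_def)
  define w where "w = (\<lambda>t. cosh (\<omega> * t))"
  define P where "P = (\<lambda>t. (w t - 1) / \<omega>\<^sup>2)"
  define P' where "P' = (\<lambda>t. sinh (\<omega> * t) / \<omega>)"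
  have P: "(P has_real_derivative P' t) (at t)" "(P' has_real_derivative w t) (at t)" "P 0 = 0" "P' 0 = 0" for t
    using \<omega>(1) unfolding P_def P'_def w_def
    by (auto intro!: derivative_eq_intros simp: power2_eq_square field_simps)
  have w1: "w t \<ge> 1" "w t > 0" for t unfolding w_def using cosh_real_ge_1[of "\<omega> * t"] by auto
  have Pw: "P t \<le> w t / \<omega>\<^sup>2" for t unfolding P_def by (intro divide_right_mono) auto
  have w_cont: "continuous_on UNIV w" unfolding w_def by (intro continuous_intros)
  \<comment> \<open>The weight must also dominate the linear part \<open>a + v * t\<close>, so that
    the iteration maps bounded functions to bounded functions.\<close>
  have tw: "\<bar>t\<bar> \<le> (2 / \<omega>) * w t" for t
  proof -
    have "\<bar>\<omega> * t\<bar> \<le> exp \<bar>\<omega> * t\<bar>" using exp_ge_add_one_self[of "\<bar>\<omega> * t\<bar>"] by linarith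
    also have "\<dots> \<le> 2 * cosh (\<omega> * t)" by (simp add: cosh_def abs_if)
    finally show ?thesis using \<omega>(1) by (simp add: w_def abs_mult field_simps)
  qed
  define N where "N = (\<lambda>(u::real \<Rightarrow>\<^sub>C real) t. f t (w t * u t))"
  have N_cont: "continuous_on UNIV (N u)" for u
    unfolding N_def by (intro continuous_on_f_compose continuous_intros w_cont) auto
  have "\<exists>G. \<forall>u. \<exists>G'. G u 0 = 0 \<and> G' 0 = 0 \<and> (\<forall>t. (G u has_real_derivative G' t) (at t) \<and> (G' has_real_derivative N u t) (at t))"
  proof (rule choice, rule allI)
    fix u show "\<exists>G G'. G 0 = 0 \<and> G' 0 = 0 \<and> (\<forall>t. (G has_real_derivative G' t) (at t) \<and> (G' has_real_derivative N u t) (at t))"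
      using second_antiderivative_real[OF N_cont[of u]] by metis
  qed
  then obtain G where "\<forall>u. \<exists>G'. G u 0 = 0 \<and> G' 0 = 0 \<and> (\<forall>t. (G u has_real_derivative G' t) (at t) \<and> (G' has_real_derivative N u t) (at t))"
    by blast
  then obtain G' where G0: "\<And>u. G u 0 = 0" "\<And>u. G' u 0 = 0"
    and G: "\<And>u t. (G u has_real_derivative G' u t) (at t)" "\<And>u t. (G' u has_real_derivative N u t) (at t)"
    using choice[of "\<lambda>u G'. G u 0 = 0 \<and> G' 0 = 0 \<and> (\<forall>t. (G u has_real_derivative G' t) (at t) \<and> (G' has_real_derivative N u t) (at t))"]
    by metis
  have P_scale: "((\<lambda>t. c * P t) has_real_derivative c * P' t) (at t)" "((\<lambda>t. c * P' t) has_real_derivative c * w t) (at t)" for c t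
    using P(1,2)[of t] by (auto intro!: derivative_eq_intros)
  define T where "T = (\<lambda>u t. (a + v * t + G u t) / w t)"
  have T_mem: "T u \<in> bcontfun" for u
  proof (rule bcontfun_normI)
    have "continuous_on UNIV (G u)" by (rule continuous_on_if_DERIV[OF G(1)])
    then show "continuous_on UNIV (T u)" unfolding T_def
      using w1(2) by (intro continuous_intros w_cont) (auto simp: less_imp_neq[symmetric])
    fix t
    let ?C = "B + M * norm u"
    have B0: "B \<ge> 0" using f_bound[of 0] by linarith
    have C0: "?C \<ge> 0" using B0 M_nonneg by auto
    have "\<bar>N u t\<bar> \<le> ?C * w t" for t
    proof -
      have "\<bar>N u t\<bar> \<le> \<bar>f t 0\<bar> + \<bar>f t (w t * u t) - f t 0\<bar>" unfolding N_def by linarith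
      also have "\<dots> \<le> B + M * \<bar>w t * u t\<bar>" using f_bound[of t] f_lipschitz[of t "w t * u t" 0] by simp
      also have "\<dots> \<le> B * w t + M * (w t * norm u)"
        using mult_left_mono[OF w1(1)[of t] B0] norm_bounded[of u t] w1(2)[of t] M_nonneg
        by (intro add_mono mult_left_mono) (auto simp: abs_mult)
      finally show ?thesis by (simp add: algebra_simps)
    qed
    from abs_le_if_second_derivative_le[OF G(1)[of u] G(2) P_scale this G0(1,2)] P(3,4)
    have "\<bar>G u t\<bar> \<le> ?C * P t" by simp
    also have "\<dots> \<le> ?C * (w t / \<omega>\<^sup>2)" by (intro mult_left_mono Pw C0)
    finally have "\<bar>a + v * t + G u t\<bar> \<le> \<bar>a\<bar> * w t + \<bar>v\<bar> * ((2 / \<omega>) * w t) + ?C * (w t / \<omega>\<^sup>2)"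
      using mult_left_mono[OF tw[of t], of "\<bar>v\<bar>"] mult_left_mono[OF w1(1)[of t], of "\<bar>a\<bar>"]
        abs_triangle_ineq[of "a + v * t" "G u t"] abs_triangle_ineq[of a "v * t"] by (simp add: abs_mult)
    then have "\<bar>a + v * t + G u t\<bar> / w t \<le> (\<bar>a\<bar> * w t + \<bar>v\<bar> * ((2 / \<omega>) * w t) + ?C * (w t / \<omega>\<^sup>2)) / w t"
      using w1(2)[of t] by (intro divide_right_mono) auto
    also have "\<dots> = \<bar>a\<bar> + \<bar>v\<bar> * (2 / \<omega>) + ?C / \<omega>\<^sup>2"
      using w1(2)[of t] by (simp add: add_divide_distrib)
    finally show "norm (T u t) \<le> \<bar>a\<bar> + \<bar>v\<bar> * (2 / \<omega>) + ?C / \<omega>\<^sup>2"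
      using w1(2)[of t] by (simp add: T_def)
  qed
  define TT where "TT = (\<lambda>u. Bcontfun (T u))"
  have TT: "apply_bcontfun (TT u) = T u" for u unfolding TT_def by (rule Bcontfun_inverse[OF T_mem])
  have "\<exists>!u. TT u = u"
  proof (rule banach_fix_type[of "1/2"]; (intro allI)?)
    fix u u'
    show "dist (TT u) (TT u') \<le> 1/2 * dist u u'"
    proof (rule dist_bound)
      fix t
      have N_diff: "\<bar>N u t - N u' t\<bar> \<le> (M * dist u u') * w t" for t
      proof -
        have "\<bar>N u t - N u' t\<bar> \<le> M * \<bar>w t * u t - w t * u' t\<bar>" unfolding N_def by (rule f_lipschitz)
        also have "\<bar>w t * u t - w t * u' t\<bar> = w t * dist (u t) (u' t)"
          using w1(2)[of t] by (simp add: dist_real_def abs_mult flip: right_diff_distrib)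
        also have "M * \<dots> \<le> M * (w t * dist u u')"
          using w1(2)[of t] M_nonneg dist_bounded[of u t u'] by (intro mult_left_mono) auto
        finally show ?thesis by (simp add: mult_ac)
      qed
      have d: "((\<lambda>t. G u t - G u' t) has_real_derivative G' u t - G' u' t) (at t)"
        "((\<lambda>t. G' u t - G' u' t) has_real_derivative N u t - N u' t) (at t)" for t
        by (auto intro!: derivative_eq_intros G)
      have "\<bar>G u t - G u' t\<bar> \<le> (M * dist u u') * P t"
        by (rule abs_le_if_second_derivative_le[OF d P_scale]) (use N_diff G0 P(3,4) in auto)
      also have "\<dots> \<le> (M * dist u u') * (w t / \<omega>\<^sup>2)" using M_nonneg by (intro mult_left_mono Pw) auto
      also have "\<dots> \<le> 1/2 * dist u u' * w t"
      proof -
        have "M / \<omega>\<^sup>2 \<le> 1/2" using M_nonneg by (simp add: \<omega> field_simps)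
        then have "(M / \<omega>\<^sup>2) * (dist u u' * w t) \<le> 1/2 * (dist u u' * w t)"
          using w1(2)[of t] by (intro mult_right_mono) auto
        then show ?thesis by (simp add: mult_ac)
      qed
      finally have "\<bar>G u t - G u' t\<bar> / w t \<le> (1/2 * dist u u' * w t) / w t"
        using w1(2)[of t] by (intro divide_right_mono) auto
      moreover have "dist (T u t) (T u' t) = \<bar>G u t - G u' t\<bar> / w t"
        using w1(2)[of t] by (simp add: T_def dist_real_def flip: diff_divide_distrib)
      ultimately show "dist (TT u t) (TT u' t) \<le> 1/2 * dist u u'"
        using w1(2)[of t] by (simp add: TT)
    qed
  qed auto
  then obtain u where u: "TT u = u" by blast
  define x where "x = (\<lambda>t. a + v * t + G u t)"
  have wx: "w t * u t = x t" for t
  proof -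
    have "u t = T u t" using u TT by metis
    then show ?thesis using w1(2)[of t] by (simp add: T_def x_def)
  qed
  have "(x has_real_derivative v + G' u t) (at t)" for t
    unfolding x_def by (auto intro!: derivative_eq_intros G)
  moreover have "((\<lambda>t. v + G' u t) has_real_derivative f t (x t)) (at t)" for t
  proof -
    have "((\<lambda>t. v + G' u t) has_real_derivative N u t) (at t)" by (auto intro!: derivative_eq_intros G)
    then show ?thesis by (simp add: N_def wx)
  qed
  ultimately have "ode2_solution f x (\<lambda>t. v + G' u t)" unfolding ode2_solution_def by auto
  then show ?thesis by (intro exI[of _ x] exI[of _ "\<lambda>t. v + G' u t"]) (auto simp: x_def G0)
qed

lemma ivp_existence: "\<exists>x x'. ode2_solution f x x' \<and> x s = a \<and> x' s = v"
proof -
  interpret S: lipschitz_ode2 "\<lambda>t. f (s + t)" M B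
  proof
    have "continuous_on UNIV (\<lambda>z. (\<lambda>(t, x). f t x) (s + fst z, snd z))"
      by (rule continuous_on_compose2[OF f_cont]) (auto intro!: continuous_intros)
    then show "continuous_on UNIV (\<lambda>(t, x). f (s + t) x)" by (simp add: case_prod_beta)
  qed (use f_lipschitz f_bound in auto)
  obtain x x' where x: "ode2_solution (\<lambda>t. f (s + t)) x x'" "x 0 = a" "x' 0 = v"
    using S.ivp_existence_at_0 by blast
  have "((\<lambda>t. g (t - s)) has_real_derivative d) (at t)" if "(g has_real_derivative d) (at (t - s))" for g d t
    using DERIV_shift[of g d "t" "- s"] that by simp
  then have "ode2_solution f (\<lambda>t. x (t - s)) (\<lambda>t. x' (t - s))"
    using ode2_solutionD[OF x(1)] unfolding ode2_solution_def by (metis add.commute diff_add_cancel)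
  then show ?thesis using x(2,3) by (intro exI[of _ "\<lambda>t. x (t - s)"] exI[of _ "\<lambda>t. x' (t - s)"]) auto
qed

lemma solution_dependence:
  assumes "ode2_solution f x x'" "ode2_solution f y y'" "s \<le> t"
  shows "(x t - y t)\<^sup>2 + (x' t - y' t)\<^sup>2 \<le> exp ((2 + 2 * M\<^sup>2) * (t - s)) * ((x s - y s)\<^sup>2 + (x' s - y' s)\<^sup>2)"
proof -
  have d: "((\<lambda>t. x t - y t) has_real_derivative x' t - y' t) (at t)"
    "((\<lambda>t. x' t - y' t) has_real_derivative f t (x t) - f t (y t)) (at t)" for t
    by (intro DERIV_diff ode2_solutionD[OF assms(1)] ode2_solutionD[OF assms(2)])+
  show ?thesis
    using gronwall2[of s t "\<lambda>t. x t - y t", OF d(1) d(2), of M 0] assms(3) f_lipschitz M_nonneg by simp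
qed

lemma solution_dependence_backward:
  assumes "ode2_solution f x x'" "ode2_solution f y y'" "t \<le> s"
  shows "(x t - y t)\<^sup>2 + (x' t - y' t)\<^sup>2 \<le> exp ((2 + 2 * M\<^sup>2) * (s - t)) * ((x s - y s)\<^sup>2 + (x' s - y' s)\<^sup>2)"
proof -
  have r: "((\<lambda>t. g (- t)) has_real_derivative - d) (at t)" if "(g has_real_derivative d) (at (- t))" for g :: "real \<Rightarrow> real" and d t
    using DERIV_mirror[of g d t] that by (metis (no_types, lifting) DERIV_mirror minus_minus)
  have d: "((\<lambda>t. x (- t) - y (- t)) has_real_derivative - x' (- t) - - y' (- t)) (at t)"
     "((\<lambda>t. - x' (- t) - - y' (- t)) has_real_derivative - (- f (- t) (x (- t))) - - (- f (- t) (y (- t)))) (at t)" for t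
    by (intro DERIV_diff DERIV_minus r ode2_solutionD[OF assms(1)] ode2_solutionD[OF assms(2)])+
  show ?thesis
    using gronwall2[of "- s" "- t" "\<lambda>t. x (- t) - y (- t)", OF d(1) d(2), of M 0] assms(3) f_lipschitz M_nonneg
    by (simp add: power2_commute[of "y' _"] algebra_simps)
qed

lemma solution_unique:
  assumes "ode2_solution f x x'" "ode2_solution f y y'" "x s = y s" "x' s = y' s"
  shows "x = y" "x' = y'"
proof -
  have "(x t - y t)\<^sup>2 + (x' t - y' t)\<^sup>2 \<le> 0" for t
    using solution_dependence[OF assms(1,2), of s t] solution_dependence_backward[OF assms(1,2), of t s] assms(3,4)
    by (cases "s \<le> t") auto
  then have "x t = y t \<and> x' t = y' t" for t
    using sum_power2_eq_zero_iff[of "x t - y t" "x' t - y' t"] by (smt (verit) zero_le_power2)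
  then show "x = y" "x' = y'" by auto
qed

definition trajectory :: "real \<Rightarrow> real \<Rightarrow> real \<Rightarrow> (real \<Rightarrow> real) \<times> (real \<Rightarrow> real)" where
  "trajectory s a v = (SOME p. ode2_solution f (fst p) (snd p) \<and> fst p s = a \<and> snd p s = v)"

definition pos :: "real \<Rightarrow> real \<Rightarrow> real \<Rightarrow> real \<Rightarrow> real" where
  "pos s a v = fst (trajectory s a v)"

definition vel :: "real \<Rightarrow> real \<Rightarrow> real \<Rightarrow> real \<Rightarrow> real" where
  "vel s a v = snd (trajectory s a v)"

lemma trajectory: "ode2_solution f (pos s a v) (vel s a v)" "pos s a v s = a" "vel s a v s = v"
proof -
  have "\<exists>p. ode2_solution f (fst p) (snd p) \<and> fst p s = a \<and> snd p s = v"
    using ivp_existence[of s a v] by auto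
  from someI_ex[OF this]
  show "ode2_solution f (pos s a v) (vel s a v)" "pos s a v s = a" "vel s a v s = v"
    unfolding pos_def vel_def trajectory_def by auto
qed

lemma trajectory_unique:
  assumes "ode2_solution f x x'"
  shows "pos s (x s) (x' s) = x" "vel s (x s) (x' s) = x'"
  using solution_unique[OF trajectory(1) assms, of s "x s" "x' s" s] trajectory(2,3) by auto

lemma trajectory_dependence:
  assumes "s \<le> t"
  shows "(pos s a v t - pos s b w t)\<^sup>2 + (vel s a v t - vel s b w t)\<^sup>2
    \<le> exp ((2 + 2 * M\<^sup>2) * (t - s)) * ((a - b)\<^sup>2 + (v - w)\<^sup>2)"
  using solution_dependence[OF trajectory(1) trajectory(1) assms, of s a v s b w] by (simp add: trajectory)

end

section \<open>Differentiability in the initial data\<close>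

locale smooth_ode2 = lipschitz_ode2 +
  fixes fx :: "real \<Rightarrow> real \<Rightarrow> real"
  assumes fx: "\<And>t x. (f t has_real_derivative fx t x) (at x)"
    and fx_cont: "continuous_on UNIV (\<lambda>(t, x). fx t x)"
    and fx_bound: "\<And>t x. \<bar>fx t x\<bar> \<le> M"
begin

lemma linearization_lipschitz:
  assumes "continuous_on UNIV x"
  shows "lipschitz_ode2 (\<lambda>t y. fx t (x t) * y) M 0"
proof
  have "continuous_on UNIV (\<lambda>z. (\<lambda>(t, x). fx t x) (fst z, x (fst z)) * snd z)"
    by (intro continuous_intros continuous_on_compose2[OF fx_cont] continuous_on_compose2[OF assms]) auto
  then show "continuous_on UNIV (\<lambda>(t, y). fx t (x t) * y)" by (simp add: case_prod_beta)
  show "\<bar>fx t (x t) * y - fx t (x t) * z\<bar> \<le> M * \<bar>y - z\<bar>" for t y z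
    using fx_bound[of t "x t"] by (simp add: abs_mult mult_right_mono flip: right_diff_distrib)
qed auto

text \<open>The point is that \<open>\<delta>\<close> does not depend on \<open>t\<close>:
  \<open>fx\<close> is uniformly continuous on a compact tube of radius 1 about the graph of
  \<open>x\<close> over \<open>{0..S}\<close>, and the mean value theorem turns this into a bound on
  the remainder.\<close>

lemma first_order_remainder:
  assumes "continuous_on UNIV x" "\<epsilon> > 0"
  obtains \<delta> where "\<delta> > 0"
    "\<And>t d. 0 \<le> t \<Longrightarrow> t \<le> S \<Longrightarrow> \<bar>d\<bar> < \<delta> \<Longrightarrow> \<bar>f t (x t + d) - f t (x t) - fx t (x t) * d\<bar> \<le> \<epsilon> * \<bar>d\<bar>"
proof -
  have "compact (x ` {0..S})" by (intro compact_continuous_image continuous_on_subset[OF assms(1)]) auto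
  then have "bounded (x ` {0..S})" by (rule compact_imp_bounded)
  then obtain R where R: "\<And>t. t \<in> {0..S} \<Longrightarrow> \<bar>x t\<bar> \<le> R"
    unfolding bounded_iff by (metis imageI real_norm_def)
  define K where "K = {0..S} \<times> {-R-1..R+1}"
  have "uniformly_continuous_on K (\<lambda>(t, x). fx t x)"
    unfolding K_def by (intro compact_uniformly_continuous continuous_on_subset[OF fx_cont] compact_Times) auto
  then obtain d0 where d0: "d0 > 0" "\<And>p q. p \<in> K \<Longrightarrow> q \<in> K \<Longrightarrow> dist q p < d0 \<Longrightarrow>
      dist ((\<lambda>(t, x). fx t x) q) ((\<lambda>(t, x). fx t x) p) < \<epsilon>"
    using assms(2) unfolding uniformly_continuous_on_def by meson
  show ?thesis
  proof (rule that[of "min d0 1"])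
    show "min d0 1 > 0" using d0 by auto
    fix t d assume t: "0 \<le> t" "t \<le> S" and d: "\<bar>d\<bar> < min d0 1"
    have near: "\<bar>fx t y - fx t (x t)\<bar> \<le> \<epsilon>" if "\<bar>y - x t\<bar> \<le> \<bar>d\<bar>" for y
    proof -
      have "(t, y) \<in> K" "(t, x t) \<in> K" using R[of t] t d that unfolding K_def by auto
      moreover have "dist (t, y) (t, x t) < d0" using that d by (simp add: dist_Pair_Pair dist_real_def)
      ultimately show ?thesis using d0(2) by (fastforce simp: dist_real_def)
    qed
    let ?g = "\<lambda>y. f t y - fx t (x t) * y"
    have "\<bar>?g (x t + d) - ?g (x t)\<bar> \<le> \<epsilon> * \<bar>x t + d - x t\<bar>"
    proof (rule field_differentiable_bound[of "cball (x t) \<bar>d\<bar>" ?g "\<lambda>y. fx t y - fx t (x t)", unfolded real_norm_def])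
      show "(?g has_real_derivative fx t y - fx t (x t)) (at y within cball (x t) \<bar>d\<bar>)" for y
        by (rule has_field_derivative_at_within) (auto intro!: derivative_eq_intros fx)
    qed (auto simp: dist_real_def intro!: near)
    then show "\<bar>f t (x t + d) - f t (x t) - fx t (x t) * d\<bar> \<le> \<epsilon> * \<bar>d\<bar>"
      by (simp add: algebra_simps)
  qed
qed

text \<open>Position and velocity are packed into one complex number so that the count of zeros of
  periodic complex functions applies.\<close>

definition time_map :: "real \<Rightarrow> complex \<Rightarrow> complex" where
  "time_map S z = Complex (pos 0 (Re z) (Im z) S) (vel 0 (Re z) (Im z) S)"

lemma time_map_dist:
  assumes "0 \<le> S"
  shows "norm (time_map S z - time_map S w) \<le> exp ((1 + M\<^sup>2) * S) * norm (z - w)"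
proof (rule power2_le_imp_le)
  have "(norm (time_map S z - time_map S w))\<^sup>2 \<le> exp ((2 + 2 * M\<^sup>2) * (S - 0)) * ((Re z - Re w)\<^sup>2 + (Im z - Im w)\<^sup>2)"
    using trajectory_dependence[OF assms, of "Re z" "Im z" "Re w" "Im w"]
    by (simp add: time_map_def cmod_power2)
  also have "\<dots> = (exp ((1 + M\<^sup>2) * S) * norm (z - w))\<^sup>2"
    by (simp add: power_mult_distrib cmod_power2 algebra_simps flip: exp_double)
  finally show "(norm (time_map S z - time_map S w))\<^sup>2 \<le> (exp ((1 + M\<^sup>2) * S) * norm (z - w))\<^sup>2" .
qed auto

lemma continuous_on_time_map: "0 \<le> S \<Longrightarrow> continuous_on U (time_map S)"
  by (rule lipschitz_on_continuous_on[of "exp ((1 + M\<^sup>2) * S)"])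
     (rule lipschitz_onI, simp_all add: dist_norm time_map_dist)

text \<open>The columns of the derivative are the two basic solutions \<open>y\<close> and
  \<open>q\<close> of the linearized equation. The linearization error \<open>?u\<close> has zero
  initial data and satisfies the linearized equation up to a forcing of size at most
  \<open>\<eta>\<close>, so \<open>gronwall2\<close> applies.\<close>

lemma time_map_derivative:
  fixes z :: complex
  assumes S: "0 \<le> S"
    and y: "ode2_solution (\<lambda>t y. fx t (pos 0 (Re z) (Im z) t) * y) y y'" "y 0 = 1" "y' 0 = 0"
    and q: "ode2_solution (\<lambda>t y. fx t (pos 0 (Re z) (Im z) t) * y) q q'" "q 0 = 0" "q' 0 = 1"
  shows "(time_map S has_derivative
     (\<lambda>h. Complex (Re h * y S + Im h * q S) (Re h * y' S + Im h * q' S))) (at z)"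
proof -
  let ?D = "\<lambda>h. Complex (Re h * y S + Im h * q S) (Re h * y' S + Im h * q' S)"
  let ?x = "pos 0 (Re z) (Im z)" and ?x' = "vel 0 (Re z) (Im z)"
  have Deq: "?D = (\<lambda>h. Re h *\<^sub>R Complex (y S) (y' S) + Im h *\<^sub>R Complex (q S) (q' S))"
    by (auto simp: complex_eq_iff)
  have bl: "bounded_linear ?D" unfolding Deq
    by (intro bounded_linear_add bounded_linear_scaleR_left[THEN bounded_linear_compose] bounded_linear_Re bounded_linear_Im)
  have x_cont: "continuous_on UNIV ?x" by (rule ode2_solution_continuous[OF trajectory(1)])
  define E where "E = exp ((1 + M\<^sup>2) * S)"
  have E: "E > 0" "exp ((2 + 2 * M\<^sup>2) * S) = E\<^sup>2"
    by (auto simp: E_def power2_eq_square algebra_simps simp flip: exp_add)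
  show ?thesis unfolding has_derivative_at_alt
  proof (intro conjI bl allI impI)
    fix e :: real assume e: "e > 0"
    \<comment> \<open>Two factors \<open>E\<close> have to be paid for: one from the spreading of
      the two trajectories, one from Gronwall for the error. The radius \<open>\<delta> / E\<close>
      used below keeps the trajectories within \<open>\<delta>\<close> of each other up to time
      \<open>S\<close>.\<close>
    define \<epsilon> where "\<epsilon> = e / E\<^sup>2"
    have \<epsilon>: "\<epsilon> > 0" using e E by (auto simp: \<epsilon>_def)
    obtain \<delta> where \<delta>: "\<delta> > 0" "\<And>t d. 0 \<le> t \<Longrightarrow> t \<le> S \<Longrightarrow> \<bar>d\<bar> < \<delta> \<Longrightarrow>
        \<bar>f t (?x t + d) - f t (?x t) - fx t (?x t) * d\<bar> \<le> \<epsilon> * \<bar>d\<bar>"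
      using first_order_remainder[OF x_cont \<epsilon>, of S] by blast
    show "\<exists>d>0. \<forall>w. norm (w - z) < d \<longrightarrow> norm (time_map S w - time_map S z - ?D (w - z)) \<le> e * norm (w - z)"
    proof (intro exI[of _ "\<delta> / E"] conjI allI impI)
      show "\<delta> / E > 0" using \<delta> E by auto
      fix w assume w: "norm (w - z) < \<delta> / E"
      let ?w = "pos 0 (Re w) (Im w)" and ?w' = "vel 0 (Re w) (Im w)"
      define a b where "a = Re (w - z)" and "b = Im (w - z)"
      let ?u = "\<lambda>t. ?w t - ?x t - (a * y t + b * q t)"
      let ?u' = "\<lambda>t. ?w' t - ?x' t - (a * y' t + b * q' t)"
      let ?u'' = "\<lambda>t. f t (?w t) - f t (?x t) - (a * (fx t (?x t) * y t) + b * (fx t (?x t) * q t))"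
      define \<eta> where "\<eta> = \<epsilon> * (E * norm (w - z))"
      have d: "(?u has_real_derivative ?u' t) (at t)" "(?u' has_real_derivative ?u'' t) (at t)" for t
        by (intro DERIV_diff DERIV_add DERIV_cmult ode2_solutionD[OF trajectory(1)] ode2_solutionD[OF y(1)] ode2_solutionD[OF q(1)])+
      have bd: "\<bar>?u'' t\<bar> \<le> M * \<bar>?u t\<bar> + \<eta>" if t: "0 \<le> t" "t \<le> S" for t
      proof -
        let ?d = "?w t - ?x t"
        have "\<bar>?d\<bar> \<le> norm (time_map t w - time_map t z)"
          using abs_Re_le_cmod[of "time_map t w - time_map t z"] by (simp add: time_map_def)
        also have "\<dots> \<le> exp ((1 + M\<^sup>2) * t) * norm (w - z)" by (rule time_map_dist[OF t(1)])
        also have "\<dots> \<le> E * norm (w - z)" unfolding E_def using t by (intro mult_right_mono) (auto intro!: mult_left_mono)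
        finally have dE: "\<bar>?d\<bar> \<le> E * norm (w - z)" .
        also have "\<dots> < \<delta>" using w E by (simp add: field_simps)
        finally have "\<bar>f t (?x t + ?d) - f t (?x t) - fx t (?x t) * ?d\<bar> \<le> \<epsilon> * \<bar>?d\<bar>" using \<delta>(2)[OF t] by blast
        also have "\<dots> \<le> \<eta>" unfolding \<eta>_def using dE \<epsilon> by (intro mult_left_mono) auto
        finally have 1: "\<bar>f t (?w t) - f t (?x t) - fx t (?x t) * ?d\<bar> \<le> \<eta>" by simp
        have "?u'' t = fx t (?x t) * ?u t + (f t (?w t) - f t (?x t) - fx t (?x t) * ?d)"
          by (simp add: algebra_simps)
        then have "\<bar>?u'' t\<bar> \<le> \<bar>fx t (?x t)\<bar> * \<bar>?u t\<bar> + \<bar>f t (?w t) - f t (?x t) - fx t (?x t) * ?d\<bar>"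
          by (metis abs_mult abs_triangle_ineq)
        also have "\<dots> \<le> M * \<bar>?u t\<bar> + \<eta>" using 1 fx_bound[of t "?x t"] by (intro add_mono mult_right_mono) auto
        finally show ?thesis .
      qed
      have "(?u S)\<^sup>2 + (?u' S)\<^sup>2 + \<eta>\<^sup>2 \<le> exp ((2 + 2 * M\<^sup>2) * (S - 0)) * ((?u 0)\<^sup>2 + (?u' 0)\<^sup>2 + \<eta>\<^sup>2)"
        by (rule gronwall2[OF d bd M_nonneg]) (use S \<epsilon> E in \<open>auto simp: \<eta>_def\<close>)
      also have "\<dots> = (E * \<eta>)\<^sup>2"
        by (simp add: E trajectory y q a_def b_def power_mult_distrib)
      finally have 2: "(?u S)\<^sup>2 + (?u' S)\<^sup>2 \<le> (E * \<eta>)\<^sup>2" using zero_le_power2[of \<eta>] by linarith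
      have "(norm (time_map S w - time_map S z - ?D (w - z)))\<^sup>2 = (?u S)\<^sup>2 + (?u' S)\<^sup>2"
        by (simp add: cmod_power2 time_map_def a_def b_def)
      with 2 have "(norm (time_map S w - time_map S z - ?D (w - z)))\<^sup>2 \<le> (E * \<eta>)\<^sup>2" by (simp only:)
      then have "norm (time_map S w - time_map S z - ?D (w - z)) \<le> E * \<eta>"
        by (rule power2_le_imp_le) (use E \<epsilon> in \<open>simp add: \<eta>_def\<close>)
      also have "\<dots> = e * norm (w - z)" using E by (simp add: \<eta>_def \<epsilon>_def power2_eq_square)
      finally show "norm (time_map S w - time_map S z - ?D (w - z)) \<le> e * norm (w - z)" .
    qed
  qed
qed

end

section \<open>Short links between two points\<close>

lemma DERIV_time_shift:
  assumes "(g has_real_derivative d) (at (t - s))"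
  shows "((\<lambda>t. g (t - s)) has_real_derivative d) (at t)"
  using DERIV_shift[of g d t "- s"] assms by simp

lemma sum_square_le_imp_le:
  fixes x y c :: real
  shows "x\<^sup>2 + y\<^sup>2 \<le> c \<Longrightarrow> x\<^sup>2 \<le> c"
  using zero_le_power2[of y] by linarith

locale periodic_potential =
  fixes V Vx Vxx :: "real \<Rightarrow> real \<Rightarrow> real" and T0 M B :: real
  assumes T0: "T0 > 0"
    and V_cont: "continuous_on UNIV (\<lambda>(t, x). V t x)"
    and Vx_cont: "continuous_on UNIV (\<lambda>(t, x). Vx t x)"
    and Vxx_cont: "continuous_on UNIV (\<lambda>(t, x). Vxx t x)"
    and V_deriv: "\<And>t x. (V t has_real_derivative Vx t x) (at x)"
    and Vx_deriv: "\<And>t x. (Vx t has_real_derivative Vxx t x) (at x)"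
    and V_shift: "\<And>t x. V t (x + 1) = V t x" and Vx_shift: "\<And>t x. Vx t (x + 1) = Vx t x"
    and V_time: "\<And>t x. V (t + T0) x = V t x" and Vx_time: "\<And>t x. Vx (t + T0) x = Vx t x"
    and V_bound: "\<And>t x. \<bar>V t x\<bar> \<le> B" and Vx_bound: "\<And>t x. \<bar>Vx t x\<bar> \<le> B"
    and Vxx_bound: "\<And>t x. \<bar>Vxx t x\<bar> \<le> M"
begin

abbreviation force :: "real \<Rightarrow> real \<Rightarrow> real" where "force \<equiv> (\<lambda>t x. - Vx t x)"

lemma Vx_lipschitz: "\<bar>Vx t x - Vx t y\<bar> \<le> M * \<bar>x - y\<bar>"
  using field_differentiable_bound[of UNIV "Vx t" "Vxx t" M x y, unfolded real_norm_def] Vx_deriv Vxx_bound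
  by simp

sublocale smooth_ode2 force M B "\<lambda>t x. - Vxx t x"
proof
  show "continuous_on UNIV (\<lambda>(t, x). - Vx t x)"
    using continuous_on_minus[OF Vx_cont] by (simp add: case_prod_beta)
  show "continuous_on UNIV (\<lambda>(t, x). - Vxx t x)"
    using continuous_on_minus[OF Vxx_cont] by (simp add: case_prod_beta)
  show "\<bar>- Vx t x - - Vx t y\<bar> \<le> M * \<bar>x - y\<bar>" for t x y
    using Vx_lipschitz[of t x y] by linarith
qed (use Vx_bound Vxx_bound in \<open>auto intro: DERIV_minus Vx_deriv\<close>)

lemma shift_int: "V t (x + of_int k) = V t x" "Vx t (x + of_int k) = Vx t x"
proof -
  have "V t (x + of_int k) = V t x \<and> Vx t (x + of_int k) = Vx t x"
  proof (induction k rule: int_induct[of _ 0])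
    case (step1 i)
    then show ?case using V_shift[of t "x + of_int i"] Vx_shift[of t "x + of_int i"] by (simp add: add.assoc)
  next
    case (step2 i)
    then show ?case using V_shift[of t "x + of_int (i - 1)"] Vx_shift[of t "x + of_int (i - 1)"] by (simp add: algebra_simps)
  qed simp
  then show "V t (x + of_int k) = V t x" "Vx t (x + of_int k) = Vx t x" by auto
qed

lemma time_multiple: "V (t + real i * T0) x = V t x" "Vx (t + real i * T0) x = Vx t x"
proof -
  have "V (t + real i * T0) x = V t x \<and> Vx (t + real i * T0) x = Vx t x"
  proof (induction i)
    case (Suc i)
    then show ?case using V_time[of "t + real i * T0" x] Vx_time[of "t + real i * T0" x] by (simp add: algebra_simps)
  qed simp
  then show "V (t + real i * T0) x = V t x" "Vx (t + real i * T0) x = Vx t x" by auto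
qed

lemma solution_shift:
  assumes "ode2_solution force x x'"
  shows "ode2_solution force (\<lambda>t. x t + of_int k) x'"
  unfolding ode2_solution_def shift_int
proof (intro allI conjI)
  fix t
  show "((\<lambda>t. x t + of_int k) has_real_derivative x' t) (at t)"
    using DERIV_add[OF ode2_solutionD(1)[OF assms, of t] DERIV_const[of "of_int k"]] by simp
qed (rule ode2_solutionD(2)[OF assms])

lemma solution_time_shift:
  assumes "ode2_solution force x x'"
  shows "ode2_solution force (\<lambda>t. x (t - real i * T0)) (\<lambda>t. x' (t - real i * T0))"
  unfolding ode2_solution_def
proof (intro allI conjI)
  fix t
  show "((\<lambda>t. x (t - real i * T0)) has_real_derivative x' (t - real i * T0)) (at t)"
    by (intro DERIV_time_shift ode2_solutionD[OF assms])
  have "((\<lambda>t. x' (t - real i * T0)) has_real_derivative - Vx (t - real i * T0) (x (t - real i * T0))) (at t)"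
    by (intro DERIV_time_shift ode2_solutionD[OF assms])
  then show "((\<lambda>t. x' (t - real i * T0)) has_real_derivative - Vx t (x (t - real i * T0))) (at t)"
    using time_multiple(2)[of "t - real i * T0" i] by simp
qed

lemma trajectory_shift:
  "pos s (a + of_int k) v t = pos s a v t + of_int k" "vel s (a + of_int k) v t = vel s a v t"
  using trajectory_unique[OF solution_shift[OF trajectory(1)], of s s a v k]
  by (simp_all add: trajectory)

lemma trajectory_time_shift:
  "pos (s + real i * T0) a v (t + real i * T0) = pos s a v t"
  "vel (s + real i * T0) a v (t + real i * T0) = vel s a v t"
  using trajectory_unique[OF solution_time_shift[OF trajectory(1), of s a v i], of "s + real i * T0"]
  by (simp_all add: trajectory)

lemma V_remainder: "\<bar>V t y - V t x - Vx t x * (y - x)\<bar> \<le> M * (y - x)\<^sup>2"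
proof -
  let ?g = "\<lambda>u. V t u - Vx t x * u"
  have "\<bar>?g y - ?g x\<bar> \<le> (M * \<bar>y - x\<bar>) * \<bar>y - x\<bar>"
  proof (rule field_differentiable_bound[of "cball x \<bar>y - x\<bar>" ?g "\<lambda>u. Vx t u - Vx t x", unfolded real_norm_def])
    show "(?g has_real_derivative Vx t u - Vx t x) (at u within cball x \<bar>y - x\<bar>)" for u
      by (rule has_field_derivative_at_within) (auto intro!: derivative_eq_intros V_deriv)
    show "\<bar>Vx t u - Vx t x\<bar> \<le> M * \<bar>y - x\<bar>" if "u \<in> cball x \<bar>y - x\<bar>" for u
      using order_trans[OF Vx_lipschitz[of t u x] mult_left_mono[of "\<bar>u - x\<bar>" "\<bar>y - x\<bar>" M]] that M_nonneg
      by (simp add: dist_real_def abs_minus_commute)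
  qed (auto simp: dist_real_def)
  then show ?thesis by (simp add: algebra_simps power2_eq_square abs_mult_self_eq flip: abs_mult)
qed

end

text \<open>A time step so short that two points are joined by exactly one solution.\<close>

locale short_step = periodic_potential +
  fixes \<tau> :: real
  assumes tau: "\<tau> > 0" "exp ((2 + 2 * M\<^sup>2) * \<tau>) \<le> 4" "4 * M * \<tau> \<le> 1"
begin

text \<open>The condition \<open>exp ((2 + 2 * M^2) * \<tau>) \<le> 4\<close> serves this bound:
  over one step the flow stretches distances at most by the factor 2.\<close>

lemma dependence:
  assumes "s \<le> t" "t \<le> s + \<tau>"
  shows "(pos s a v t - pos s b w t)\<^sup>2 + (vel s a v t - vel s b w t)\<^sup>2 \<le> 4 * ((a - b)\<^sup>2 + (v - w)\<^sup>2)"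
proof -
  have "exp ((2 + 2 * M\<^sup>2) * (t - s)) \<le> exp ((2 + 2 * M\<^sup>2) * \<tau>)"
    using assms by (simp add: mult_left_mono)
  also have "\<dots> \<le> 4" by (rule tau(2))
  finally have "exp ((2 + 2 * M\<^sup>2) * (t - s)) * ((a - b)\<^sup>2 + (v - w)\<^sup>2) \<le> 4 * ((a - b)\<^sup>2 + (v - w)\<^sup>2)"
    by (intro mult_right_mono) auto
  then show ?thesis using trajectory_dependence[OF assms(1), of a v b w] by linarith
qed

lemma pos_dependence_start: "\<bar>pos s a v (s + \<tau>) - pos s b v (s + \<tau>)\<bar> \<le> 2 * \<bar>a - b\<bar>"
proof -
  have "(pos s a v (s + \<tau>) - pos s b v (s + \<tau>))\<^sup>2 \<le> 4 * ((a - b)\<^sup>2 + (v - v)\<^sup>2)"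
    by (rule sum_square_le_imp_le, rule dependence) (use tau(1) in auto)
  then have "(pos s a v (s + \<tau>) - pos s b v (s + \<tau>))\<^sup>2 \<le> (2 * \<bar>a - b\<bar>)\<^sup>2"
    by (simp add: power_mult_distrib)
  from abs_le_square_iff[THEN iffD2, OF this] show ?thesis by simp
qed

lemma pos_dependence_velocity:
  assumes "s \<le> t" "t \<le> s + \<tau>"
  shows "\<bar>pos s a v t - pos s a w t\<bar> \<le> 2 * \<bar>v - w\<bar>"
proof -
  have "(pos s a v t - pos s a w t)\<^sup>2 \<le> 4 * ((a - a)\<^sup>2 + (v - w)\<^sup>2)"
    by (rule sum_square_le_imp_le, rule dependence[OF assms])
  then have "(pos s a v t - pos s a w t)\<^sup>2 \<le> (2 * \<bar>v - w\<bar>)\<^sup>2"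
    by (simp add: power_mult_distrib)
  from abs_le_square_iff[THEN iffD2, OF this] show ?thesis by simp
qed

text \<open>For equal starting points the difference of the trajectories has second derivative at
  most \<open>2 * M * (v - w)\<close> in modulus. During one step the velocity difference therefore
  loses at most \<open>2 * M * \<tau> * (v - w)\<close>, which by
  \<open>4 * M * \<tau> \<le> 1\<close> is at most half of it; the remaining half is integrated.
  This excludes conjugate points within a step.\<close>

lemma shoot_expanding:
  assumes "w \<le> v"
  shows "\<tau> / 2 * (v - w) \<le> pos s a v (s + \<tau>) - pos s a w (s + \<tau>)"
proof -
  let ?d = "\<lambda>t. pos s a v t - pos s a w t" and ?d' = "\<lambda>t. vel s a v t - vel s a w t"
  let ?d'' = "\<lambda>t. - Vx t (pos s a v t) - - Vx t (pos s a w t)"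
  have d: "(?d has_real_derivative ?d' t) (at t)" "(?d' has_real_derivative ?d'' t) (at t)" for t
    by (intro DERIV_diff ode2_solutionD[OF trajectory(1)])+
  have d'_ge: "(v - w) / 2 \<le> ?d' t" if t: "s \<le> t" "t \<le> s + \<tau>" for t
  proof -
    have "?d' s + 2 * M * (v - w) * (s - s) \<le> ?d' t + 2 * M * (v - w) * (t - s)"
    proof (rule DERIV_nonneg_imp_nondecreasing[OF t(1)])
      fix r assume r: "s \<le> r" "r \<le> t"
      have "\<bar>?d'' r\<bar> \<le> M * \<bar>?d r\<bar>" using Vx_lipschitz[of r "pos s a v r" "pos s a w r"] by linarith
      also have "\<dots> \<le> M * (2 * \<bar>v - w\<bar>)"
        using r t by (intro mult_left_mono pos_dependence_velocity M_nonneg) auto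
      also have "\<dots> = 2 * M * (v - w)" using assms by simp
      finally have "0 \<le> ?d'' r + 2 * M * (v - w)" by linarith
      moreover have "((\<lambda>t. ?d' t + 2 * M * (v - w) * (t - s)) has_real_derivative ?d'' r + 2 * M * (v - w)) (at r)"
        using DERIV_add[OF d(2)[of r] DERIV_cmult[OF DERIV_diff[OF DERIV_ident DERIV_const[of s]], of "2 * M * (v - w)"]]
        by simp
      ultimately show "\<exists>y. ((\<lambda>t. ?d' t + 2 * M * (v - w) * (t - s)) has_real_derivative y) (at r) \<and> 0 \<le> y"
        by blast
    qed
    moreover have "2 * M * (v - w) * (t - s) \<le> (v - w) / 2"
    proof -
      have "(4 * M * (t - s)) * (v - w) \<le> 1 * (v - w)"
        using t assms M_nonneg order_trans[OF mult_left_mono[of "t - s" \<tau> "4 * M"] tau(3)]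
        by (intro mult_right_mono) auto
      then show ?thesis by (simp add: algebra_simps)
    qed
    ultimately show ?thesis by (simp add: trajectory)
  qed
  have "?d s - (v - w) / 2 * (s - s) \<le> ?d (s + \<tau>) - (v - w) / 2 * (s + \<tau> - s)"
  proof (rule DERIV_nonneg_imp_nondecreasing[of s "s + \<tau>" "\<lambda>t. ?d t - (v - w) / 2 * (t - s)"])
    fix r assume r: "s \<le> r" "r \<le> s + \<tau>"
    have "((\<lambda>t. ?d t - (v - w) / 2 * (t - s)) has_real_derivative ?d' r - (v - w) / 2) (at r)"
      using DERIV_diff[OF d(1)[of r] DERIV_cmult[OF DERIV_diff[OF DERIV_ident DERIV_const[of s]], of "(v - w) / 2"]]
      by simp
    then show "\<exists>y. ((\<lambda>t. ?d t - (v - w) / 2 * (t - s)) has_real_derivative y) (at r) \<and> 0 \<le> y"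
      using d'_ge[OF r] by force
  qed (use tau in auto)
  then show ?thesis by (simp add: trajectory mult.commute)
qed

lemma shoot_expanding_abs: "\<tau> / 2 * \<bar>v - w\<bar> \<le> \<bar>pos s a v (s + \<tau>) - pos s a w (s + \<tau>)\<bar>"
proof (cases "w \<le> v")
  case True
  then have "\<tau> / 2 * \<bar>v - w\<bar> = \<tau> / 2 * (v - w)" by simp
  then show ?thesis using shoot_expanding[OF True, of s a] by linarith
next
  case False
  then have "\<tau> / 2 * \<bar>v - w\<bar> = \<tau> / 2 * (w - v)" by simp
  then show ?thesis using shoot_expanding[of v w s a] False by linarith
qed

lemma shoot_exists: "\<exists>v. pos s a v (s + \<tau>) = b"
proof -
  let ?p = "\<lambda>v. pos s a v (s + \<tau>)"
  \<comment> \<open>By the expansion rate \<open>\<tau> / 2\<close>, the velocities \<open>R\<close>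
    and \<open>- R\<close> move the end point by at least its distance to \<open>b\<close>, so
    \<open>b\<close> is enclosed.\<close>
  define R where "R = (2 / \<tau>) * \<bar>b - ?p 0\<bar>"
  have R: "R \<ge> 0" "\<tau> / 2 * R = \<bar>b - ?p 0\<bar>" using tau(1) by (auto simp: R_def)
  have hi: "b \<le> ?p R" using shoot_expanding[OF R(1), of s a] R(2) by (simp only: diff_0_right)
  have lo: "?p (- R) \<le> b" using shoot_expanding[of "- R" 0 s a] R by (simp only: diff_minus_eq_add add_0, linarith?)
  have "continuous_on {- R..R} ?p"
    by (rule lipschitz_on_continuous_on[of 2], rule lipschitz_onI)
       (use tau(1) in \<open>auto simp: dist_real_def intro!: pos_dependence_velocity\<close>)
  then show ?thesis using IVT'[of ?p "- R" b R, OF lo hi] R(1) by auto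
qed

section \<open>Slope, end velocity and action of a link\<close>

definition slope :: "real \<Rightarrow> real \<Rightarrow> real \<Rightarrow> real" where
  "slope s a b = (THE v. pos s a v (s + \<tau>) = b)"

lemma shoot_inj: "pos s a v (s + \<tau>) = pos s a w (s + \<tau>) \<Longrightarrow> v = w"
  using shoot_expanding_abs[of v w s a] tau(1) by (simp add: mult_le_0_iff)

lemma pos_slope: "pos s a (slope s a b) (s + \<tau>) = b"
  unfolding slope_def by (rule theI') (metis shoot_exists shoot_inj)

lemma slope_unique: "pos s a v (s + \<tau>) = b \<Longrightarrow> slope s a b = v"
  by (rule shoot_inj[of s a]) (simp add: pos_slope)

definition end_velocity :: "real \<Rightarrow> real \<Rightarrow> real \<Rightarrow> real" where
  "end_velocity s a b = vel s a (slope s a b) (s + \<tau>)"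

text \<open>This is the generating function of the flow over one step: its partial derivatives in
  \<open>a\<close> and \<open>b\<close> are \<open>- slope s a b\<close> and
  \<open>end_velocity s a b\<close>.\<close>

definition link_action :: "real \<Rightarrow> real \<Rightarrow> real \<Rightarrow> real" where
  "link_action s a b =
     integral {s..s + \<tau>} (\<lambda>t. (vel s a (slope s a b) t)\<^sup>2 / 2 - V t (pos s a (slope s a b) t))"

lemma slope_lipschitz: "\<bar>slope s a b - slope s a' b'\<bar> \<le> (2 / \<tau>) * (\<bar>b - b'\<bar> + 2 * \<bar>a - a'\<bar>)"
proof -
  let ?v = "slope s a b" and ?w = "slope s a' b'"
  have "\<tau> / 2 * \<bar>?v - ?w\<bar> \<le> \<bar>pos s a ?v (s + \<tau>) - pos s a ?w (s + \<tau>)\<bar>" by (rule shoot_expanding_abs)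
  also have "\<dots> \<le> \<bar>b - b'\<bar> + 2 * \<bar>a - a'\<bar>"
    using pos_dependence_start[of s a ?w a'] by (simp add: pos_slope)
  finally have "(2 / \<tau>) * (\<tau> / 2 * \<bar>?v - ?w\<bar>) \<le> (2 / \<tau>) * (\<bar>b - b'\<bar> + 2 * \<bar>a - a'\<bar>)"
    using tau(1) by (intro mult_left_mono) auto
  then show ?thesis using tau(1) by simp
qed

lemma slope_lipschitz_square: "(slope s a b - slope s a' b')\<^sup>2 \<le> (32 / \<tau>\<^sup>2) * ((a - a')\<^sup>2 + (b - b')\<^sup>2)"
proof -
  have "(slope s a b - slope s a' b')\<^sup>2 \<le> ((2 / \<tau>) * (\<bar>b - b'\<bar> + 2 * \<bar>a - a'\<bar>))\<^sup>2"
    using slope_lipschitz[of s a b a' b'] tau(1) by (simp add: abs_le_square_iff[symmetric] abs_mult)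
  also have "\<dots> = (4 / \<tau>\<^sup>2) * (\<bar>b - b'\<bar> + 2 * \<bar>a - a'\<bar>)\<^sup>2" by (simp only: power_mult_distrib power_divide) simp
  also have "\<dots> \<le> (4 / \<tau>\<^sup>2) * (8 * ((a - a')\<^sup>2 + (b - b')\<^sup>2))"
  proof (rule mult_left_mono)
    show "(\<bar>b - b'\<bar> + 2 * \<bar>a - a'\<bar>)\<^sup>2 \<le> 8 * ((a - a')\<^sup>2 + (b - b')\<^sup>2)"
      using sum_squares_bound[of "\<bar>b - b'\<bar>" "2 * \<bar>a - a'\<bar>"] zero_le_power2[of "b - b'"]
      by (simp add: power2_sum power_mult_distrib) (smt (verit) zero_le_power2)
  qed simp
  finally show ?thesis by simp
qed

lemma end_velocity_lipschitz:
  "(end_velocity s a b - end_velocity s a' b')\<^sup>2 \<le> 4 * (1 + 32 / \<tau>\<^sup>2) * ((a - a')\<^sup>2 + (b - b')\<^sup>2)"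
proof -
  have "(end_velocity s a b - end_velocity s a' b')\<^sup>2 \<le> 4 * ((a - a')\<^sup>2 + (slope s a b - slope s a' b')\<^sup>2)"
    unfolding end_velocity_def
    by (rule sum_square_le_imp_le, subst add.commute, rule dependence) (use tau(1) in auto)
  also have "\<dots> \<le> 4 * (((a - a')\<^sup>2 + (b - b')\<^sup>2) + (32 / \<tau>\<^sup>2) * ((a - a')\<^sup>2 + (b - b')\<^sup>2))"
    by (intro mult_left_mono add_mono slope_lipschitz_square) auto
  finally show ?thesis by (simp only: distrib_right mult_1 mult.assoc)
qed

lemma continuous_on_pair_if_square_lipschitz:
  fixes g :: "real \<Rightarrow> real \<Rightarrow> real"
  assumes "\<And>a b a' b'. (g a b - g a' b')\<^sup>2 \<le> K * ((a - a')\<^sup>2 + (b - b')\<^sup>2)" "K \<ge> 0"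
  shows "continuous_on UNIV (\<lambda>p. g (fst p) (snd p))"
proof (rule lipschitz_on_continuous_on[of "sqrt K"], rule lipschitz_onI)
  fix p q :: "real \<times> real"
  have "(dist (g (fst p) (snd p)) (g (fst q) (snd q)))\<^sup>2 \<le> (sqrt K * dist p q)\<^sup>2"
    using assms(1)[of "fst p" "snd p" "fst q" "snd q"] assms(2)
    by (simp add: dist_prod_def dist_real_def power_mult_distrib)
  then show "dist (g (fst p) (snd p)) (g (fst q) (snd q)) \<le> sqrt K * dist p q"
    by (rule power2_le_imp_le) (use assms(2) in simp)
qed (use assms(2) in simp)

lemma continuous_on_slope: "continuous_on UNIV (\<lambda>p. slope s (fst p) (snd p))"
  by (rule continuous_on_pair_if_square_lipschitz[of "slope s", OF slope_lipschitz_square]) simp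

lemma continuous_on_end_velocity: "continuous_on UNIV (\<lambda>p. end_velocity s (fst p) (snd p))"
  by (rule continuous_on_pair_if_square_lipschitz[of "end_velocity s", OF end_velocity_lipschitz]) simp

lemma slope_shift: "slope s (a + of_int k) (b + of_int k) = slope s a b"
  by (rule slope_unique) (simp add: trajectory_shift pos_slope)

lemma end_velocity_shift: "end_velocity s (a + of_int k) (b + of_int k) = end_velocity s a b"
  by (simp add: end_velocity_def slope_shift trajectory_shift)

lemma link_action_shift: "link_action s (a + of_int k) (b + of_int k) = link_action s a b"
  by (simp add: link_action_def slope_shift trajectory_shift shift_int)

lemma slope_time_shift: "slope (s + real i * T0) a b = slope s a b"
proof (rule slope_unique)
  have eq: "s + real i * T0 + \<tau> = (s + \<tau>) + real i * T0" by simp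
  show "pos (s + real i * T0) a (slope s a b) (s + real i * T0 + \<tau>) = b"
    unfolding eq trajectory_time_shift by (rule pos_slope)
qed

lemma continuous_on_V_compose: "continuous_on U x \<Longrightarrow> continuous_on U (\<lambda>t. V t (x t))"
  using continuous_on_compose2[OF V_cont, of U "\<lambda>t. (t, x t)"] by (simp add: continuous_on_Pair continuous_on_id)

lemma continuous_on_lagrangian: "continuous_on U (\<lambda>t. (vel s a v t)\<^sup>2 / 2 - V t (pos s a v t))"
  by (intro continuous_intros continuous_on_V_compose ode2_solution_continuous[OF trajectory(1)]) auto

lemma link_action_time_shift: "link_action (s + real i * T0) a b = link_action s a b"
proof -
  let ?T = "real i * T0" and ?v = "slope s a b"
  let ?g = "\<lambda>t. (vel (s + ?T) a ?v t)\<^sup>2 / 2 - V t (pos (s + ?T) a ?v t)"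
  have "link_action s a b = integral {s..s + \<tau>} (\<lambda>t. ?g (t + ?T))"
    unfolding link_action_def trajectory_time_shift time_multiple ..
  also have "\<dots> = integral {s + ?T..s + \<tau> + ?T} ?g"
    using integral_shift_real_ivl[of "s + ?T" ?T "s + \<tau> + ?T" ?g] by simp
  finally show ?thesis unfolding link_action_def slope_time_shift by (simp add: algebra_simps)
qed

text \<open>With the mean velocity \<open>c = (b - a) / \<tau>\<close>, the kinetic energy lies
  above its tangent: \<open>v^2 / 2 \<ge> c * v - c^2 / 2\<close>. The right side integrates exactly
  to \<open>(b - a)^2 / (2 * \<tau>)\<close>.\<close>

lemma link_action_coercive: "1 / (2 * \<tau>) * (b - a)\<^sup>2 - B * \<tau> \<le> link_action s a b"
proof -
  let ?v = "slope s a b" and ?c = "(b - a) / \<tau>"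
  let ?K = "?c\<^sup>2 / 2 + B"
  have "((\<lambda>t. ?c * vel s a ?v t - ?K) has_integral
      (?c * pos s a ?v (s + \<tau>) - ?K * (s + \<tau>)) - (?c * pos s a ?v s - ?K * s)) {s..s + \<tau>}"
  proof (rule fundamental_theorem_of_calculus)
    fix t
    have "((\<lambda>t. ?c * pos s a ?v t - ?K * t) has_real_derivative ?c * vel s a ?v t - ?K) (at t)"
      using DERIV_diff[OF DERIV_cmult[OF ode2_solutionD(1)[OF trajectory(1)[of s a ?v]], of ?c] DERIV_cmult[OF DERIV_ident, of ?K]]
      by simp
    then show "((\<lambda>t. ?c * pos s a ?v t - ?K * t) has_vector_derivative ?c * vel s a ?v t - ?K) (at t within {s..s + \<tau>})"
      by (simp add: has_real_derivative_iff_has_vector_derivative has_vector_derivative_at_within)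
  qed (use tau(1) in simp)
  moreover have "((\<lambda>t. (vel s a ?v t)\<^sup>2 / 2 - V t (pos s a ?v t)) has_integral link_action s a b) {s..s + \<tau>}"
    unfolding link_action_def by (intro integrable_integral integrable_continuous_real continuous_on_lagrangian)
  ultimately have "(?c * pos s a ?v (s + \<tau>) - ?K * (s + \<tau>)) - (?c * pos s a ?v s - ?K * s) \<le> link_action s a b"
  proof (rule has_integral_le)
    fix t
    have "?c * vel s a ?v t \<le> (vel s a ?v t)\<^sup>2 / 2 + ?c\<^sup>2 / 2"
      using sum_squares_bound[of ?c "vel s a ?v t"] by linarith
    moreover have "V t (pos s a ?v t) \<le> B" using V_bound[of t "pos s a ?v t"] by linarith
    ultimately show "?c * vel s a ?v t - ?K \<le> (vel s a ?v t)\<^sup>2 / 2 - V t (pos s a ?v t)" by linarith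
  qed
  moreover have "(?c * pos s a ?v (s + \<tau>) - ?K * (s + \<tau>)) - (?c * pos s a ?v s - ?K * s) = 1 / (2 * \<tau>) * (b - a)\<^sup>2 - B * \<tau>"
    using tau(1) by (simp add: pos_slope trajectory) (simp add: field_simps power2_eq_square)
  ultimately show ?thesis by simp
qed

text \<open>The factors come from the integrand (\<open>1 + M\<close>), the dependence on initial
  data (4), the dependence of the slope on the end points (\<open>1 + 32 / \<tau>^2\<close>) and the
  length of the step.\<close>

definition link_constant :: real where "link_constant = 4 * (1 + M) * (1 + 32 / \<tau>\<^sup>2) * \<tau>"

lemma link_constant_pos: "link_constant > 0"
proof -
  have "1 + M > 0" "1 + 32 / \<tau>\<^sup>2 > 0" using M_nonneg by (simp_all add: add_pos_nonneg)
  then show ?thesis unfolding link_constant_def using tau(1) by simp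
qed

text \<open>First variation with remainder: integrating by parts, the Euler--Lagrange equation kills
  the interior term, leaving the boundary terms and a quadratic error.\<close>

lemma link_action_expansion:
  "\<bar>link_action s a' b' - link_action s a b - (end_velocity s a b * (b' - b) - slope s a b * (a' - a))\<bar>
    \<le> link_constant * ((a' - a)\<^sup>2 + (b' - b)\<^sup>2)"
proof -
  let ?v = "slope s a b" and ?w = "slope s a' b'"
  let ?x = "pos s a ?v" and ?x' = "vel s a ?v" and ?y = "pos s a' ?w" and ?y' = "vel s a' ?w"
  let ?Lx = "\<lambda>t. (?x' t)\<^sup>2 / 2 - V t (?x t)" and ?Ly = "\<lambda>t. (?y' t)\<^sup>2 / 2 - V t (?y t)"
  let ?P = "\<lambda>t. ?x' t * (?y t - ?x t)"
  let ?P' = "\<lambda>t. - Vx t (?x t) * (?y t - ?x t) + ?x' t * (?y' t - ?x' t)"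
  have P: "(?P' has_integral ?P (s + \<tau>) - ?P s) {s..s + \<tau>}"
  proof (rule fundamental_theorem_of_calculus)
    fix t
    have "(?P has_real_derivative ?P' t) (at t)"
      by (rule derivative_eq_intros ode2_solutionD[OF trajectory(1)] refl)+ simp
    then show "(?P has_vector_derivative ?P' t) (at t within {s..s + \<tau>})"
      by (simp add: has_real_derivative_iff_has_vector_derivative has_vector_derivative_at_within)
  qed (use tau(1) in simp)
  have Lx: "(?Lx has_integral link_action s a b) {s..s + \<tau>}" and Ly: "(?Ly has_integral link_action s a' b') {s..s + \<tau>}"
    unfolding link_action_def by (intro integrable_integral integrable_continuous_real continuous_on_lagrangian)+
  have E: "((\<lambda>t. ?Ly t - ?Lx t - ?P' t) has_integral
      link_action s a' b' - link_action s a b - (?P (s + \<tau>) - ?P s)) {s..s + \<tau>}"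
    by (intro has_integral_diff Lx Ly P)
  define K where "K = 4 * (1 + M) * (1 + 32 / \<tau>\<^sup>2) * ((a' - a)\<^sup>2 + (b' - b)\<^sup>2)"
  have "\<bar>link_action s a' b' - link_action s a b - (?P (s + \<tau>) - ?P s)\<bar> \<le> K * (s + \<tau> - s)"
  proof (rule has_integral_bound_real[OF _ finite.emptyI E, unfolded real_norm_def, THEN order_trans])
    show "0 \<le> K" unfolding K_def using M_nonneg by simp
    show "K * Henstock_Kurzweil_Integration.content {s..s + \<tau>} \<le> K * (s + \<tau> - s)" using tau(1) by simp
    fix t assume t: "t \<in> {s..s + \<tau>} - {}"
    let ?d = "?y t - ?x t" and ?d' = "?y' t - ?x' t"
    \<comment> \<open>All first order terms cancel against the derivative of the boundary term
      \<open>?P\<close>, leaving the exact kinetic square and the first order Taylor remainder of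
      the potential.\<close>
    have "?Ly t - ?Lx t - ?P' t = ?d'\<^sup>2 / 2 - (V t (?y t) - V t (?x t) - Vx t (?x t) * ?d)"
      by (simp add: power2_eq_square field_simps)
    then have "\<bar>?Ly t - ?Lx t - ?P' t\<bar> \<le> ?d'\<^sup>2 / 2 + M * ?d\<^sup>2"
      using V_remainder[of t "?y t" "?x t"] zero_le_power2[of ?d'] by linarith
    also have "\<dots> \<le> (1 + M) * (?d\<^sup>2 + ?d'\<^sup>2)"
      using M_nonneg zero_le_power2[of ?d] zero_le_power2[of ?d'] mult_nonneg_nonneg[OF M_nonneg zero_le_power2[of ?d']]
      by (simp add: distrib_left distrib_right)
    also have "\<dots> \<le> (1 + M) * (4 * ((a' - a)\<^sup>2 + (?w - ?v)\<^sup>2))"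
      using t M_nonneg by (intro mult_left_mono dependence) auto
    also have "\<dots> \<le> (1 + M) * (4 * ((1 + 32 / \<tau>\<^sup>2) * ((a' - a)\<^sup>2 + (b' - b)\<^sup>2)))"
    proof (intro mult_left_mono)
      show "(a' - a)\<^sup>2 + (?w - ?v)\<^sup>2 \<le> (1 + 32 / \<tau>\<^sup>2) * ((a' - a)\<^sup>2 + (b' - b)\<^sup>2)"
        unfolding distrib_right mult_1 by (intro add_mono slope_lipschitz_square) auto
    qed (use M_nonneg in auto)
    also have "\<dots> = K" by (simp only: K_def mult_ac)
    finally show "\<bar>?Ly t - ?Lx t - ?P' t\<bar> \<le> K" .
  qed
  moreover have "?P (s + \<tau>) - ?P s = end_velocity s a b * (b' - b) - slope s a b * (a' - a)"
    by (simp add: pos_slope trajectory end_velocity_def)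
  moreover have "K * (s + \<tau> - s) = link_constant * ((a' - a)\<^sup>2 + (b' - b)\<^sup>2)"
    by (simp add: K_def link_constant_def)
  ultimately show ?thesis by simp
qed

end

section \<open>Periodic chains and the mountain pass\<close>

text \<open>Tychonoff. Chains are total functions on the naturals, so a compact set of chains must
  confine every coordinate; those beyond the last node will be pinned to 0.\<close>

lemma compact_box_fun:
  fixes S :: "'i \<Rightarrow> 'b::topological_space set"
  assumes "\<And>j. compact (S j)"
  shows "compact {z. \<forall>j. z j \<in> S j}"
proof -
  have "compactin (product_topology (\<lambda>i. euclidean) UNIV) (PiE UNIV S)"
    using assms by (subst compactin_PiE) auto
  moreover have "PiE UNIV S = {z. \<forall>j. z j \<in> S j}" by (auto simp: PiE_def Pi_def)
  ultimately show ?thesis by (simp add: euclidean_product_topology)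
qed

text \<open>The functions \<open>\<beta> j\<close> and \<open>- \<alpha> j\<close> act as the
  partial derivatives of \<open>h j\<close>. The assumption \<open>expansion\<close> is the only
  link between them and \<open>h\<close>, and no second derivatives appear.\<close>

locale periodic_chain =
  fixes h \<alpha> \<beta> :: "nat \<Rightarrow> real \<Rightarrow> real \<Rightarrow> real" and C c0 B0 :: real and N :: nat and \<kappa> :: int
  assumes N: "N \<ge> 1" and C: "C > 0" and c0: "c0 > 0"
    and expansion: "\<And>j a b a' b'. \<bar>h j a' b' - h j a b - (\<beta> j a b * (b' - b) - \<alpha> j a b * (a' - a))\<bar>
        \<le> C * ((a' - a)\<^sup>2 + (b' - b)\<^sup>2)"
    and coercive: "\<And>j a b. c0 * (b - a)\<^sup>2 - B0 \<le> h j a b"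
    and shift_h: "\<And>j a b (k::int). h j (a + of_int k) (b + of_int k) = h j a b"
    and shift_\<alpha>: "\<And>j a b (k::int). \<alpha> j (a + of_int k) (b + of_int k) = \<alpha> j a b"
    and shift_\<beta>: "\<And>j a b (k::int). \<beta> j (a + of_int k) (b + of_int k) = \<beta> j a b"
    and \<alpha>_cont: "\<And>j. continuous_on UNIV (\<lambda>p. \<alpha> j (fst p) (snd p))"
    and \<beta>_cont: "\<And>j. continuous_on UNIV (\<lambda>p. \<beta> j (fst p) (snd p))"
begin

definition wrap :: "(nat \<Rightarrow> real) \<Rightarrow> nat \<Rightarrow> real" where
  "wrap z j = (if j < N then z j else z 0 + of_int \<kappa>)"

definition action :: "(nat \<Rightarrow> real) \<Rightarrow> real" where
  "action z = (\<Sum>j<N. h j (wrap z j) (wrap z (Suc j)))"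

definition prv :: "nat \<Rightarrow> nat" where "prv i = (if i = 0 then N - 1 else i - 1)"

text \<open>For trajectories this is the velocity arriving at node \<open>i\<close> minus the
  velocity leaving it. At node 0 the incoming link is the last one, which ends at
  \<open>z 0 + \<kappa>\<close>.\<close>

definition grad :: "(nat \<Rightarrow> real) \<Rightarrow> nat \<Rightarrow> real" where
  "grad z i = \<beta> (prv i) (wrap z (prv i)) (wrap z (Suc (prv i))) - \<alpha> i (wrap z i) (wrap z (Suc i))"

definition critical :: "(nat \<Rightarrow> real) \<Rightarrow> bool" where
  "critical z \<longleftrightarrow> (\<forall>i<N. grad z i = 0)"

lemma sum_shift: "(\<Sum>j<N. g j (if Suc j < N then d (Suc j) else d 0)) = (\<Sum>i<N. g (prv i) (d i))"
proof -
  have last: "N - Suc 0 = a" if "a < N" "\<not> Suc a < N" for a using that by arith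
  show ?thesis
    by (rule sum.reindex_bij_witness[of _ prv "\<lambda>j. if Suc j < N then Suc j else 0"])
       (use N in \<open>auto simp: prv_def intro: arg_cong2[where f = g, OF last] split: if_splits\<close>)
qed

text \<open>Every node increment occurs in two links, as left and as right end, hence the factor 2
  in front of \<open>C\<close>. Reindexing cyclically collects both linear contributions in
  \<open>grad\<close>.\<close>

lemma action_expansion:
  "\<bar>action z' - action z - (\<Sum>i<N. grad z i * (z' i - z i))\<bar> \<le> 2 * C * (\<Sum>i<N. (z' i - z i)\<^sup>2)"
proof -
  define d where "d = (\<lambda>i. z' i - z i)"
  let ?n = "\<lambda>j. if Suc j < N then d (Suc j) else d 0"
  let ?\<beta> = "\<lambda>j. \<beta> j (wrap z j) (wrap z (Suc j))" and ?\<alpha> = "\<lambda>j. \<alpha> j (wrap z j) (wrap z (Suc j))"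
  have w: "wrap z' j - wrap z j = d j" "wrap z' (Suc j) - wrap z (Suc j) = ?n j" if "j < N" for j
    using that by (auto simp: wrap_def d_def)
  have "(\<Sum>i<N. grad z i * d i) = (\<Sum>j<N. ?\<beta> j * ?n j) - (\<Sum>j<N. ?\<alpha> j * d j)"
    using sum_shift[of "\<lambda>j x. ?\<beta> j * x" d] by (simp add: grad_def left_diff_distrib sum_subtractf)
  then have eq: "action z' - action z - (\<Sum>i<N. grad z i * d i) =
      (\<Sum>j<N. h j (wrap z' j) (wrap z' (Suc j)) - h j (wrap z j) (wrap z (Suc j)) - (?\<beta> j * ?n j - ?\<alpha> j * d j))"
    by (simp add: action_def sum_subtractf)
  have "\<bar>action z' - action z - (\<Sum>i<N. grad z i * d i)\<bar> \<le> (\<Sum>j<N. C * ((d j)\<^sup>2 + (?n j)\<^sup>2))"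
    unfolding eq
  proof (rule order_trans[OF sum_abs sum_mono])
    fix j assume "j \<in> {..<N}"
    then have j: "j < N" by simp
    show "\<bar>h j (wrap z' j) (wrap z' (Suc j)) - h j (wrap z j) (wrap z (Suc j)) - (?\<beta> j * ?n j - ?\<alpha> j * d j)\<bar>
        \<le> C * ((d j)\<^sup>2 + (?n j)\<^sup>2)"
      using expansion[of j "wrap z' j" "wrap z' (Suc j)" "wrap z j" "wrap z (Suc j)"] unfolding w[OF j] .
  qed
  also have "\<dots> = C * ((\<Sum>j<N. (d j)\<^sup>2) + (\<Sum>j<N. (?n j)\<^sup>2))"
    by (subst sum_distrib_left[symmetric]) (simp only: sum.distrib)
  also have "(\<Sum>j<N. (?n j)\<^sup>2) = (\<Sum>j<N. (d j)\<^sup>2)"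
    using sum_shift[of "\<lambda>j x. x\<^sup>2" d] by simp
  finally show ?thesis by (simp add: d_def)
qed

lemma wrap_shift:
  assumes "\<And>i. i < N \<Longrightarrow> z' i = z i + of_int k"
  shows "wrap z' j = wrap z j + of_int k"
  using assms N by (auto simp: wrap_def)

lemma shift:
  assumes "\<And>i. i < N \<Longrightarrow> z' i = z i + of_int k"
  shows "action z' = action z" "grad z' i = grad z i" "critical z' = critical z"
proof -
  have w: "wrap z' j = wrap z j + of_int k" for j using wrap_shift[of z' z k j] assms by blast
  show "action z' = action z" "grad z' i = grad z i" for i
    unfolding action_def grad_def w shift_h shift_\<alpha> shift_\<beta> by simp_all
  then show "critical z' = critical z" unfolding critical_def by simp
qed

lemma cong:
  assumes "\<And>i. i < N \<Longrightarrow> z' i = z i"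
  shows "action z' = action z" "grad z' i = grad z i" "critical z' = critical z"
  using shift[of z' z 0] assms by auto

lemma h_cont: "continuous_on UNIV (\<lambda>p. h j (fst p) (snd p))"
proof -
  have "isCont (\<lambda>p. h j (fst p) (snd p)) p" for p
  proof -
    let ?g = "\<lambda>q. h j (fst p) (snd p) + (\<beta> j (fst p) (snd p) * (snd q - snd p) - \<alpha> j (fst p) (snd p) * (fst q - fst p))"
    let ?e = "\<lambda>q. C * ((fst q - fst p)\<^sup>2 + (snd q - snd p)\<^sup>2)"
    have e: "(?e \<longlongrightarrow> C * ((fst p - fst p)\<^sup>2 + (snd p - snd p)\<^sup>2)) (at p)" by (intro tendsto_intros)
    have g: "(?g \<longlongrightarrow> ?g p) (at p)" by (intro tendsto_intros)
    have "((\<lambda>q. h j (fst q) (snd q) - ?g q) \<longlongrightarrow> 0) (at p)"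
      by (rule Lim_null_comparison[of _ ?e])
         (use e expansion[of j _ _ "fst p" "snd p"] in \<open>auto intro!: always_eventually simp: algebra_simps\<close>)
    from tendsto_add[OF this g] show ?thesis by (simp add: isCont_def)
  qed
  then show ?thesis by (simp add: continuous_on_eq_continuous_at)
qed

lemma continuous_on_coordinate: "continuous_on U (\<lambda>z::nat \<Rightarrow> real. z i)"
  by (rule continuous_on_subset[OF continuous_on_product_coordinates]) simp

lemma continuous_on_wrap: "continuous_on U (\<lambda>z. wrap z i)"
  unfolding wrap_def by (cases "i < N") (auto intro!: continuous_intros continuous_on_coordinate)

lemma continuous_on_action: "continuous_on U action"
proof -
  have "continuous_on U (\<lambda>z. (\<lambda>p. h j (fst p) (snd p)) (wrap z j, wrap z (Suc j)))" for j
    by (rule continuous_on_compose2[OF h_cont]) (auto intro!: continuous_intros continuous_on_wrap)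
  then have "continuous_on U (\<lambda>z. h j (wrap z j) (wrap z (Suc j)))" for j by simp
  then show ?thesis unfolding action_def[abs_def] by (intro continuous_on_sum)
qed

lemma continuous_on_grad: "continuous_on U (\<lambda>z. grad z i)"
proof -
  have "continuous_on U (\<lambda>z. (\<lambda>p. \<alpha> j (fst p) (snd p)) (wrap z j, wrap z (Suc j)))"
    "continuous_on U (\<lambda>z. (\<lambda>p. \<beta> j (fst p) (snd p)) (wrap z j, wrap z (Suc j)))" for j
    by (rule continuous_on_compose2[OF \<alpha>_cont] continuous_on_compose2[OF \<beta>_cont];
        auto intro!: continuous_intros continuous_on_wrap)+
  then show ?thesis unfolding grad_def by (intro continuous_on_diff) auto
qed

section \<open>Compactness modulo integer translations, minimum and descent\<close>

definition cube :: "real \<Rightarrow> (nat \<Rightarrow> real) set" where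
  "cube D = {z. \<forall>j. z j \<in> (if j < N then {- D..D} else {0})}"

lemma compact_cube: "compact (cube D)"
  unfolding cube_def by (rule compact_box_fun) auto

text \<open>All links are bounded below, so a bound on the total action bounds each single link and,
  by coercivity, each step. At most \<open>N\<close> steps bound the distance to \<open>z 0\<close>,
  and an integer translation moves \<open>z 0\<close> into \<open>[0, 1]\<close>.\<close>

lemma sublevel_in_cube:
  obtains D where "D \<ge> 0"
    "\<And>z. action z \<le> w \<Longrightarrow> (\<lambda>j. if j < N then z j - of_int \<lfloor>z 0\<rfloor> else 0) \<in> cube D"
proof -
  \<comment> \<open>The summand 1 avoids a square root: a step with square at most
    \<open>e - 1\<close> is itself at most \<open>e\<close>, because
    \<open>2 * d \<le> d^2 + 1\<close>.\<close>
  define e where "e = (\<bar>w\<bar> + N * \<bar>B0\<bar>) / c0 + 1"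
  have e: "e \<ge> 0" using c0 by (simp add: e_def)
  show ?thesis
  proof (rule that[of "N * e + 1"])
    show "N * e + 1 \<ge> 0" using e by simp
    fix z assume w: "action z \<le> w"
    have nonneg: "0 \<le> h i a b + B0" for i a b
      using coercive[of b a i] mult_nonneg_nonneg[OF less_imp_le[OF c0] zero_le_power2, of "b - a"] by linarith
    have step: "\<bar>wrap z (Suc j) - wrap z j\<bar> \<le> e" if j: "j < N" for j
    proof -
      let ?d = "wrap z (Suc j) - wrap z j"
      have "c0 * ?d\<^sup>2 - B0 \<le> h j (wrap z j) (wrap z (Suc j))" by (rule coercive)
      moreover have "h j (wrap z j) (wrap z (Suc j)) + B0 \<le> (\<Sum>j<N. h j (wrap z j) (wrap z (Suc j)) + B0)"
        using j nonneg by (intro member_le_sum) auto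
      moreover have "(\<Sum>j<N. h j (wrap z j) (wrap z (Suc j)) + B0) = action z + N * B0"
        by (simp add: action_def sum.distrib)
      moreover have "N * B0 \<le> N * \<bar>B0\<bar>" by (intro mult_left_mono) auto
      ultimately have "c0 * ?d\<^sup>2 \<le> \<bar>w\<bar> + N * \<bar>B0\<bar>" using w by linarith
      then have "?d\<^sup>2 \<le> e - 1" using c0 by (simp add: e_def field_simps)
      then show ?thesis using sum_squares_bound[of "\<bar>?d\<bar>" 1] e by simp
    qed
    have far: "\<bar>wrap z j - z 0\<bar> \<le> j * e" if "j \<le> N" for j
      using that
    proof (induction j)
      case 0 then show ?case using N by (simp add: wrap_def)
    next
      case (Suc j)
      then show ?case using step[of j] by (simp add: algebra_simps)
    qed
    have fl: "0 \<le> z 0 - of_int \<lfloor>z 0\<rfloor>" "z 0 - of_int \<lfloor>z 0\<rfloor> \<le> 1" by linarith+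
    have "\<bar>z j - of_int \<lfloor>z 0\<rfloor>\<bar> \<le> N * e + 1" if "j < N" for j
    proof -
      have "\<bar>z j - z 0\<bar> \<le> j * e" using far[of j] that by (simp add: wrap_def)
      also have "\<dots> \<le> N * e" using that e by (intro mult_right_mono) auto
      finally show ?thesis using fl by linarith
    qed
    then show "(\<lambda>j. if j < N then z j - of_int \<lfloor>z 0\<rfloor> else 0) \<in> cube (N * e + 1)"
      by (auto simp: cube_def abs_le_iff) (smt (verit))
  qed
qed

lemma normalize:
  fixes z
  defines "z' \<equiv> (\<lambda>j. if j < N then z j - of_int \<lfloor>z 0\<rfloor> else 0)"
  shows "action z' = action z" "grad z' i = grad z i" "critical z' = critical z"
proof -
  have "z' i = z i + of_int (- \<lfloor>z 0\<rfloor>)" if "i < N" for i using that by (simp add: z'_def)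
  from shift[OF this] show "action z' = action z" "grad z' i = grad z i" "critical z' = critical z" by auto
qed

lemma minimum_exists: obtains q where "\<And>z. action q \<le> action z"
proof -
  obtain D where D: "D \<ge> 0" "\<And>z. action z \<le> action (\<lambda>_. 0) \<Longrightarrow> (\<lambda>j. if j < N then z j - of_int \<lfloor>z 0\<rfloor> else 0) \<in> cube D"
    using sublevel_in_cube by blast
  have 0: "(\<lambda>_. 0) \<in> cube D" using D(1) by (simp add: cube_def)
  then obtain q where q: "q \<in> cube D" "\<And>z. z \<in> cube D \<Longrightarrow> action q \<le> action z"
    using continuous_attains_inf[OF compact_cube _ continuous_on_action, of D] by blast
  show ?thesis
  proof (rule that[of q])
    fix z show "action q \<le> action z"
    proof (cases "action z \<le> action (\<lambda>_. 0)")
      case True then show ?thesis using q(2)[OF D(2)[OF True]] normalize(1)[of z] by simp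
    next
      case False then show ?thesis using q(2)[OF 0] by simp
    qed
  qed
qed

text \<open>The step length \<open>1 / (4 * C)\<close> minimizes the upper bound
  \<open>- s * g^2 + 2 * C * s^2 * g^2\<close> for the change of the action, and yields the gain
  \<open>g^2 / (8 * C)\<close>.\<close>

definition descend :: "(nat \<Rightarrow> real) \<Rightarrow> nat \<Rightarrow> real" where
  "descend z i = (if i < N then z i - grad z i / (4 * C) else z i)"

lemma action_descend: "action (descend z) \<le> action z - (\<Sum>i<N. (grad z i)\<^sup>2) / (8 * C)"
proof -
  let ?S = "\<Sum>i<N. (grad z i)\<^sup>2"
  have 1: "(\<Sum>i<N. grad z i * (descend z i - z i)) = - ?S / (4 * C)"
    by (simp add: descend_def power2_eq_square sum_negf sum_divide_distrib)
  have 2: "(\<Sum>i<N. (descend z i - z i)\<^sup>2) = ?S / (16 * C\<^sup>2)"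
    by (simp add: descend_def power_divide sum_divide_distrib power2_eq_square)
  have "action (descend z) - action z + ?S / (4 * C) \<le> 2 * C * (?S / (16 * C\<^sup>2))"
    using action_expansion[of "descend z" z] unfolding 1 2 by (simp add: abs_le_iff)
  also have "\<dots> = ?S / (8 * C)" using C by (simp add: power2_eq_square)
  finally have "action (descend z) - action z + ?S / (4 * C) \<le> ?S / (8 * C)" .
  moreover have "?S / (4 * C) = ?S / (8 * C) + ?S / (8 * C)" using C by (simp add: field_simps)
  ultimately show ?thesis by linarith
qed

lemma minimum_critical:
  assumes "\<And>z. action q \<le> action z"
  shows "critical q"
proof -
  have "(\<Sum>i<N. (grad q i)\<^sup>2) / (8 * C) \<le> 0" using action_descend[of q] assms[of "descend q"] by linarith
  then have "(\<Sum>i<N. (grad q i)\<^sup>2) \<le> 0" using C by (simp add: divide_le_0_iff)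
  then have "(\<Sum>i<N. (grad q i)\<^sup>2) = 0" by (simp add: order_antisym sum_nonneg)
  then show ?thesis by (simp add: critical_def sum_nonneg_eq_0_iff)
qed

lemma continuous_on_descend: "continuous_on U descend"
proof (rule continuous_on_coordinatewise_then_product)
  fix i show "continuous_on U (\<lambda>z. descend z i)"
    unfolding descend_def using C
    by (cases "i < N") (auto intro!: continuous_intros continuous_on_grad continuous_on_coordinate)
qed

text \<open>Mountain pass between the minimum \<open>q\<close> and its translate \<open>q + 1\<close>. One step of gradient
  descent is a deformation fixing both ends, so no gradient flow is needed.\<close>

lemma mountain_pass:
  fixes \<gamma> :: "real \<Rightarrow> nat \<Rightarrow> real"
  assumes q: "\<And>z. action q \<le> action z"
    and iso: "\<epsilon> > 0" "\<And>z. critical z \<Longrightarrow> (\<And>i. i < N \<Longrightarrow> \<bar>z i - q i\<bar> \<le> \<epsilon>) \<Longrightarrow> (\<forall>i<N. z i = q i)"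
    and path: "continuous_on {0..1} \<gamma>" "\<And>i. i < N \<Longrightarrow> \<gamma> 0 i = q i" "\<And>i. i < N \<Longrightarrow> \<gamma> 1 i = q i + 1"
      "\<And>t. t \<in> {0..1} \<Longrightarrow> action (\<gamma> t) \<le> U"
  obtains y where "critical y" "action q < action y" "action y \<le> U"
proof -
  define P where "P = {g :: real \<Rightarrow> nat \<Rightarrow> real. continuous_on {0..1} g \<and> (\<forall>i<N. g 0 i = q i) \<and> (\<forall>i<N. g 1 i = q i + 1)}"
  define A where "A = {l. \<exists>g\<in>P. \<forall>t\<in>{0..1}. action (g t) \<le> l}"
  define c where "c = Inf A"
  \<comment> \<open>The radius lies inside the isolating neighbourhood and below 1, so every path
    from \<open>q\<close> to \<open>q + 1\<close>, whose end has distance \<open>N \<ge> 1\<close>,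
    crosses the sphere.\<close>
  define r where "r = min \<epsilon> (1/2)"
  have r: "r > 0" "r \<le> \<epsilon>" "r < 1" using iso(1) by (auto simp: r_def)
  define nrm where "nrm = (\<lambda>z. \<Sum>i<N. \<bar>z i - q i\<bar>)"
  have nrm_cont: "continuous_on U' nrm" for U'
    unfolding nrm_def by (intro continuous_intros continuous_on_coordinate)
  define D where "D = (\<Sum>i<N. \<bar>q i\<bar>) + r"
  define sphere where "sphere = {z \<in> cube D. nrm z = r}"
  have coord: "\<bar>z i - q i\<bar> \<le> nrm z" if "i < N" for z i
    unfolding nrm_def using that by (intro member_le_sum[of i "{..<N}" "\<lambda>i. \<bar>z i - q i\<bar>"]) auto
  have sphere_mem: "(\<lambda>i. if i < N then z i else 0) \<in> sphere" if "nrm z = r" for z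
  proof -
    have "\<bar>z i\<bar> \<le> D" if "i < N" for i
    proof -
      have "\<bar>q i\<bar> \<le> (\<Sum>i<N. \<bar>q i\<bar>)" using that by (intro member_le_sum[of i "{..<N}" "\<lambda>i. \<bar>q i\<bar>"]) auto
      then show ?thesis using coord[OF that, of z] \<open>nrm z = r\<close> by (simp add: D_def)
    qed
    then show ?thesis using that by (auto simp: sphere_def cube_def nrm_def abs_le_iff) (smt (verit))
  qed
  have "compact sphere"
  proof -
    have "closed {z. nrm z = r}" by (intro closed_Collect_eq nrm_cont continuous_intros)
    then have "compact (cube D \<inter> {z. nrm z = r})" by (intro compact_Int_closed compact_cube)
    then show ?thesis by (simp add: sphere_def Int_def)
  qed
  moreover have "sphere \<noteq> {}"
  proof -
    have "nrm (\<lambda>i. if i = 0 then q i + r else q i) = r"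
      unfolding nrm_def using N r by (simp add: if_distrib[of "\<lambda>x. \<bar>x - _\<bar>"] sum.delta cong: if_cong)
    then show ?thesis using sphere_mem by blast
  qed
  ultimately obtain s where s: "s \<in> sphere" "\<And>z. z \<in> sphere \<Longrightarrow> action s \<le> action z"
    using continuous_attains_inf[OF _ _ continuous_on_action, of sphere] by blast
  \<comment> \<open>Otherwise \<open>s\<close> would be another minimum, hence a critical chain
    within the isolating neighbourhood and different from \<open>q\<close>.\<close>
  have s_gt: "action q < action s"
  proof (rule ccontr)
    assume "\<not> ?thesis"
    then have "critical s" using q by (intro minimum_critical) (metis dual_order.trans not_less)
    moreover have "\<bar>s i - q i\<bar> \<le> \<epsilon>" if "i < N" for i
      using coord[OF that, of s] s(1) r by (simp add: sphere_def)
    ultimately have "\<forall>i<N. s i = q i" by (rule iso(2))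
    then have "nrm s = 0" by (simp add: nrm_def)
    then show False using s(1) r by (simp add: sphere_def)
  qed
  have level_ge: "action s \<le> l" if "l \<in> A" for l
  proof -
    obtain g where g: "g \<in> P" "\<And>t. t \<in> {0..1} \<Longrightarrow> action (g t) \<le> l" using \<open>l \<in> A\<close> unfolding A_def by blast
    have "continuous_on {0..1} (\<lambda>t. nrm (g t))"
      by (rule continuous_on_compose2[OF nrm_cont]) (use g(1) in \<open>auto simp: P_def\<close>)
    moreover have "nrm (g 0) = 0" "nrm (g 1) = N" using g(1) by (auto simp: P_def nrm_def)
    ultimately obtain t where t: "0 \<le> t" "t \<le> 1" "nrm (g t) = r"
      using IVT'[of "\<lambda>t. nrm (g t)" 0 r 1] r N by auto
    have "action s \<le> action (\<lambda>i. if i < N then g t i else 0)" by (rule s(2)[OF sphere_mem[OF t(3)]])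
    also have "\<dots> = action (g t)" by (rule cong) auto
    also have "\<dots> \<le> l" using g(2)[of t] t by auto
    finally show ?thesis .
  qed
  have "\<gamma> \<in> P" using path(1-3) by (simp add: P_def)
  then have "U \<in> A" using path(4) unfolding A_def by blast
  have bdd: "bdd_below A" by (rule bdd_belowI[of A "action s"]) (rule level_ge)
  have c_le: "c \<le> l" if "l \<in> A" for l unfolding c_def by (rule cInf_lower[OF that bdd])
  have c_ge: "action s \<le> c" unfolding c_def using \<open>U \<in> A\<close> level_ge by (intro cInf_greatest) auto
  have "\<exists>y. critical y \<and> action y = c"
  proof (rule ccontr)
    assume no: "\<not> ?thesis"
    obtain D' where D': "D' \<ge> 0" "\<And>z. action z \<le> c + 1 \<Longrightarrow> (\<lambda>j. if j < N then z j - of_int \<lfloor>z 0\<rfloor> else 0) \<in> cube D'"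
      using sublevel_in_cube by blast
    \<comment> \<open>This function vanishes exactly at critical chains of level \<open>c\<close>.
      If there are none, its minimum on a compact cube is positive: a quantitative Palais-Smale
      condition.\<close>
    define \<phi> where "\<phi> = (\<lambda>z. (\<Sum>i<N. (grad z i)\<^sup>2) + \<bar>action z - c\<bar>)"
    have \<phi>_cont: "continuous_on (cube D') \<phi>"
      unfolding \<phi>_def by (intro continuous_intros continuous_on_grad continuous_on_action)
    have "cube D' \<noteq> {}" using D'(1) by (auto simp: cube_def intro!: exI[of _ "\<lambda>_. 0"])
    then obtain m where m: "m \<in> cube D'" "\<And>z. z \<in> cube D' \<Longrightarrow> \<phi> m \<le> \<phi> z"
      using continuous_attains_inf[OF compact_cube _ \<phi>_cont] by blast
    have "\<phi> m \<noteq> 0"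
    proof
      assume "\<phi> m = 0"
      moreover have "0 \<le> (\<Sum>i<N. (grad m i)\<^sup>2)" by (simp add: sum_nonneg)
      ultimately have "(\<Sum>i<N. (grad m i)\<^sup>2) = 0" "action m = c" unfolding \<phi>_def by linarith+
      then show False using no by (auto simp: critical_def sum_nonneg_eq_0_iff)
    qed
    moreover have "\<phi> m \<ge> 0" unfolding \<phi>_def by (simp add: sum_nonneg)
    ultimately have mu: "\<phi> m > 0" by simp
    \<comment> \<open>A chain whose action lies in \<open>[c, c + e)\<close> and which loses less
      than \<open>e\<close> in one descent step has \<open>\<phi>\<close> below
      \<open>(8 * C + 1) * e\<close>. The cap 1 keeps it in the sublevel set for which the cube was
      chosen.\<close>
    define e where "e = min 1 (\<phi> m / (8 * C + 1))"
    have K: "8 * C + 1 > 0" using C by simp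
    have e: "e > 0" "e \<le> 1" using mu K by (auto simp: e_def)
    have "(8 * C + 1) * e \<le> (8 * C + 1) * (\<phi> m / (8 * C + 1))"
      unfolding e_def using K by (intro mult_left_mono) auto
    then have e_le: "(8 * C + 1) * e \<le> \<phi> m" using K by simp
    obtain l where l: "l \<in> A" "l < c + e"
      using cInf_lessD[of A "c + e"] \<open>U \<in> A\<close> e(1) unfolding c_def by auto
    then obtain g where g: "g \<in> P" "\<And>t. t \<in> {0..1} \<Longrightarrow> action (g t) \<le> l" unfolding A_def by blast
    have ends: "grad z i = 0" if "\<And>i. i < N \<Longrightarrow> z i = q i + of_int k" "i < N" for z i and k :: int
      using shift(2)[of z q k, OF that(1)] minimum_critical[OF q] that(2) by (simp add: critical_def)
    have dg: "(\<lambda>t. descend (g t)) \<in> P"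
    proof -
      have "continuous_on {0..1} (\<lambda>t. descend (g t))"
        by (rule continuous_on_compose2[OF continuous_on_descend]) (use g(1) in \<open>auto simp: P_def\<close>)
      moreover have "descend (g 0) i = q i" "descend (g 1) i = q i + 1" if "i < N" for i
        using ends[of "g 0" 0 i] ends[of "g 1" 1 i] g(1) that by (auto simp: P_def descend_def)
      ultimately show ?thesis by (auto simp: P_def)
    qed
    then have "continuous_on {0..1} (\<lambda>t. action (descend (g t)))"
      by (intro continuous_on_compose2[OF continuous_on_action]) (auto simp: P_def)
    then obtain t where t: "t \<in> {0..1}" "\<And>t'. t' \<in> {0..1} \<Longrightarrow> action (descend (g t')) \<le> action (descend (g t))"
      using continuous_attains_sup[of "{0..1::real}" "\<lambda>t. action (descend (g t))"] by auto
    have "action (descend (g t)) \<in> A"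
      unfolding A_def by (rule CollectI, rule bexI[OF _ dg]) (use t(2) in simp)
    then have ge: "c \<le> action (descend (g t))" by (rule c_le)
    have S: "(\<Sum>i<N. (grad (g t) i)\<^sup>2) \<ge> 0" by (simp add: sum_nonneg)
    have "(\<Sum>i<N. (grad (g t) i)\<^sup>2) / (8 * C) < e" "c \<le> action (g t)" "action (g t) < c + e"
      using action_descend[of "g t"] ge g(2)[OF t(1)] l(2) S C divide_nonneg_pos[OF S, of "8 * C"] by linarith+
    then have "(\<Sum>i<N. (grad (g t) i)\<^sup>2) + \<bar>action (g t) - c\<bar> < (8 * C + 1) * e"
      using C by (simp add: field_simps)
    then have "\<phi> (\<lambda>j. if j < N then g t j - of_int \<lfloor>g t 0\<rfloor> else 0) < \<phi> m"
      using e_le by (simp add: \<phi>_def normalize)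
    moreover have "(\<lambda>j. if j < N then g t j - of_int \<lfloor>g t 0\<rfloor> else 0) \<in> cube D'"
      using \<open>action (g t) < c + e\<close> e(2) by (intro D'(2)) linarith
    ultimately show False using m(2) by (meson not_le)
  qed
  then obtain y where "critical y" "action y = c" by blast
  then show ?thesis using that[of y] s_gt c_ge c_le[OF \<open>U \<in> A\<close>] by auto
qed

text \<open>The path from \<open>q\<close> to \<open>q + 1\<close> raises one coordinate after the other, so at any time all
  but three links are translates of links of \<open>q\<close>.\<close>

lemma mountain_pass_uniform:
  assumes q: "\<And>z. action q \<le> action z"
    and iso: "\<epsilon> > 0" "\<And>z. critical z \<Longrightarrow> (\<And>i. i < N \<Longrightarrow> \<bar>z i - q i\<bar> \<le> \<epsilon>) \<Longrightarrow> (\<forall>i<N. z i = q i)"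
    and K: "\<And>j s s'. j < N \<Longrightarrow> \<bar>s\<bar> \<le> 1 \<Longrightarrow> \<bar>s'\<bar> \<le> 1 \<Longrightarrow>
      h j (wrap q j + s) (wrap q (Suc j) + s') \<le> h j (wrap q j) (wrap q (Suc j)) + K"
  obtains y where "critical y" "action q < action y" "action y \<le> action q + 3 * K"
proof (rule mountain_pass[OF q iso])
  \<comment> \<open>Coordinate \<open>j\<close> rises from 0 to 1 for \<open>t\<close> between
    \<open>j / N\<close> and \<open>(j + 1) / N\<close> and rests otherwise.\<close>
  define e where "e = (\<lambda>t j. max 0 (min 1 (real N * t - real j)))"
  define \<gamma> where "\<gamma> = (\<lambda>t j. q j + e t j)"
  have K0: "K \<ge> 0" using K[of 0 0 0] N by simp
  show "continuous_on {0..1} \<gamma>"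
    unfolding \<gamma>_def e_def by (intro continuous_on_coordinatewise_then_product continuous_intros)
  show "\<gamma> 0 i = q i" for i by (simp add: \<gamma>_def e_def)
  show "\<gamma> 1 i = q i + 1" if "i < N" for i
  proof -
    have "real i + 1 \<le> real N" using that by linarith
    then show ?thesis by (simp add: \<gamma>_def e_def)
  qed
  fix t :: real assume t: "t \<in> {0..1}"
  let ?z = "\<gamma> t"
  \<comment> \<open>The closing node moves with node 0, which is raised before all others. Hence the
    closing link \<open>N - 1\<close> stays distorted along the way and is exempted below, together
    with the two links at the moving node \<open>i\<close>.\<close>
  define s where "s = (\<lambda>j. if j < N then e t j else e t 0)"
  have wz: "wrap ?z j = wrap q j + s j" for j
    using N by (simp add: wrap_def \<gamma>_def s_def)
  have s01: "\<bar>s j\<bar> \<le> 1" for j by (simp add: s_def e_def)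
  let ?f = "\<lambda>j. h j (wrap q j + s j) (wrap q (Suc j) + s (Suc j)) - h j (wrap q j) (wrap q (Suc j))"
  define i where "i = nat \<lfloor>real N * t\<rfloor>"
  have i: "real i \<le> real N * t" "real N * t < real i + 1" using t by (auto simp: i_def)
  have zero: "?f j = 0" if j: "j < N" "j \<notin> {i - 1, i, N - 1}" for j
  proof -
    have jN: "Suc j < N" using j by auto
    have "Suc j < i \<or> i < j" using j by auto
    then have "(s j = 1 \<and> s (Suc j) = 1) \<or> (s j = 0 \<and> s (Suc j) = 0)"
    proof
      assume "Suc j < i"
      then have "real j + 2 \<le> real i" by linarith
      then show ?thesis using jN i by (simp add: s_def e_def)
    next
      assume "i < j"
      then have "real i + 1 \<le> real j" by linarith
      then show ?thesis using jN i by (simp add: s_def e_def)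
    qed
    then show ?thesis using shift_h[of j _ 1] by auto
  qed
  have "action ?z - action q = (\<Sum>j<N. ?f j)"
    by (simp add: action_def wz sum_subtractf)
  also have "\<dots> = (\<Sum>j\<in>{..<N} \<inter> {i - 1, i, N - 1}. ?f j)"
    by (rule sum.mono_neutral_right) (use zero in auto)
  also have "\<dots> \<le> (\<Sum>j\<in>{..<N} \<inter> {i - 1, i, N - 1}. K)"
    using K[OF _ s01 s01] by (intro sum_mono) (simp add: diff_le_eq add.commute)
  also have "\<dots> \<le> 3 * K"
  proof -
    have "card ({..<N} \<inter> {i - 1, i, N - 1}) \<le> card {i - 1, i, N - 1}" by (intro card_mono) auto
    also have "\<dots> \<le> 3" by (simp add: card_insert_if)
    finally show ?thesis using K0 by (simp add: mult_right_mono)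
  qed
  finally show "action (\<gamma> t) \<le> action q + 3 * K" by simp
qed (use that in auto)

end

section \<open>Solutions on the cylinder\<close>

text \<open>Near \<open>w\<close> the linear part is at least \<open>b * norm (z - w)\<close> and
  the error at most half of that, so \<open>F\<close> cannot vanish off \<open>w\<close>.\<close>

lemma isolated_zero:
  fixes F :: "complex \<Rightarrow> complex"
  assumes F: "(F has_derivative D) (at w)" "F w = 0" and inj: "\<And>h. D h = 0 \<Longrightarrow> h = 0"
  obtains d where "d > 0" "\<And>z. norm (z - w) < d \<Longrightarrow> F z = 0 \<Longrightarrow> z = w"
proof -
  interpret D: bounded_linear D using F(1) by (rule has_derivative_bounded_linear)
  have "inj D" using inj D.linear_axioms by (metis linear_injective_0)
  then obtain b where b: "b > 0" "\<And>z. b * norm z \<le> norm (D z)"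
    using linear_inj_bounded_below_pos[of D] D.linear_axioms by blast
  obtain d where d: "d > 0" "\<And>z. norm (z - w) < d \<Longrightarrow> norm (F z - F w - D (z - w)) \<le> b / 2 * norm (z - w)"
    using F(1) half_gt_zero[OF b(1)] unfolding has_derivative_at_alt by blast
  show ?thesis
  proof (rule that[OF d(1)])
    fix z assume z: "norm (z - w) < d" "F z = 0"
    have "norm (D (z - w)) \<le> b / 2 * norm (z - w)" using d(2)[OF z(1)] z(2) F(2) by simp
    then have "b * norm (z - w) \<le> b / 2 * norm (z - w)" using b(2)[of "z - w"] by linarith
    then have "norm (z - w) \<le> 0" using b(1) by (simp add: mult_le_0_iff)
    then show "z = w" by simp
  qed
qed

locale nonresonant_potential = short_step +
  fixes n :: nat
  assumes n: "real n * \<tau> = T0"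
    and nonresonant: "\<And>K \<kappa> x x' y y' t. 1 \<le> K \<Longrightarrow> ode2_solution force x x' \<Longrightarrow>
      (\<And>t. x (t + real K * T0) = x t + of_int \<kappa>) \<Longrightarrow>
      ode2_solution (\<lambda>t y. - Vxx t (x t) * y) y y' \<Longrightarrow>
      (\<And>t. y (t + real K * T0) = y t) \<Longrightarrow> y t = 0"
begin

lemma n_pos: "n \<ge> 1"
  using n T0 by (cases n) auto

lemma Vxx_period: "Vxx (t + real i * T0) (x + of_int k) = Vxx t x"
proof -
  have "((\<lambda>u. Vx (t + real i * T0) (u + of_int k)) has_real_derivative Vxx (t + real i * T0) (x + of_int k)) (at x)"
    using DERIV_shift[of "Vx (t + real i * T0)" _ x "of_int k"] Vx_deriv by blast
  then have "(Vx t has_real_derivative Vxx (t + real i * T0) (x + of_int k)) (at x)"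
    by (simp only: shift_int time_multiple)
  then show ?thesis using Vx_deriv DERIV_unique by blast
qed

text \<open>\<open>returning K \<kappa> x x'\<close>: the solution \<open>x\<close> with velocity \<open>x'\<close> represents an element of
  \<open>C\<^sup>2\<close> with \<open>k\<^sub>1 = \<kappa>\<close> and \<open>k\<^sub>2 = K\<close>.\<close>

definition returning :: "nat \<Rightarrow> int \<Rightarrow> (real \<Rightarrow> real) \<Rightarrow> (real \<Rightarrow> real) \<Rightarrow> bool" where
  "returning K \<kappa> x x' \<longleftrightarrow> ode2_solution force x x' \<and> (\<forall>t. x (t + real K * T0) = x t + of_int \<kappa>)"

lemma returningD:
  assumes "returning K \<kappa> x x'"
  shows "ode2_solution force x x'" "x (t + real K * T0) = x t + of_int \<kappa>" "x' (t + real K * T0) = x' t"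
proof -
  show sol: "ode2_solution force x x'" and per: "x (t + real K * T0) = x t + of_int \<kappa>" for t
    using assms by (auto simp: returning_def)
  have "((\<lambda>t. x (t + real K * T0)) has_real_derivative x' (t + real K * T0)) (at t)"
    using DERIV_shift[of x _ t "real K * T0"] ode2_solutionD(1)[OF sol] by blast
  moreover have "((\<lambda>t. x (t + real K * T0)) has_real_derivative x' t) (at t)"
    unfolding per using DERIV_add[OF ode2_solutionD(1)[OF sol, of t] DERIV_const[of "of_int \<kappa>"]] by simp
  ultimately show "x' (t + real K * T0) = x' t" by (rule DERIV_unique)
qed

text \<open>The translate of \<open>x\<close> by one return time, raised by \<open>\<kappa>\<close>,
  solves the same equation with the same data at that time, so uniqueness makes it equal to
  \<open>x\<close>.\<close>

lemma returning_if_endpoints: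
  assumes sol: "ode2_solution force x x'"
    and "x (real K * T0) = x 0 + of_int \<kappa>" "x' (real K * T0) = x' 0"
  shows "returning K \<kappa> x x'"
proof -
  have "(\<lambda>t. x (t - real K * T0) + of_int \<kappa>) = x"
    by (rule solution_unique(1)[OF solution_shift[OF solution_time_shift[OF sol]] sol, where s = "real K * T0"])
       (use assms(2,3) in simp_all)
  then have "x (t + real K * T0) = x t + of_int \<kappa>" for t
    by (metis add_diff_cancel_right')
  then show ?thesis using sol by (simp add: returning_def)
qed

lemma returning_multiple:
  assumes "returning K \<kappa> x x'"
  shows "returning (m * K) (int m * \<kappa>) x x'"
proof -
  have "x (t + real (m * K) * T0) = x t + of_int (int m * \<kappa>)" for t
  proof (induction m)
    case (Suc m)
    have "x (t + real (Suc m * K) * T0) = x ((t + real (m * K) * T0) + real K * T0)" by (simp add: algebra_simps)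
    also have "\<dots> = x t + of_int (int (Suc m) * \<kappa>)"
      unfolding returningD(2)[OF assms] Suc by (simp add: algebra_simps)
    finally show ?case .
  qed simp
  then show ?thesis using returningD(1)[OF assms] by (simp add: returning_def)
qed

lemma returning_shift: "returning K \<kappa> x x' \<Longrightarrow> returning K \<kappa> (\<lambda>t. x t + of_int k) x'"
  unfolding returning_def using solution_shift by auto

text \<open>At some instant of each return time the velocity equals the mean velocity
  \<open>\<kappa> / (K * T0)\<close>; within one return time the bounded force changes it by at most
  \<open>B * (K * T0)\<close>.\<close>

lemma returning_velocity_bound:
  assumes "returning K \<kappa> x x'" "K \<ge> 1"
  shows "\<bar>x' s\<bar> \<le> \<bar>of_int \<kappa>\<bar> / (real K * T0) + B * (real K * T0)"
proof -
  let ?S = "real K * T0"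
  have S: "?S > 0" using assms(2) T0 by simp
  note sol = returningD(1)[OF assms(1)]
  obtain z where z: "s < z" "z < s + ?S" "x (s + ?S) - x s = (s + ?S - s) * x' z"
    using MVT2[of s "s + ?S" x x'] S ode2_solutionD(1)[OF sol] by auto
  then have "of_int \<kappa> = ?S * x' z" using returningD(2)[OF assms(1), of s] by simp
  moreover have "?S * x' z / ?S = x' z" by (rule nonzero_mult_div_cancel_left) (use S in linarith)
  ultimately have "x' z = of_int \<kappa> / ?S" by metis
  then have 1: "\<bar>x' z\<bar> = \<bar>of_int \<kappa>\<bar> / ?S" using S by (simp add: abs_div)
  obtain u where u: "x' z - x' s = (z - s) * - Vx u (x u)"
    using MVT2[of s z x' "\<lambda>u. - Vx u (x u)"] z(1) ode2_solutionD(2)[OF sol] by auto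
  have "\<bar>x' z - x' s\<bar> = (z - s) * \<bar>Vx u (x u)\<bar>" unfolding u using z by (simp add: abs_mult)
  also have "\<dots> \<le> ?S * B" using z Vx_bound[of u "x u"] by (intro mult_mono) auto
  finally show ?thesis using 1 by (simp add: mult.commute)
qed

section \<open>The return map and its zeros\<close>

definition return_map :: "nat \<Rightarrow> int \<Rightarrow> complex \<Rightarrow> complex" where
  "return_map K \<kappa> z = time_map (real K * T0) z - z - of_int \<kappa>"

lemma return_map_eq_0_iff:
  "return_map K \<kappa> z = 0 \<longleftrightarrow> returning K \<kappa> (pos 0 (Re z) (Im z)) (vel 0 (Re z) (Im z))"
proof
  assume "return_map K \<kappa> z = 0"
  then show "returning K \<kappa> (pos 0 (Re z) (Im z)) (vel 0 (Re z) (Im z))"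
    by (intro returning_if_endpoints trajectory) (auto simp: return_map_def time_map_def complex_eq_iff trajectory)
next
  assume r: "returning K \<kappa> (pos 0 (Re z) (Im z)) (vel 0 (Re z) (Im z))"
  show "return_map K \<kappa> z = 0"
    using returningD(2,3)[OF r, of 0] by (simp add: return_map_def time_map_def complex_eq_iff trajectory)
qed

lemma returning_return_map:
  assumes "returning K \<kappa> x x'"
  shows "return_map K \<kappa> (Complex (x 0) (x' 0)) = 0"
  using assms unfolding return_map_eq_0_iff complex.sel trajectory_unique[OF returningD(1)[OF assms], of 0] .

lemma return_map_translation: "return_map K \<kappa> (z + of_int k) = return_map K \<kappa> z"
  by (simp add: return_map_def time_map_def trajectory_shift complex_eq_iff)

lemma continuous_on_return_map: "continuous_on U (return_map K \<kappa>)"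
  unfolding return_map_def using T0 by (intro continuous_intros continuous_on_time_map) auto

text \<open>A kernel vector \<open>h\<close> gives the solution \<open>u\<close> of the linearized
  equation with initial data \<open>h\<close>, and \<open>D h = 0\<close> says that these data recur
  after the return time. Hence \<open>u\<close> is periodic, so it vanishes by non-resonance, and
  with it \<open>h\<close>.\<close>

lemma return_map_nondegenerate:
  assumes K: "K \<ge> 1" and z: "return_map K \<kappa> z = 0"
  shows "\<exists>D. (return_map K \<kappa> has_derivative D) (at z) \<and> (\<forall>h. D h = 0 \<longrightarrow> h = 0)"
proof -
  let ?x = "pos 0 (Re z) (Im z)" and ?S = "real K * T0"
  have r: "returning K \<kappa> ?x (vel 0 (Re z) (Im z))" using z by (simp add: return_map_eq_0_iff)
  interpret Lin: lipschitz_ode2 "\<lambda>t y. - Vxx t (?x t) * y" M 0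
    by (rule linearization_lipschitz) (rule ode2_solution_continuous[OF trajectory(1)])
  obtain y y' where y: "ode2_solution (\<lambda>t y. - Vxx t (?x t) * y) y y'" "y 0 = 1" "y' 0 = 0"
    using Lin.ivp_existence by blast
  obtain q q' where q: "ode2_solution (\<lambda>t y. - Vxx t (?x t) * y) q q'" "q 0 = 0" "q' 0 = 1"
    using Lin.ivp_existence by blast
  define D where "D = (\<lambda>h. Complex (Re h * y ?S + Im h * q ?S) (Re h * y' ?S + Im h * q' ?S) - h - 0)"
  have "(time_map ?S has_derivative
     (\<lambda>h. Complex (Re h * y ?S + Im h * q ?S) (Re h * y' ?S + Im h * q' ?S))) (at z)"
    using T0 y q by (intro time_map_derivative) auto
  then have der: "(return_map K \<kappa> has_derivative D) (at z)"
    unfolding return_map_def[abs_def] D_def by (intro has_derivative_diff has_derivative_ident has_derivative_const)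
  have "h = 0" if "D h = 0" for h
  proof -
    define u u' where "u = (\<lambda>t. Re h * y t + Im h * q t)" and "u' = (\<lambda>t. Re h * y' t + Im h * q' t)"
    have "(u has_real_derivative u' t) (at t)"
      "(u' has_real_derivative Re h * (- Vxx t (?x t) * y t) + Im h * (- Vxx t (?x t) * q t)) (at t)" for t
      unfolding u_def u'_def
      by (intro DERIV_add DERIV_cmult ode2_solutionD[OF y(1)] ode2_solutionD[OF q(1)])+
    moreover have "Re h * (- Vxx t (?x t) * y t) + Im h * (- Vxx t (?x t) * q t) = - Vxx t (?x t) * u t" for t
      by (simp add: u_def algebra_simps)
    ultimately have u: "ode2_solution (\<lambda>t y. - Vxx t (?x t) * y) u u'" by (simp add: ode2_solution_def)
    have ends: "u ?S = u 0" "u' ?S = u' 0"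
      using that by (auto simp: D_def u_def u'_def y q complex_eq_iff)
    have "ode2_solution (\<lambda>t y. - Vxx t (?x t) * y) (\<lambda>t. u (t - ?S)) (\<lambda>t. u' (t - ?S))"
      unfolding ode2_solution_def
    proof (intro allI conjI)
      fix t
      show "((\<lambda>t. u (t - ?S)) has_real_derivative u' (t - ?S)) (at t)"
        by (intro DERIV_time_shift ode2_solutionD[OF u])
      \<comment> \<open>The coefficient of the linearized equation is genuinely periodic, although
        \<open>?x\<close> is so only up to \<open>\<kappa>\<close>; thus the translate of
        \<open>u\<close> solves the same equation.\<close>
      have "Vxx t (?x t) = Vxx (t - ?S + ?S) (?x (t - ?S) + of_int \<kappa>)"
        using returningD(2)[OF r, of "t - ?S"] by simp
      then have "Vxx t (?x t) = Vxx (t - ?S) (?x (t - ?S))" by (simp only: Vxx_period)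
      moreover have "((\<lambda>t. u' (t - ?S)) has_real_derivative - Vxx (t - ?S) (?x (t - ?S)) * u (t - ?S)) (at t)"
        by (intro DERIV_time_shift ode2_solutionD[OF u])
      ultimately show "((\<lambda>t. u' (t - ?S)) has_real_derivative - Vxx t (?x t) * u (t - ?S)) (at t)" by simp
    qed
    then have "(\<lambda>t. u (t - ?S)) = u"
      using Lin.solution_unique(1)[OF _ u, of _ _ ?S] ends by simp
    then have "u (t + ?S) = u t" for t by (metis add_diff_cancel_right')
    then have u0: "u t = 0" for t
      using nonresonant[OF K returningD(1)[OF r] returningD(2)[OF r] u] by blast
    then have "u = (\<lambda>t. 0)" by auto
    then have "u' 0 = 0" using ode2_solutionD(1)[OF u, of 0] DERIV_unique[OF _ DERIV_const] by metis
    then show "h = 0" using u0[of 0] by (simp add: u_def u'_def y q complex_eq_iff)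
  qed
  then show ?thesis using der by blast
qed

definition return_zeros :: "nat \<Rightarrow> int \<Rightarrow> complex set" where
  "return_zeros K \<kappa> = {z. return_map K \<kappa> z = 0 \<and> 0 \<le> Re z \<and> Re z < 1}"

lemma finite_return_zeros:
  assumes K: "K \<ge> 1"
  shows "finite (return_zeros K \<kappa>)"
proof (rule ccontr)
  assume inf: "infinite (return_zeros K \<kappa>)"
  define R where "R = \<bar>of_int \<kappa>\<bar> / (real K * T0) + B * (real K * T0)"
  have "return_zeros K \<kappa> \<subseteq> cbox (Complex 0 (- R)) (Complex 1 R)"
  proof
    fix z assume z: "z \<in> return_zeros K \<kappa>"
    then have "\<bar>Im z\<bar> \<le> R"
      using returning_velocity_bound[of K \<kappa> "pos 0 (Re z) (Im z)" "vel 0 (Re z) (Im z)" 0] K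
      by (simp add: return_zeros_def return_map_eq_0_iff R_def trajectory)
    then show "z \<in> cbox (Complex 0 (- R)) (Complex 1 R)"
      using z by (auto simp: return_zeros_def in_cbox_complex_iff)
  qed
  then obtain w where w: "w islimpt return_zeros K \<kappa>"
    using compact_cbox inf unfolding compact_eq_Bolzano_Weierstrass by blast
  \<comment> \<open>The limit point may have real part 1 and so leave the half-open strip.
    Closedness and isolation are therefore used for zeros in the whole plane.\<close>
  have "closed {z. return_map K \<kappa> z = 0}" by (intro closed_Collect_eq continuous_on_return_map continuous_on_const)
  moreover have "w islimpt {z. return_map K \<kappa> z = 0}"
    using w by (rule islimpt_subset) (auto simp: return_zeros_def)
  ultimately have w0: "return_map K \<kappa> w = 0" by (auto simp: closed_limpt)
  obtain D where D: "(return_map K \<kappa> has_derivative D) (at w)" "\<And>h. D h = 0 \<Longrightarrow> h = 0"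
    using return_map_nondegenerate[OF K w0] by blast
  obtain d where d: "d > 0" "\<And>z. norm (z - w) < d \<Longrightarrow> return_map K \<kappa> z = 0 \<Longrightarrow> z = w"
    using isolated_zero[OF D(1) w0 D(2)] by blast
  obtain z where "z \<in> return_zeros K \<kappa>" "z \<noteq> w" "dist z w < d"
    using w d(1) unfolding islimpt_approachable by blast
  then show False using d(2)[of z] by (simp add: return_zeros_def dist_norm)
qed

lemma even_card_return_zeros:
  assumes K: "K \<ge> 1"
  shows "even (card (return_zeros K \<kappa>))"
proof -
  let ?S = "real K * T0"
  have S: "?S > 0" using K T0 by simp
  define R where "R = \<bar>of_int \<kappa>\<bar> / ?S + B * ?S"
  have RS: "?S * (R - B * ?S) = \<bar>of_int \<kappa>\<bar>" unfolding R_def add_diff_cancel_right' times_divide_eq_right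
    by (rule nonzero_mult_div_cancel_left) (use S in linarith)
  \<comment> \<open>The mean velocity \<open>c\<close> differs from the initial one by at most
    \<open>B * ?S\<close>. Beyond \<open>R\<close> the displacement thus exceeds
    \<open>\<bar>\<kappa>\<bar>\<close> in the direction of the velocity, which fixes the sign of
    the real part.\<close>
  have avg: "\<exists>c. pos 0 a v ?S = a + ?S * c \<and> \<bar>c - v\<bar> \<le> B * ?S" for a v
  proof -
    obtain u where u: "0 < u" "u < ?S" "pos 0 a v ?S - pos 0 a v 0 = (?S - 0) * vel 0 a v u"
      using MVT2[of 0 ?S "pos 0 a v" "vel 0 a v"] S ode2_solutionD(1)[OF trajectory(1)] by blast
    obtain r where r: "vel 0 a v u - vel 0 a v 0 = (u - 0) * - Vx r (pos 0 a v r)"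
      using MVT2[of 0 u "vel 0 a v" "\<lambda>r. - Vx r (pos 0 a v r)"] u(1) ode2_solutionD(2)[OF trajectory(1)] by blast
    have "\<bar>vel 0 a v u - v\<bar> = u * \<bar>Vx r (pos 0 a v r)\<bar>"
      using r u(1) by (simp add: trajectory abs_mult)
    also have "\<dots> \<le> ?S * B" using u Vx_bound by (intro mult_mono) auto
    finally show ?thesis using u(3) by (intro exI[of _ "vel 0 a v u"]) (simp add: trajectory mult.commute)
  qed
  have up: "Re (return_map K \<kappa> z) > 0" if "Im z > R" for z
  proof -
    obtain c where c: "pos 0 (Re z) (Im z) ?S = Re z + ?S * c" "\<bar>c - Im z\<bar> \<le> B * ?S" using avg by blast
    have "?S * (R - B * ?S) < ?S * c" using S c(2) that by (intro mult_strict_left_mono) linarith+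
    then show ?thesis using c(1) RS by (simp add: return_map_def time_map_def)
  qed
  have lo: "Re (return_map K \<kappa> z) < 0" if "Im z < - R" for z
  proof -
    obtain c where c: "pos 0 (Re z) (Im z) ?S = Re z + ?S * c" "\<bar>c - Im z\<bar> \<le> B * ?S" using avg by blast
    have "?S * c < ?S * - (R - B * ?S)" using S c(2) that by (intro mult_strict_left_mono) linarith+
    then have "?S * c < - \<bar>of_int \<kappa>\<bar>" using RS by (simp only: mult_minus_right)
    then show ?thesis using c(1) by (simp add: return_map_def time_map_def, linarith?)
  qed
  show ?thesis unfolding return_zeros_def
    by (rule even_card_nondegenerate_zeros[OF continuous_on_return_map _ return_map_nondegenerate[OF K] up lo
          finite_return_zeros[OF K, unfolded return_zeros_def]])
       (use return_map_translation[of K \<kappa> _ 1] in auto)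
qed

lemma returning_zero_representative:
  assumes "returning K \<kappa> x x'"
  obtains z k where "z \<in> return_zeros K \<kappa>" "x = (\<lambda>t. pos 0 (Re z) (Im z) t + of_int k)" "x' = vel 0 (Re z) (Im z)"
proof -
  let ?k = "\<lfloor>x 0\<rfloor>"
  let ?z = "Complex (x 0 - of_int ?k) (x' 0)"
  have r: "returning K \<kappa> (\<lambda>t. x t + of_int (- ?k)) x'" by (rule returning_shift[OF assms])
  have tr: "pos 0 (Re ?z) (Im ?z) = (\<lambda>t. x t + of_int (- ?k))" "vel 0 (Re ?z) (Im ?z) = x'"
    using trajectory_unique[OF returningD(1)[OF r], of 0] by simp_all
  have "0 \<le> x 0 - of_int ?k" "x 0 - of_int ?k < 1" by linarith+
  then have "?z \<in> return_zeros K \<kappa>"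
    using returning_return_map[OF r] by (simp add: return_zeros_def)
  then show ?thesis by (rule that[of ?z ?k]) (simp_all only: tr, simp)
qed

section \<open>Chains of short links and returning solutions\<close>

definition node :: "nat \<Rightarrow> real" where "node j = real j * \<tau>"

lemma node_0 [simp]: "node 0 = 0"
  by (simp add: node_def)

lemma chain:
  assumes "K \<ge> 1"
  shows "periodic_chain (\<lambda>j. link_action (node j)) (\<lambda>j. slope (node j)) (\<lambda>j. end_velocity (node j))
    link_constant (1 / (2 * \<tau>)) (B * \<tau>) (K * n)"
proof
  show "K * n \<ge> 1" using assms n_pos by (metis One_nat_def Suc_leI mult_pos_pos less_le_trans zero_less_one)
qed (rule link_constant_pos link_action_expansion link_action_coercive link_action_shift slope_shift
      end_velocity_shift continuous_on_slope continuous_on_end_velocity | simp add: tau)+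

definition curve_action :: "(real \<Rightarrow> real) \<Rightarrow> nat \<Rightarrow> real" where
  "curve_action x N = (\<Sum>j<N. link_action (node j) (x (node j)) (x (node (Suc j))))"

lemma node_add: "node (j + K * n) = node j + real K * T0"
  unfolding n[symmetric] node_def by (simp add: algebra_simps)

lemma node_Suc: "node (Suc j) = node j + \<tau>"
  by (simp add: node_def algebra_simps)

lemma solution_at_node:
  assumes "ode2_solution force x x'"
  shows "slope (node j) (x (node j)) (x (node (Suc j))) = x' (node j)"
    and "end_velocity (node j) (x (node j)) (x (node (Suc j))) = x' (node (Suc j))"
proof -
  show s: "slope (node j) (x (node j)) (x (node (Suc j))) = x' (node j)"
    using trajectory_unique(1)[OF assms, of "node j"] by (intro slope_unique) (simp only: node_Suc)
  show "end_velocity (node j) (x (node j)) (x (node (Suc j))) = x' (node (Suc j))"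
    unfolding end_velocity_def s using trajectory_unique(2)[OF assms, of "node j"] by (simp only: node_Suc)
qed

lemma curve_action_multiple:
  assumes "returning K \<kappa> x x'"
  shows "curve_action x (m * (K * n)) = real m * curve_action x (K * n)"
proof -
  let ?g = "\<lambda>j. link_action (node j) (x (node j)) (x (node (Suc j)))"
  have per: "?g (j + K * n) = ?g j" for j
  proof -
    have s: "Suc (j + K * n) = Suc j + K * n" by simp
    show ?thesis
      unfolding s node_add returningD(2)[OF assms] link_action_shift
      by (rule link_action_time_shift)
  qed
  have per': "?g (j + i * (K * n)) = ?g j" for i j
  proof (induction i)
    case (Suc i)
    have "?g (j + Suc i * (K * n)) = ?g ((j + i * (K * n)) + K * n)" by (simp add: algebra_simps)
    also have "\<dots> = ?g j" unfolding per by (rule Suc)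
    finally show ?case .
  qed simp
  have block: "sum ?g {i * (K * n)..<i * (K * n) + K * n} = curve_action x (K * n)" for i
  proof -
    have "sum ?g {0 + i * (K * n)..<K * n + i * (K * n)} = (\<Sum>j\<in>{0..<K * n}. ?g (j + i * (K * n)))"
      by (rule sum.shift_bounds_nat_ivl)
    also have "\<dots> = curve_action x (K * n)" unfolding per' by (simp add: curve_action_def atLeast0LessThan)
    finally show ?thesis by (simp add: add.commute)
  qed
  have "curve_action x (m * (K * n)) = (\<Sum>i<m. sum ?g {i * (K * n)..<i * (K * n) + K * n})"
    unfolding curve_action_def by (rule sum.nat_group[symmetric])
  then show ?thesis unfolding block by simp
qed

lemma curve_action_shift: "curve_action (\<lambda>t. x t + of_int k) N = curve_action x N"
  by (simp add: curve_action_def link_action_shift)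

context
  fixes K :: nat and \<kappa> :: int
  assumes K: "K \<ge> 1"
begin

interpretation chain: periodic_chain "\<lambda>j. link_action (node j)" "\<lambda>j. slope (node j)" "\<lambda>j. end_velocity (node j)"
    link_constant "1 / (2 * \<tau>)" "B * \<tau>" "K * n" \<kappa>
  by (rule chain[OF K])

lemma returning_wrap:
  assumes "returning K \<kappa> x x'" "j \<le> K * n"
  shows "chain.wrap (\<lambda>j. x (node j)) j = x (node j)"
proof (cases "j = K * n")
  case True
  then show ?thesis using returningD(2)[OF assms(1), of 0] node_add[of 0 K] by (simp add: chain.wrap_def)
next
  case False
  then show ?thesis using assms(2) by (simp add: chain.wrap_def)
qed

lemma returning_action:
  assumes "returning K \<kappa> x x'"
  shows "chain.action (\<lambda>j. x (node j)) = curve_action x (K * n)"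
  unfolding chain.action_def curve_action_def
  by (rule sum.cong) (simp_all add: returning_wrap[OF assms] Suc_leI)

text \<open>A vanishing \<open>grad\<close> at an inner node says that the next link leaves with the
  velocity at which the previous one arrives. By induction all links are pieces of the one
  trajectory that starts along the first link.\<close>

lemma critical_returning:
  assumes crit: "chain.critical z"
  defines "x \<equiv> pos 0 (z 0) (slope 0 (z 0) (chain.wrap z 1))"
    and "x' \<equiv> vel 0 (z 0) (slope 0 (z 0) (chain.wrap z 1))"
  shows "returning K \<kappa> x x'" "\<And>j. j < K * n \<Longrightarrow> x (node j) = z j" "chain.action z = curve_action x (K * n)"
proof -
  let ?w = "chain.wrap z"
  have sol: "ode2_solution force x x'" unfolding x_def x'_def by (rule trajectory)
  have N: "0 < K * n" using chain.N by simp
  have w0: "?w 0 = z 0" using N by (simp add: chain.wrap_def)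
  have step: "x (node (Suc j)) = ?w (Suc j) \<and> x' (node (Suc j)) = end_velocity (node j) (?w j) (?w (Suc j))"
    if "x (node j) = ?w j" "x' (node j) = slope (node j) (?w j) (?w (Suc j))" for j
    using trajectory_unique[OF sol, of "node j"] pos_slope[of "node j" "?w j" "?w (Suc j)"]
    unfolding that end_velocity_def node_Suc by metis
  have I: "x (node j) = ?w j \<and> x' (node j) = slope (node j) (?w j) (?w (Suc j))" if "j < K * n" for j
    using that
  proof (induction j)
    case 0
    then show ?case by (simp add: w0) (simp add: x_def x'_def trajectory)
  next
    case (Suc j)
    then have "x (node (Suc j)) = ?w (Suc j)" "x' (node (Suc j)) = end_velocity (node j) (?w j) (?w (Suc j))"
      using step[of j] by auto
    moreover have "chain.grad z (Suc j) = 0" using crit Suc.prems by (simp add: chain.critical_def)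
    ultimately show ?case by (simp add: chain.grad_def chain.prv_def)
  qed
  define j where "j = K * n - 1"
  have j: "j < K * n" "Suc j = K * n" using N by (auto simp: j_def)
  have e: "x (node (K * n)) = ?w (K * n)" "x' (node (K * n)) = end_velocity (node j) (?w j) (?w (K * n))"
    using step[of j] I[OF j(1)] j(2) by auto
  \<comment> \<open>The condition at node 0 matches the final with the initial velocity and so
    closes the orbit.\<close>
  have "chain.grad z 0 = 0" using crit N by (simp add: chain.critical_def)
  then have "x' (node (K * n)) = x' (node 0)"
    using I[OF N] e(2) j(2) by (simp add: chain.grad_def chain.prv_def j_def)
  moreover have "x (node (K * n)) = x (node 0) + of_int \<kappa>"
    using e(1) I[OF N] w0 by (simp add: chain.wrap_def[of z "K * n"])
  ultimately show r: "returning K \<kappa> x x'"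
    using returning_if_endpoints[OF sol, of K \<kappa>] node_add[of 0 K] by simp
  show xz: "x (node j) = z j" if "j < K * n" for j using I[OF that] that by (simp add: chain.wrap_def)
  show "chain.action z = curve_action x (K * n)"
    unfolding returning_action[OF r, symmetric] by (rule chain.cong) (simp add: xz)
qed

text \<open>Minimality among solutions compares actions within a class; minimality among all chains
  is what the mountain pass requires.\<close>

lemma returning_minimizer_exists:
  obtains x x' where "returning K \<kappa> x x'"
    "\<And>y y'. returning K \<kappa> y y' \<Longrightarrow> curve_action x (K * n) \<le> curve_action y (K * n)"
    "\<And>z. curve_action x (K * n) \<le> chain.action z"
proof -
  obtain q where q: "\<And>z. chain.action q \<le> chain.action z" using chain.minimum_exists by blast
  note c = critical_returning[OF chain.minimum_critical[OF q]]
  show ?thesis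
  proof (rule that[OF c(1)])
    fix z show "curve_action (pos 0 (q 0) (slope 0 (q 0) (chain.wrap q 1))) (K * n) \<le> chain.action z"
      using q[of z] unfolding c(3) .
  next
    fix y y' assume y: "returning K \<kappa> y y'"
    show "curve_action (pos 0 (q 0) (slope 0 (q 0) (chain.wrap q 1))) (K * n) \<le> curve_action y (K * n)"
      using q[of "\<lambda>j. y (node j)"] unfolding c(3) returning_action[OF y] .
  qed
qed

text \<open>Isolation is carried from initial data to chains: the initial velocity is a Lipschitz
  function of the first two nodes, so a nearby critical chain comes from a nearby zero of the return
  map.\<close>

lemma critical_isolated:
  assumes r: "returning K \<kappa> x x'"
  obtains \<epsilon> where "\<epsilon> > 0"
    "\<And>z. chain.critical z \<Longrightarrow> (\<And>i. i < K * n \<Longrightarrow> \<bar>z i - x (node i)\<bar> \<le> \<epsilon>) \<Longrightarrow> (\<forall>i<K * n. z i = x (node i))"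
proof -
  let ?w = "Complex (x 0) (x' 0)"
  have w0: "return_map K \<kappa> ?w = 0" by (rule returning_return_map[OF r])
  obtain D where D: "(return_map K \<kappa> has_derivative D) (at ?w)" "\<And>h. D h = 0 \<Longrightarrow> h = 0"
    using return_map_nondegenerate[OF K w0] by blast
  obtain d where d: "d > 0" "\<And>z. norm (z - ?w) < d \<Longrightarrow> return_map K \<kappa> z = 0 \<Longrightarrow> z = ?w"
    using isolated_zero[OF D(1) w0 D(2)] by blast
  \<comment> \<open>The 1 accounts for the starting position. The slope estimate contributes
    \<open>(2 / \<tau>) * (\<epsilon> + 2 * \<epsilon>)\<close> for the velocity.\<close>
  define L where "L = 1 + 6 / \<tau>"
  define \<epsilon> where "\<epsilon> = d / (2 * L)"
  have c: "L > 0" using tau(1) by (simp add: L_def add_pos_pos)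
  have "L * \<epsilon> = d / 2" using c by (simp add: \<epsilon>_def)
  then have \<epsilon>: "\<epsilon> > 0" "(1 + 6 / \<tau>) * \<epsilon> < d" using d(1) c unfolding L_def[symmetric] by (simp_all add: \<epsilon>_def)
  show ?thesis
  proof (rule that[OF \<epsilon>(1)])
    fix z assume crit: "chain.critical z" and near: "\<And>i. i < K * n \<Longrightarrow> \<bar>z i - x (node i)\<bar> \<le> \<epsilon>"
    let ?v = "slope 0 (z 0) (chain.wrap z 1)"
    note c = critical_returning[OF crit]
    have N: "0 < K * n" using chain.N by simp
    \<comment> \<open>\<open>wrap\<close> covers the case of a single link, where node 1 is already
      the closing node.\<close>
    have near_wrap: "\<bar>chain.wrap z 1 - x (node 1)\<bar> \<le> \<epsilon>"
    proof -
      have "\<bar>chain.wrap z 1 - chain.wrap (\<lambda>j. x (node j)) 1\<bar> \<le> \<epsilon>"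
        using near[OF N] near[of 1] by (simp add: chain.wrap_def)
      then show ?thesis using returning_wrap[OF r, of 1] N by simp
    qed
    have x'0: "x' 0 = slope 0 (x 0) (x (node 1))"
      using solution_at_node(1)[OF returningD(1)[OF r], of 0] by simp
    have "\<bar>?v - x' 0\<bar> \<le> (2 / \<tau>) * (\<bar>chain.wrap z 1 - x (node 1)\<bar> + 2 * \<bar>z 0 - x 0\<bar>)"
      unfolding x'0 by (rule slope_lipschitz)
    also have "\<dots> \<le> (2 / \<tau>) * (\<epsilon> + 2 * \<epsilon>)"
      using near_wrap near[OF N] tau(1) by (intro mult_left_mono add_mono) auto
    finally have v: "\<bar>?v - x' 0\<bar> \<le> (6 / \<tau>) * \<epsilon>" by simp
    have "norm (Complex (z 0) ?v - ?w) \<le> \<bar>z 0 - x 0\<bar> + \<bar>?v - x' 0\<bar>"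
      using cmod_le[of "Complex (z 0) ?v - ?w"] by simp
    also have "\<dots> \<le> \<epsilon> + (6 / \<tau>) * \<epsilon>" using near[OF N] v by simp
    also have "\<dots> < d" using \<epsilon>(2) by (simp add: algebra_simps)
    finally have "Complex (z 0) ?v = ?w"
      by (rule d(2)) (use returning_return_map[OF c(1)] in \<open>simp only: trajectory\<close>)
    then have "z 0 = x 0 \<and> ?v = x' 0" unfolding complex.inject .
    then have "pos 0 (z 0) ?v = x" using trajectory_unique(1)[OF returningD(1)[OF r], of 0] by metis
    then show "\<forall>i<K * n. z i = x (node i)" using c(2) by metis
  qed
qed

text \<open>Moving both ends of a link by at most 1 costs at most \<open>2 * R\<close> in the linear
  terms, which are velocities of \<open>x\<close>, and \<open>2 * link_constant\<close> in the
  quadratic error. Neither depends on the number of links.\<close>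

lemma mountain_pass_solution:
  assumes r: "returning K \<kappa> x x'" and min: "\<And>z. curve_action x (K * n) \<le> chain.action z"
    and R: "\<And>t. \<bar>x' t\<bar> \<le> R"
  obtains y y' where "returning K \<kappa> y y'" "curve_action x (K * n) < curve_action y (K * n)"
    "curve_action y (K * n) \<le> curve_action x (K * n) + 3 * (2 * R + 2 * link_constant)"
proof -
  let ?q = "\<lambda>j. x (node j)"
  obtain \<epsilon> where \<epsilon>: "\<epsilon> > 0"
    "\<And>z. chain.critical z \<Longrightarrow> (\<And>i. i < K * n \<Longrightarrow> \<bar>z i - x (node i)\<bar> \<le> \<epsilon>) \<Longrightarrow> (\<forall>i<K * n. z i = x (node i))"
    using critical_isolated[OF r] by blast
  have rise: "link_action (node j) (chain.wrap ?q j + s) (chain.wrap ?q (Suc j) + s')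
      \<le> link_action (node j) (chain.wrap ?q j) (chain.wrap ?q (Suc j)) + (2 * R + 2 * link_constant)"
    if j: "j < K * n" and s: "\<bar>s\<bar> \<le> 1" "\<bar>s'\<bar> \<le> 1" for j s s'
  proof -
    have w: "chain.wrap ?q j = x (node j)" "chain.wrap ?q (Suc j) = x (node (Suc j))"
      using j by (auto intro: returning_wrap[OF r])
    have 1: "\<bar>link_action (node j) (x (node j) + s) (x (node (Suc j)) + s') - link_action (node j) (x (node j)) (x (node (Suc j)))
        - (x' (node (Suc j)) * s' - x' (node j) * s)\<bar> \<le> link_constant * (s\<^sup>2 + s'\<^sup>2)"
      using link_action_expansion[of "node j" "x (node j) + s" "x (node (Suc j)) + s'" "x (node j)" "x (node (Suc j))"]
      by (simp only: solution_at_node[OF returningD(1)[OF r]] add_diff_cancel_left')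
    have 2: "link_constant * (s\<^sup>2 + s'\<^sup>2) \<le> link_constant * (1 + 1)"
      using s link_constant_pos by (intro mult_left_mono add_mono) (auto simp: abs_square_le_1)
    have 3: "\<bar>x' (node (Suc j)) * s'\<bar> \<le> R" "\<bar>x' (node j) * s\<bar> \<le> R"
      using mult_mono[OF R[of "node (Suc j)"] s(2)] mult_mono[OF R[of "node j"] s(1)] order_trans[OF abs_ge_zero R]
      by (auto simp: abs_mult)
    show ?thesis using abs_le_D1[OF 1] 2 abs_le_D1[OF 3(1)] abs_le_D2[OF 3(2)] unfolding w by simp
  qed
  have q: "chain.action ?q \<le> chain.action z" for z
    using min[of z] returning_action[OF r] by simp
  obtain z where z: "chain.critical z" "chain.action ?q < chain.action z"
    "chain.action z \<le> chain.action ?q + 3 * (2 * R + 2 * link_constant)"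
    using chain.mountain_pass_uniform[OF q \<epsilon> rise] by blast
  note c = critical_returning[OF z(1)]
  show ?thesis by (rule that[OF c(1)]) (use z(2,3) in \<open>simp_all only: c(3) returning_action[OF r]\<close>)
qed

end

lemma return_zeros_nonempty:
  assumes "K \<ge> 1" shows "return_zeros K \<kappa> \<noteq> {}"
proof -
  obtain x x' where r: "returning K \<kappa> x x'" by (rule returning_minimizer_exists[OF assms])
  obtain z where "z \<in> return_zeros K \<kappa>" by (rule returning_zero_representative[OF r])
  then show ?thesis by blast
qed

text \<open>A mountain pass over the \<open>m\<close>-fold iterate of a minimizer costs a bounded amount of action, while
  the action of the \<open>m\<close>-fold iterate of a non-minimizing solution exceeds the minimum by a multiple of \<open>m\<close>.\<close>

lemma new_returning_solution:
  assumes K: "K \<ge> 1"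
  obtains m0 where "\<And>m. m > m0 \<Longrightarrow> \<exists>x x'. returning (m * K) (int m * \<kappa>) x x' \<and> \<not> returning K \<kappa> x x'"
proof -
  obtain p p' where p: "returning K \<kappa> p p'"
    and p_min: "\<And>y y'. returning K \<kappa> y y' \<Longrightarrow> curve_action p (K * n) \<le> curve_action y (K * n)"
    using returning_minimizer_exists[OF K] by metis
  \<comment> \<open>The velocity bound is that of the base class, not of the iterated one, so
    \<open>K0\<close> below is independent of \<open>m\<close>.\<close>
  define R where "R = \<bar>of_int \<kappa>\<bar> / (real K * T0) + B * (real K * T0)"
  have R: "\<bar>p' t\<bar> \<le> R" for t unfolding R_def by (rule returning_velocity_bound[OF p K])
  define K0 where "K0 = 3 * (2 * R + 2 * link_constant)"
  define a where "a = curve_action p (K * n)"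
  \<comment> \<open>The base class has only finitely many actions, so there is a gap
    \<open>\<delta>\<close> above the minimal one. The threshold \<open>m0\<close> makes
    \<open>m * \<delta>\<close> exceed \<open>K0\<close>.\<close>
  define Vals where "Vals = (\<lambda>z. curve_action (pos 0 (Re z) (Im z)) (K * n)) ` return_zeros K \<kappa>"
  have Vals: "curve_action y (K * n) \<in> Vals" if r: "returning K \<kappa> y y'" for y y'
  proof -
    obtain z k where z: "z \<in> return_zeros K \<kappa>" "y = (\<lambda>t. pos 0 (Re z) (Im z) t + of_int k)"
      using returning_zero_representative[OF r] by blast
    have "curve_action y (K * n) = curve_action (pos 0 (Re z) (Im z)) (K * n)"
      unfolding z(2) by (rule curve_action_shift)
    then show ?thesis using z(1) unfolding Vals_def by blast
  qed
  have "finite Vals" unfolding Vals_def by (intro finite_imageI finite_return_zeros K)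
  then obtain \<delta> where \<delta>: "\<delta> > 0" "\<And>v. v \<in> Vals \<Longrightarrow> v > a \<Longrightarrow> a + \<delta> \<le> v"
  proof (cases "{v \<in> Vals. v > a} = {}")
    case True
    then show ?thesis using that[of 1] by auto
  next
    case False
    then have "Min {v \<in> Vals. v > a} \<in> {v \<in> Vals. v > a}" using \<open>finite Vals\<close> by (intro Min_in) auto
    then show ?thesis using that[of "Min {v \<in> Vals. v > a} - a"] \<open>finite Vals\<close> by auto
  qed
  define m0 where "m0 = nat \<lceil>\<bar>K0\<bar> / \<delta>\<rceil>"
  show ?thesis
  proof (rule that[of m0])
    fix m assume m: "m > m0"
    have "\<bar>K0\<bar> / \<delta> \<le> real m0" unfolding m0_def by linarith
    also have "\<dots> < real m" using m by simp
    finally have m\<delta>: "K0 < real m * \<delta>" using \<delta>(1) by (simp add: field_simps)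
    have mK: "m * K \<ge> 1" using m K by (metis One_nat_def Suc_leI less_le_trans mult_pos_pos zero_less_one not_gr_zero not_less_zero)
    have act: "curve_action y (m * K * n) = real m * curve_action y (K * n)" if "returning K \<kappa> y y'" for y y'
      using curve_action_multiple[OF that, of m] by (simp add: mult.assoc)
    show "\<exists>x x'. returning (m * K) (int m * \<kappa>) x x' \<and> \<not> returning K \<kappa> x x'"
    proof (rule ccontr)
      assume no: "\<not> ?thesis"
      obtain x x' where x: "returning (m * K) (int m * \<kappa>) x x'"
        "\<And>z. curve_action x (m * K * n) \<le> periodic_chain.action (\<lambda>j. link_action (node j)) (m * K * n) (int m * \<kappa>) z"
        using returning_minimizer_exists[OF mK] by metis
      \<comment> \<open>If no solution is new, even the minimizer of the iterated class is an
        iterate, so its action is at least \<open>m * a\<close> and the iterate of \<open>p\<close>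
        is minimal among all chains.\<close>
      have "returning K \<kappa> x x'" using no x(1) by blast
      then have "curve_action p (m * K * n) \<le> curve_action x (m * K * n)"
        using act[OF p] act p_min by (simp add: mult_left_mono)
      then have min: "curve_action p (m * K * n) \<le> periodic_chain.action (\<lambda>j. link_action (node j)) (m * K * n) (int m * \<kappa>) z" for z
        using x(2)[of z] by linarith
      obtain y y' where y: "returning (m * K) (int m * \<kappa>) y y'"
        "curve_action p (m * K * n) < curve_action y (m * K * n)"
        "curve_action y (m * K * n) \<le> curve_action p (m * K * n) + K0"
        unfolding K0_def using mountain_pass_solution[OF mK returning_multiple[OF p] min R] by blast
      have yf: "returning K \<kappa> y y'" using no y(1) by blast
      have "real m * a < real m * curve_action y (K * n)" "real m * curve_action y (K * n) \<le> real m * a + K0"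
        using y(2,3) unfolding act[OF p] act[OF yf] a_def by simp_all
      moreover from this have "a + \<delta> \<le> curve_action y (K * n)"
        by (intro \<delta>(2) Vals[OF yf]) (simp add: mult_less_cancel_left)
      then have "real m * (a + \<delta>) \<le> real m * curve_action y (K * n)" by (intro mult_left_mono) auto
      ultimately show False using m\<delta> by (simp add: distrib_left)
    qed
  qed
qed

text \<open>By Bezout \<open>a * m = b * m' + 1\<close>: going \<open>a\<close> times through the
  first return and back \<open>b\<close> times through the second leaves a single return of the base
  class.\<close>

lemma returning_coprime:
  assumes 1: "returning (m * K) (int m * \<kappa>) x x'" and 2: "returning (m' * K) (int m' * \<kappa>) x x'"
    and m: "coprime m m'" "m \<ge> 1"
  shows "returning K \<kappa> x x'"
proof -
  obtain a b where "m * a = m' * b + gcd m m'" using bezout_nat[of m m'] m(2) by auto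
  then have ab: "a * m = b * m' + 1" using m(1) by (simp add: mult.commute)
  have "x (t + real K * T0) = x t + of_int \<kappa>" for t
  proof -
    have e1: "x (t + real (a * (m * K)) * T0) = x t + of_int (int a * (int m * \<kappa>))"
      by (rule returningD(2)[OF returning_multiple[OF 1]])
    have e2: "x ((t + real K * T0) + real (b * (m' * K)) * T0) = x (t + real K * T0) + of_int (int b * (int m' * \<kappa>))"
      by (rule returningD(2)[OF returning_multiple[OF 2]])
    have e3: "t + real (a * (m * K)) * T0 = (t + real K * T0) + real (b * (m' * K)) * T0"
    proof -
      have "a * (m * K) = K + b * (m' * K)" using ab by (metis mult.assoc distrib_right mult_1 add.commute)
      then show ?thesis by (simp only: of_nat_add) (simp add: algebra_simps)
    qed
    have e4: "int a * (int m * \<kappa>) = int b * (int m' * \<kappa>) + \<kappa>"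
    proof -
      have "int a * int m = int b * int m' + 1" using ab by (metis of_nat_mult of_nat_add of_nat_1)
      then show ?thesis by (metis mult.assoc distrib_right mult_1)
    qed
    show ?thesis using e1 e2 unfolding e3 e4 of_int_add by linarith
  qed
  then show ?thesis using returningD(1)[OF 1] by (simp add: returning_def)
qed

end

section \<open>Translation to curves modulo 1\<close>

text \<open>Bounded linear maps on the line are multiplications by numbers, so evaluation at 1 and
  \<open>blinfun_scaleR_left\<close> translate between Frechet and ordinary derivatives.\<close>

lemma C2_fun_real_iff:
  fixes x :: "real \<Rightarrow> real"
  shows "C2_fun x \<longleftrightarrow> (\<exists>x' x''. (\<forall>t. (x has_real_derivative x' t) (at t)) \<and>
    (\<forall>t. (x' has_real_derivative x'' t) (at t)) \<and> continuous_on UNIV x'')"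
proof
  assume "C2_fun x"
  then obtain f' :: "real \<Rightarrow> real \<Rightarrow>\<^sub>L real" and f'' :: "real \<Rightarrow> real \<Rightarrow>\<^sub>L real \<Rightarrow>\<^sub>L real"
    where f: "\<And>t. (x has_derivative blinfun_apply (f' t)) (at t)"
      "\<And>t. (f' has_derivative blinfun_apply (f'' t)) (at t)" "continuous_on UNIV f''"
    unfolding C2_fun_def by blast
  have lin: "blinfun_apply g h = blinfun_apply g 1 * h" for g :: "real \<Rightarrow>\<^sub>L real" and h
    using blinfun.scaleR_right[of g h 1] by (simp add: mult.commute)
  have lin2: "blinfun_apply g h = h *\<^sub>R blinfun_apply g 1" for g :: "real \<Rightarrow>\<^sub>L real \<Rightarrow>\<^sub>L real" and h
    using blinfun.scaleR_right[of g h 1] by simp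
  have 1: "(x has_real_derivative blinfun_apply (f' t) 1) (at t)" for t
    unfolding has_field_derivative_def using f(1)[of t] by (rule has_derivative_eq_rhs) (rule ext, rule lin)
  have 2: "((\<lambda>t. blinfun_apply (f' t) 1) has_real_derivative blinfun_apply (blinfun_apply (f'' t) 1) 1) (at t)" for t
  proof -
    have "((\<lambda>t. blinfun_apply (f' t) 1) has_derivative (\<lambda>h. blinfun_apply (blinfun_apply (f'' t) h) 1)) (at t)"
      by (rule bounded_linear.has_derivative[OF blinfun.bounded_linear_left f(2)])
    then show ?thesis unfolding has_field_derivative_def
      by (rule has_derivative_eq_rhs) (rule ext, subst lin2, simp add: blinfun.scaleR_left mult.commute)
  qed
  have 3: "continuous_on UNIV (\<lambda>t. blinfun_apply (blinfun_apply (f'' t) 1) 1)"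
    using f(3) by (intro continuous_intros)
  show "\<exists>x' x''. (\<forall>t. (x has_real_derivative x' t) (at t)) \<and>
    (\<forall>t. (x' has_real_derivative x'' t) (at t)) \<and> continuous_on UNIV x''"
    by (intro exI[of _ "\<lambda>t. blinfun_apply (f' t) 1"] exI[of _ "\<lambda>t. blinfun_apply (blinfun_apply (f'' t) 1) 1"]
        conjI allI 1 2 3)
next
  assume "\<exists>x' x''. (\<forall>t. (x has_real_derivative x' t) (at t)) \<and>
    (\<forall>t. (x' has_real_derivative x'' t) (at t)) \<and> continuous_on UNIV x''"
  then obtain x' x'' where x: "\<And>t. (x has_real_derivative x' t) (at t)"
    "\<And>t. (x' has_real_derivative x'' t) (at t)" "continuous_on UNIV x''" by blast
  show "C2_fun x" unfolding C2_fun_def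
  proof (intro exI conjI allI)
    fix t
    show "(x has_derivative blinfun_apply (blinfun_scaleR_left (x' t))) (at t)"
      using x(1)[of t] unfolding has_field_derivative_def
      by (rule has_derivative_eq_rhs) (simp add: fun_eq_iff mult.commute)
    have "(x' has_derivative (*) (x'' t)) (at t)" using x(2)[of t] unfolding has_field_derivative_def .
    from bounded_linear.has_derivative[OF bounded_linear_blinfun_scaleR_left this]
    show "((\<lambda>t. blinfun_scaleR_left (x' t)) has_derivative
        blinfun_apply (blinfun_scaleR_left (blinfun_scaleR_left (x'' t)))) (at t)"
      by (rule has_derivative_eq_rhs) (auto intro!: blinfun_eqI simp: blinfun.scaleR_left)
  next
    show "continuous_on UNIV (\<lambda>t. blinfun_scaleR_left (blinfun_scaleR_left (x'' t)) :: real \<Rightarrow>\<^sub>L real \<Rightarrow>\<^sub>L real)"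
      by (intro bounded_linear.continuous_on[OF bounded_linear_blinfun_scaleR_left] x(3))
  qed
qed

lemma C2_fun_partial_derivatives:
  fixes V :: "real \<Rightarrow> real \<Rightarrow> real"
  assumes "C2_fun (\<lambda>(t, x). V t x)"
  shows "continuous_on UNIV (\<lambda>(t, x). V t x)"
    and "continuous_on UNIV (\<lambda>(t, x). V_x V t x)"
    and "continuous_on UNIV (\<lambda>(t, x). V_xx V t x)"
    and "(V t has_real_derivative V_x V t x) (at x)"
    and "(V_x V t has_real_derivative V_xx V t x) (at x)"
proof -
  obtain f' :: "real \<times> real \<Rightarrow> (real \<times> real) \<Rightarrow>\<^sub>L real" and f'' :: "real \<times> real \<Rightarrow> (real \<times> real) \<Rightarrow>\<^sub>L (real \<times> real) \<Rightarrow>\<^sub>L real"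
    where f: "\<And>z. ((\<lambda>(t, x). V t x) has_derivative blinfun_apply (f' z)) (at z)"
      "\<And>z. (f' has_derivative blinfun_apply (f'' z)) (at z)" "continuous_on UNIV f''"
    using assms unfolding C2_fun_def by blast
  have pair: "((\<lambda>u. (t, u)) has_derivative (\<lambda>h. (0, h))) (at x)" for t x :: real
    by (auto intro!: derivative_eq_intros)
  have scale: "(0, h) = h *\<^sub>R (0::real, 1::real)" for h by simp
  have d1: "(V t has_real_derivative blinfun_apply (f' (t, x)) (0, 1)) (at x)" for t x
  proof -
    have "((\<lambda>u. (\<lambda>(t, x). V t x) (t, u)) has_derivative (\<lambda>h. blinfun_apply (f' (t, x)) (0, h))) (at x)"
      by (rule has_derivative_compose[OF pair f(1)])
    then show ?thesis unfolding has_field_derivative_def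
      by (simp, elim has_derivative_eq_rhs, intro ext, subst scale)
        (simp only: blinfun.scaleR_right real_scaleR_def mult.commute)
  qed
  have Vx: "V_x V t x = blinfun_apply (f' (t, x)) (0, 1)" for t x
    unfolding V_x_def by (rule DERIV_imp_deriv) (rule d1)
  have d2: "(V_x V t has_real_derivative blinfun_apply (blinfun_apply (f'' (t, x)) (0, 1)) (0, 1)) (at x)" for t x
  proof -
    have "((\<lambda>u. f' (t, u)) has_derivative (\<lambda>h. blinfun_apply (f'' (t, x)) (0, h))) (at x)"
      by (rule has_derivative_compose[OF pair f(2)])
    from bounded_linear.has_derivative[OF blinfun.bounded_linear_left this]
    have "((\<lambda>u. blinfun_apply (f' (t, u)) (0, 1)) has_derivative
        (\<lambda>h. blinfun_apply (blinfun_apply (f'' (t, x)) (0, h)) (0, 1))) (at x)" .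
    then show ?thesis unfolding has_field_derivative_def Vx[abs_def]
      by (elim has_derivative_eq_rhs, intro ext, subst scale)
        (simp only: blinfun.scaleR_right blinfun.scaleR_left real_scaleR_def mult.commute)
  qed
  have Vxx: "V_xx V t x = blinfun_apply (blinfun_apply (f'' (t, x)) (0, 1)) (0, 1)" for t x
    unfolding V_xx_def by (rule DERIV_imp_deriv) (rule d2)
  show "(V t has_real_derivative V_x V t x) (at x)" unfolding Vx by (rule d1)
  show "(V_x V t has_real_derivative V_xx V t x) (at x)" unfolding Vxx by (rule d2)
  show "continuous_on UNIV (\<lambda>(t, x). V t x)"
    using f(1) by (rule has_derivative_continuous_on[OF has_derivative_at_withinI])
  have "continuous_on UNIV f'"
    using f(2) by (rule has_derivative_continuous_on[OF has_derivative_at_withinI])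
  then have "continuous_on UNIV (\<lambda>z. blinfun_apply (f' z) (0, 1))" by (intro continuous_intros)
  then show "continuous_on UNIV (\<lambda>(t, x). V_x V t x)" by (simp add: Vx case_prod_beta)
  have "continuous_on UNIV (\<lambda>z. blinfun_apply (blinfun_apply (f'' z) (0, 1)) (0, 1))"
    using f(3) by (intro continuous_intros)
  then show "continuous_on UNIV (\<lambda>(t, x). V_xx V t x)" by (simp add: Vxx case_prod_beta)
qed

lemma periodic_int_multiple:
  fixes g :: "real \<Rightarrow> 'a"
  assumes "\<And>s. g (s + p) = g s"
  shows "g (s + of_int k * p) = g s"
proof (induction k rule: int_induct[of _ 0])
  case (step1 i)
  then show ?case using assms[of "s + of_int i * p"] by (simp add: algebra_simps)
next
  case (step2 i)
  then show ?case using assms[of "s + of_int (i - 1) * p"] by (simp add: algebra_simps)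
qed simp

lemma doubly_periodic_bounded:
  fixes g :: "real \<Rightarrow> real \<Rightarrow> real"
  assumes cont: "continuous_on UNIV (\<lambda>(t, x). g t x)" and T: "T > 0"
    and per: "\<And>t x. g (t + T) x = g t x" "\<And>t x. g t (x + 1) = g t x"
  obtains b where "\<And>t x. \<bar>g t x\<bar> \<le> b"
proof -
  let ?K = "{0..T} \<times> {0..1::real}"
  have "compact ((\<lambda>(t, x). g t x) ` ?K)"
    by (intro compact_continuous_image compact_Times continuous_on_subset[OF cont]) auto
  then have "bounded ((\<lambda>(t, x). g t x) ` ?K)" by (rule compact_imp_bounded)
  then obtain b where b: "\<forall>y \<in> (\<lambda>(t, x). g t x) ` ?K. norm y \<le> b"
    unfolding bounded_iff ..
  show ?thesis
  proof (rule that[of b])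
    fix t x :: real
    define k where "k = - \<lfloor>t / T\<rfloor>"
    have fl: "of_int \<lfloor>t / T\<rfloor> \<le> t / T" "t / T \<le> of_int \<lfloor>t / T\<rfloor> + 1" by linarith+
    have t: "t + of_int k * T \<in> {0..T}"
      using mult_right_mono[OF fl(1), of T] mult_right_mono[OF fl(2), of T] T by (simp add: k_def algebra_simps)
    have "x + of_int (- \<lfloor>x\<rfloor>) * 1 \<in> {0..1}" by simp linarith
    then have "(\<lambda>(t, x). g t x) (t + of_int k * T, x + of_int (- \<lfloor>x\<rfloor>) * 1) \<in> (\<lambda>(t, x). g t x) ` ?K"
      using t by (intro imageI) auto
    then have "\<bar>g (t + of_int k * T) (x + of_int (- \<lfloor>x\<rfloor>) * 1)\<bar> \<le> b" using bspec[OF b] by fastforce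
    moreover have "g (t + of_int k * T) (x + of_int (- \<lfloor>x\<rfloor>) * 1) = g (t + of_int k * T) x"
      by (rule periodic_int_multiple) (rule per(2))
    moreover have "g (t + of_int k * T) x = g t x"
      by (rule periodic_int_multiple[of "\<lambda>t. g t x"]) (rule per(1))
    ultimately show "\<bar>g t x\<bar> \<le> b" by simp
  qed
qed

lemma ode2_solution_C2_fun:
  assumes "ode2_solution f x x'" "continuous_on UNIV (\<lambda>t. f t (x t))"
  shows "C2_fun x" "deriv (deriv x) t = f t (x t)"
proof -
  show "C2_fun x" unfolding C2_fun_real_iff
    by (intro exI[of _ x'] exI[of _ "\<lambda>t. f t (x t)"] conjI allI ode2_solutionD[OF assms(1)] assms(2))
  have "deriv x = x'" by (rule ext, rule DERIV_imp_deriv, rule ode2_solutionD(1)[OF assms(1)])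
  then show "deriv (deriv x) t = f t (x t)" using DERIV_imp_deriv[OF ode2_solutionD(2)[OF assms(1)]] by simp
qed

lemma C2_fun_ode2_solution:
  fixes x :: "real \<Rightarrow> real"
  assumes "C2_fun x" "\<And>t. deriv (deriv x) t = f t (x t)"
  shows "ode2_solution f x (deriv x)"
proof -
  obtain x' x'' where x: "\<And>t. (x has_real_derivative x' t) (at t)" "\<And>t. (x' has_real_derivative x'' t) (at t)"
    using assms(1) unfolding C2_fun_real_iff by blast
  have "deriv x = x'" by (rule ext, rule DERIV_imp_deriv, rule x(1))
  moreover have "deriv x' t = x'' t" for t using x(2) by (rule DERIV_imp_deriv)
  ultimately show ?thesis using x assms(2) unfolding ode2_solution_def by metis
qed

lemma curve_mod1_eq_iff: "curve_mod1 x = curve_mod1 y \<longleftrightarrow> (\<exists>k::int. \<forall>t. y t = x t + of_int k)"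
proof
  assume "curve_mod1 x = curve_mod1 y"
  moreover have "y \<in> curve_mod1 y" by (auto simp: curve_mod1_def intro: exI[of _ 0])
  ultimately have "y \<in> curve_mod1 x" by simp
  then show "\<exists>k::int. \<forall>t. y t = x t + of_int k" by (simp add: curve_mod1_def)
next
  assume "\<exists>k::int. \<forall>t. y t = x t + of_int k"
  then obtain k :: int where k: "\<And>t. y t = x t + of_int k" by blast
  show "curve_mod1 x = curve_mod1 y"
  proof (intro set_eqI iffI)
    fix z assume "z \<in> curve_mod1 x"
    then obtain l :: int where "\<And>t. z t = x t + of_int l" by (auto simp: curve_mod1_def)
    then show "z \<in> curve_mod1 y" using k by (auto simp: curve_mod1_def intro!: exI[of _ "l - k"])
  next
    fix z assume "z \<in> curve_mod1 y"
    then obtain l :: int where "\<And>t. z t = y t + of_int l" by (auto simp: curve_mod1_def)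
    then show "z \<in> curve_mod1 x" using k by (auto simp: curve_mod1_def intro!: exI[of _ "k + l"])
  qed
qed

lemma reduced_fraction_unique:
  fixes k1 k1' :: int and k2 k2' :: nat and T :: real
  assumes "T > 0" "k2 \<ge> 1" "k2' \<ge> 1" "coprime k1 (int k2)" "coprime k1' (int k2')"
    and "of_int k1 / (real k2 * T) = of_int k1' / (real k2' * T)"
  shows "k1 = k1'" "k2 = k2'"
proof -
  have "of_int k1 * real k2' = of_int k1' * real k2" using assms by (simp add: field_simps)
  then have eq: "k1 * int k2' = k1' * int k2" by (metis of_int_eq_iff of_int_mult of_int_of_nat_eq)
  have "int k2 dvd int k2'"
    using assms(4) eq by (metis coprime_commute coprime_dvd_mult_right_iff dvd_triv_right)
  moreover have "int k2' dvd int k2"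
    using assms(5) eq by (metis coprime_commute coprime_dvd_mult_right_iff dvd_triv_right)
  ultimately show k2: "k2 = k2'" by (simp add: dvd_antisym)
  show "k1 = k1'" using eq k2 assms(2) by simp
qed

section \<open>Curves modulo 1 as zeros of the return map\<close>

context nonresonant_potential
begin

definition return_curve :: "complex \<Rightarrow> (real \<Rightarrow> real) set" where
  "return_curve z = curve_mod1 (pos 0 (Re z) (Im z))"

lemma return_curves:
  "return_curve ` return_zeros K \<kappa> = {curve_mod1 x |x x'. returning K \<kappa> x x'}"
proof (intro set_eqI iffI)
  fix c assume "c \<in> return_curve ` return_zeros K \<kappa>"
  then show "c \<in> {curve_mod1 x |x x'. returning K \<kappa> x x'}"
    by (auto simp: return_curve_def return_zeros_def return_map_eq_0_iff)
next
  fix c assume "c \<in> {curve_mod1 x |x x'. returning K \<kappa> x x'}"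
  then obtain x x' where c: "c = curve_mod1 x" and r: "returning K \<kappa> x x'" by blast
  obtain z k where z: "z \<in> return_zeros K \<kappa>" "x = (\<lambda>t. pos 0 (Re z) (Im z) t + of_int k)"
    by (rule returning_zero_representative[OF r])
  have "return_curve z = c" unfolding c return_curve_def curve_mod1_eq_iff z(2) by blast
  then show "c \<in> return_curve ` return_zeros K \<kappa>" using z(1) by blast
qed

text \<open>Lifts of one curve differ by an integer, and two starting points in
  \<open>[0, 1)\<close> force it to be 0. Counting curves thus means counting zeros in the
  strip.\<close>

lemma inj_on_return_curve: "inj_on return_curve (return_zeros K \<kappa>)"
proof (rule inj_onI)
  fix z w assume z: "z \<in> return_zeros K \<kappa>" and w: "w \<in> return_zeros K \<kappa>" and "return_curve z = return_curve w"
  then obtain k :: int where k: "\<And>t. pos 0 (Re w) (Im w) t = pos 0 (Re z) (Im z) t + of_int k"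
    unfolding return_curve_def curve_mod1_eq_iff by blast
  have "Re w = Re z + of_int k" using k[of 0] by (simp add: trajectory)
  then have "k = 0" using z w by (simp add: return_zeros_def)
  then have p: "pos 0 (Re w) (Im w) = pos 0 (Re z) (Im z)" using k by auto
  have "vel 0 (Re w) (Im w) 0 = vel 0 (Re z) (Im z) 0"
    by (rule DERIV_unique[OF ode2_solutionD(1)[OF trajectory(1)]])
       (unfold p, rule ode2_solutionD(1)[OF trajectory(1)])
  moreover have "Re w = Re z" using p trajectory(2) by metis
  ultimately show "z = w" by (simp add: trajectory complex_eq_iff)
qed

lemma new_curves_infinite:
  assumes "K \<ge> 1"
  shows "infinite {curve_mod1 x |x x' m. m \<ge> 1 \<and> returning (m * K) (int m * \<kappa>) x x' \<and> \<not> returning K \<kappa> x x'}"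
proof -
  obtain m0 where "\<And>m. m > m0 \<Longrightarrow> \<exists>x x'. returning (m * K) (int m * \<kappa>) x x' \<and> \<not> returning K \<kappa> x x'"
    by (rule new_returning_solution[OF assms, where \<kappa> = \<kappa>]) (rule that)
  then have "\<forall>m. \<exists>x. m > m0 \<longrightarrow> (\<exists>x'. returning (m * K) (int m * \<kappa>) x x' \<and> \<not> returning K \<kappa> x x')" by metis
  then obtain x where x: "\<And>m. m > m0 \<Longrightarrow> \<exists>x'. returning (m * K) (int m * \<kappa>) (x m) x' \<and> \<not> returning K \<kappa> (x m) x'"
    by metis
  define P where "P = {p::nat. prime p \<and> p > m0}"
  have "infinite P"
  proof
    assume "finite P"
    then have "finite (P \<union> {..m0})" by simp
    moreover have "{p::nat. prime p} \<subseteq> P \<union> {..m0}" by (auto simp: P_def)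
    ultimately show False using primes_infinite finite_subset by blast
  qed
  moreover have "inj_on (\<lambda>p. curve_mod1 (x p)) P"
  proof (rule inj_onI, rule ccontr)
    fix p q assume p: "p \<in> P" and q: "q \<in> P" and eq: "curve_mod1 (x p) = curve_mod1 (x q)" and ne: "p \<noteq> q"
    obtain k :: int where k: "\<And>t. x q t = x p t + of_int k" using eq unfolding curve_mod1_eq_iff by blast
    obtain x' where x': "returning (p * K) (int p * \<kappa>) (x p) x'" "\<not> returning K \<kappa> (x p) x'"
      using x p by (auto simp: P_def)
    obtain y' where "returning (q * K) (int q * \<kappa>) (x q) y'" using x q by (auto simp: P_def)
    then have "\<And>t. x q (t + real (q * K) * T0) = x q t + of_int (int q * \<kappa>)" by (rule returningD(2))
    then have "\<And>t. x p (t + real (q * K) * T0) = x p t + of_int (int q * \<kappa>)" unfolding k by simp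
    then have "returning (q * K) (int q * \<kappa>) (x p) x'" using returningD(1)[OF x'(1)] by (simp add: returning_def)
    moreover have "coprime p q" using p q ne by (auto simp: P_def intro: primes_coprime)
    moreover have "p \<ge> 1" using p by (simp add: P_def prime_ge_1_nat)
    ultimately show False using returning_coprime[OF x'(1)] x'(2) by blast
  qed
  ultimately have "infinite ((\<lambda>p. curve_mod1 (x p)) ` P)" by (simp add: finite_image_iff)
  moreover have "(\<lambda>p. curve_mod1 (x p)) ` P \<subseteq>
      {curve_mod1 x |x x' m. m \<ge> 1 \<and> returning (m * K) (int m * \<kappa>) x x' \<and> \<not> returning K \<kappa> x x'}"
  proof (rule image_subsetI)
    fix p assume p: "p \<in> P"
    then have "p > m0" "p \<ge> 1" by (auto simp: P_def prime_ge_1_nat)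
    then show "curve_mod1 (x p) \<in>
      {curve_mod1 x |x x' m. m \<ge> 1 \<and> returning (m * K) (int m * \<kappa>) x x' \<and> \<not> returning K \<kappa> x x'}"
      using x[of p] by blast
  qed
  ultimately show ?thesis using finite_subset by blast
qed

end

text \<open>The number \<open>L\<close> dominates both rates, and \<open>n > T * L\<close> gives
  \<open>L * \<tau> \<le> 1\<close>. The first condition then holds because \<open>exp 1\<close> is
  below 4.\<close>

lemma short_step_exists:
  fixes T M :: real
  assumes "T > 0" "M \<ge> 0"
  obtains n \<tau> where "real n * \<tau> = T" "\<tau> > 0" "exp ((2 + 2 * M\<^sup>2) * \<tau>) \<le> 4" "4 * M * \<tau> \<le> 1"
proof -
  define L where "L = (2 + 2 * M\<^sup>2) + 4 * M"
  have L: "L > 0" "2 + 2 * M\<^sup>2 \<le> L" "4 * M \<le> L" using assms(2) by (auto simp: L_def add_pos_nonneg)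
  define n where "n = Suc (nat \<lceil>T * L\<rceil>)"
  define \<tau> where "\<tau> = T / n"
  have "T * L \<le> real (nat \<lceil>T * L\<rceil>)" by (rule real_nat_ceiling_ge)
  then have n: "real n > 0" "T * L \<le> real n" by (simp_all add: n_def)
  have \<tau>: "\<tau> > 0" "L * \<tau> \<le> 1" using n assms(1) by (simp_all add: \<tau>_def field_simps)
  have le: "(2 + 2 * M\<^sup>2) * \<tau> \<le> 1" "4 * M * \<tau> \<le> 1"
    using mult_right_mono[OF L(2), of \<tau>] mult_right_mono[OF L(3), of \<tau>] \<tau> by linarith+
  have "exp ((2 + 2 * M\<^sup>2) * \<tau>) \<le> exp 1" using le(1) by simp
  then have "exp ((2 + 2 * M\<^sup>2) * \<tau>) \<le> 4" using exp_le by linarith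
  moreover have "real n * \<tau> = T" using n(1) by (simp add: \<tau>_def)
  ultimately show ?thesis using that \<tau>(1) le(2) by blast
qed

theorem theorem3:
  fixes V :: "real \<Rightarrow> real \<Rightarrow> real" and T0 :: real
  assumes "T0 > 0"
    and "C2_cylinder V"
    and "minimal_time_period V T0"
    and "non_resonant_equation V T0"
  shows "\<forall>(\<rho>::real) (k1::int) (k2::nat).
           k2 \<ge> 1 \<and> coprime k1 (int k2) \<and> \<rho> = of_int k1 / (real k2 * T0) \<longrightarrow>
             (\<exists>r::nat. r > 0 \<and> finite (fundamental_solutions V T0 \<rho>) \<and>
                       card (fundamental_solutions V T0 \<rho>) = 2 * r) \<and>
             infinite (non_fundamental_solutions V T0 \<rho>)"
proof -
  note C2 = C2_fun_partial_derivatives[OF assms(2)[unfolded C2_cylinder_def, THEN conjunct1]]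
  have V_shift: "V t (x + 1) = V t x" for t x using assms(2) by (simp add: C2_cylinder_def)
  have V_time: "V (t + T0) x = V t x" for t x
    using assms(3) by (simp add: minimal_time_period_def time_period_def)
  have Vx_shift: "V_x V t (x + 1) = V_x V t x" for t x
  proof -
    have "((\<lambda>u. V t (u + 1)) has_real_derivative V_x V t (x + 1)) (at x)" by (rule DERIV_shift[THEN iffD1, OF C2(4)])
    then have "(V t has_real_derivative V_x V t (x + 1)) (at x)" by (simp only: V_shift)
    then show ?thesis using C2(4) DERIV_unique by blast
  qed
  have Vxx_shift: "V_xx V t (x + 1) = V_xx V t x" for t x
  proof -
    have "((\<lambda>u. V_x V t (u + 1)) has_real_derivative V_xx V t (x + 1)) (at x)" by (rule DERIV_shift[THEN iffD1, OF C2(5)])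
    then have "(V_x V t has_real_derivative V_xx V t (x + 1)) (at x)" by (simp only: Vx_shift)
    then show ?thesis using C2(5) DERIV_unique by blast
  qed
  have Vt: "V (t + T0) = V t" for t using V_time by auto
  have Vx_time: "V_x V (t + T0) x = V_x V t x" for t x by (simp add: V_x_def Vt)
  have Vxt: "V_x V (t + T0) = V_x V t" for t using Vx_time by auto
  have Vxx_time: "V_xx V (t + T0) x = V_xx V t x" for t x by (simp add: V_xx_def Vxt)
  obtain B1 where B1: "\<And>t x. \<bar>V t x\<bar> \<le> B1"
    by (rule doubly_periodic_bounded[OF C2(1) assms(1) V_time V_shift]) (rule that)
  obtain B2 where B2: "\<And>t x. \<bar>V_x V t x\<bar> \<le> B2"
    by (rule doubly_periodic_bounded[OF C2(2) assms(1) Vx_time Vx_shift]) (rule that)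
  obtain M where M: "\<And>t x. \<bar>V_xx V t x\<bar> \<le> M"
    by (rule doubly_periodic_bounded[OF C2(3) assms(1) Vxx_time Vxx_shift]) (rule that)
  have M0: "M \<ge> 0" using M[of 0 0] by linarith
  obtain n \<tau> where \<tau>: "real n * \<tau> = T0" "\<tau> > 0" "exp ((2 + 2 * M\<^sup>2) * \<tau>) \<le> 4" "4 * M * \<tau> \<le> 1"
    by (rule short_step_exists[OF assms(1) M0])
  interpret P: periodic_potential V "V_x V" "V_xx V" T0 M "max B1 B2"
    by unfold_locales
       (rule assms(1) C2 V_shift Vx_shift V_time Vx_time M order_trans[OF B1 max.cobounded1] order_trans[OF B2 max.cobounded2])+
  have solves_iff: "solves V x \<longleftrightarrow> (\<exists>x'. ode2_solution P.force x x')" for x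
  proof
    assume s: "solves V x"
    then have "deriv (deriv x) t = - V_x V t (x t)" for t unfolding solves_def by (metis add_eq_0_iff2)
    then show "\<exists>x'. ode2_solution P.force x x'"
      using C2_fun_ode2_solution[of x P.force] s unfolding solves_def by blast
  next
    assume "\<exists>x'. ode2_solution P.force x x'"
    then obtain x' where x: "ode2_solution P.force x x'" by blast
    have "continuous_on UNIV (\<lambda>t. P.force t (x t))"
      by (rule P.continuous_on_f_compose[OF ode2_solution_continuous(1)[OF x]])
    from ode2_solution_C2_fun[OF x this] show "solves V x" by (simp add: solves_def)
  qed
  have curves: "solution_curve V c \<and> c \<in> C2_curves T0 \<kappa> K \<longleftrightarrow>
      (\<exists>x x'. c = curve_mod1 x \<and> ode2_solution P.force x x' \<and> (\<forall>t. x (t + real K * T0) = x t + of_int \<kappa>))" for c \<kappa> K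
  proof
    assume c: "solution_curve V c \<and> c \<in> C2_curves T0 \<kappa> K"
    then obtain x y where x: "c = curve_mod1 x" "solves V x"
      and y: "c = curve_mod1 y" "\<And>t. y (t + real K * T0) = y t + of_int \<kappa>"
      unfolding solution_curve_def C2_curves_def by blast
    \<comment> \<open>Being a solution and returning may be witnessed by different lifts of the
      curve. They differ by an integer, which cancels in the return condition.\<close>
    obtain k :: int where k: "\<And>t. y t = x t + of_int k" using x(1) y(1) curve_mod1_eq_iff by metis
    have "x (t + real K * T0) = x t + of_int \<kappa>" for t using y(2)[of t] unfolding k by simp
    then show "\<exists>x x'. c = curve_mod1 x \<and> ode2_solution P.force x x' \<and> (\<forall>t. x (t + real K * T0) = x t + of_int \<kappa>)"
      using x solves_iff by blast
  next
    assume "\<exists>x x'. c = curve_mod1 x \<and> ode2_solution P.force x x' \<and> (\<forall>t. x (t + real K * T0) = x t + of_int \<kappa>)"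
    then obtain x where x: "c = curve_mod1 x" "solves V x" "\<And>t. x (t + real K * T0) = x t + of_int \<kappa>"
      using solves_iff by blast
    have "C2_fun x" using x(2) by (simp add: solves_def)
    then show "solution_curve V c \<and> c \<in> C2_curves T0 \<kappa> K"
      using x unfolding solution_curve_def C2_curves_def by blast
  qed
  interpret P: nonresonant_potential V "V_x V" "V_xx V" T0 M "max B1 B2" \<tau> n
  proof
    fix K :: nat and \<kappa> x x' y y' t
    assume K: "1 \<le> K" and x: "ode2_solution P.force x x'" "\<And>t. x (t + real K * T0) = x t + of_int \<kappa>"
      and y: "ode2_solution (\<lambda>t y. - V_xx V t (x t) * y) y y'" "\<And>t. y (t + real K * T0) = y t"
    have "solution_curve V (curve_mod1 x) \<and> curve_mod1 x \<in> C2_curves T0 \<kappa> K"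
      unfolding curves using x by blast
    then have "periodic_solution V T0 (curve_mod1 x)" using K unfolding periodic_solution_def by blast
    then have nr: "non_resonant_solution V (curve_mod1 x)" using assms(4) unfolding non_resonant_equation_def by blast
    have "continuous_on UNIV (\<lambda>t. (\<lambda>(t, x). V_xx V t x) (t, x t))"
      by (intro continuous_on_compose2[OF C2(3)] continuous_on_Pair continuous_on_id ode2_solution_continuous(1)[OF x(1)]) auto
    then have "continuous_on UNIV (\<lambda>t. - V_xx V t (x t) * y t)"
      using ode2_solution_continuous(1)[OF y(1)] by (intro continuous_intros) auto
    from ode2_solution_C2_fun[OF y(1) this]
    have "C2_fun y \<and> (\<forall>t. deriv (deriv y) t + V_xx V t (x t) * y t = 0)" by simp
    moreover have "\<exists>T>0. \<forall>t. y (t + T) = y t" using y(2) K assms(1) by (intro exI[of _ "real K * T0"]) simp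
    moreover have "x \<in> curve_mod1 x" by (auto simp: curve_mod1_def intro: exI[of _ 0])
    ultimately show "y t = 0" using nr unfolding non_resonant_solution_def by blast
  qed (use \<tau> in auto)
  have curves': "solution_curve V c \<and> c \<in> C2_curves T0 \<kappa> K \<longleftrightarrow> (\<exists>x x'. c = curve_mod1 x \<and> P.returning K \<kappa> x x')" for c \<kappa> K
    unfolding curves P.returning_def by blast
  show ?thesis
  proof (intro allI impI)
    fix \<rho> :: real and k1 :: int and k2 :: nat
    assume "k2 \<ge> 1 \<and> coprime k1 (int k2) \<and> \<rho> = of_int k1 / (real k2 * T0)"
    then have k: "k2 \<ge> 1" "coprime k1 (int k2)" "\<rho> = of_int k1 / (real k2 * T0)" by auto
    \<comment> \<open>The frequency determines its reduced fraction, so the existential pair in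
      \<open>fundamental\<close> can only be \<open>k1\<close> and \<open>k2\<close>.\<close>
    have fund: "fundamental T0 c \<rho> \<longleftrightarrow> c \<in> C2_curves T0 k1 k2" for c
      unfolding fundamental_def using k reduced_fraction_unique[OF assms(1) k(1) _ k(2)] by metis
    have "fundamental_solutions V T0 \<rho> = {curve_mod1 x |x x'. P.returning k2 k1 x x'}"
    proof (intro set_eqI iffI)
      fix c assume "c \<in> fundamental_solutions V T0 \<rho>"
      then have "solution_curve V c \<and> c \<in> C2_curves T0 k1 k2"
        by (auto simp: fundamental_solutions_def fund periodic_solution_def)
      then show "c \<in> {curve_mod1 x |x x'. P.returning k2 k1 x x'}" unfolding curves' by blast
    next
      fix c assume "c \<in> {curve_mod1 x |x x'. P.returning k2 k1 x x'}"
      then have "solution_curve V c \<and> c \<in> C2_curves T0 k1 k2" unfolding curves' by blast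
      then show "c \<in> fundamental_solutions V T0 \<rho>"
        using k unfolding fundamental_solutions_def fund periodic_solution_def has_rotation_frequency_def by blast
    qed
    then have F: "fundamental_solutions V T0 \<rho> = P.return_curve ` P.return_zeros k2 k1"
      by (simp only: P.return_curves)
    have fin: "finite (P.return_zeros k2 k1)" by (rule P.finite_return_zeros[OF k(1)])
    have card: "card (fundamental_solutions V T0 \<rho>) = card (P.return_zeros k2 k1)"
      unfolding F by (rule card_image[OF P.inj_on_return_curve])
    obtain r where r: "card (P.return_zeros k2 k1) = 2 * r"
      using P.even_card_return_zeros[OF k(1), of k1] by (elim evenE)
    have "card (P.return_zeros k2 k1) \<noteq> 0" using fin P.return_zeros_nonempty[OF k(1)] by simp
    then have "r > 0" using r by simp
    then have 1: "\<exists>r::nat. r > 0 \<and> finite (fundamental_solutions V T0 \<rho>) \<and> card (fundamental_solutions V T0 \<rho>) = 2 * r"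
      using r card fin F by auto
    have "{curve_mod1 x |x x' m. m \<ge> 1 \<and> P.returning (m * k2) (int m * k1) x x' \<and> \<not> P.returning k2 k1 x x'}
        \<subseteq> non_fundamental_solutions V T0 \<rho>"
    proof
      fix c assume "c \<in> {curve_mod1 x |x x' m. m \<ge> 1 \<and> P.returning (m * k2) (int m * k1) x x' \<and> \<not> P.returning k2 k1 x x'}"
      then obtain x x' m where c: "c = curve_mod1 x" and m: "m \<ge> 1"
        and x: "P.returning (m * k2) (int m * k1) x x'" "\<not> P.returning k2 k1 x x'" by blast
      have s: "solution_curve V c \<and> c \<in> C2_curves T0 (int m * k1) (m * k2)"
        unfolding curves' using c x(1) by blast
      have mk: "m * k2 \<ge> 1" using m k(1) by simp
      have \<rho>: "\<rho> = of_int (int m * k1) / (real (m * k2) * T0)" using k(3) m by simp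
      have "\<not> fundamental T0 c \<rho>"
      proof
        assume "fundamental T0 c \<rho>"
        then have "solution_curve V c \<and> c \<in> C2_curves T0 k1 k2" using s by (simp add: fund)
        then obtain y y' where y: "c = curve_mod1 y" "P.returning k2 k1 y y'" unfolding curves' by blast
        obtain l :: int where l: "\<And>t. y t = x t + of_int l" using c y(1) curve_mod1_eq_iff by metis
        have "x (t + real k2 * T0) = x t + of_int k1" for t
          using P.returningD(2)[OF y(2), of t] unfolding l by simp
        then show False using x(2) P.returningD(1)[OF x(1)] by (simp add: P.returning_def)
      qed
      then show "c \<in> non_fundamental_solutions V T0 \<rho>"
        using s mk \<rho> unfolding non_fundamental_solutions_def periodic_solution_def has_rotation_frequency_def by blast
    qed
    then have 2: "infinite (non_fundamental_solutions V T0 \<rho>)"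
      using P.new_curves_infinite[OF k(1), of k1] finite_subset by blast
    show "(\<exists>r::nat. r > 0 \<and> finite (fundamental_solutions V T0 \<rho>) \<and> card (fundamental_solutions V T0 \<rho>) = 2 * r) \<and>
        infinite (non_fundamental_solutions V T0 \<rho>)" using 1 2 by blast
  qed
qed

end
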